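(* Let $\mathcal M$ be a model of a $b$-minimal theory, with main sort $M$. Let $Y$ and $X\subset M^n\times Y$ be definable sets. Then there exists a finite partition of $X$ into cells over $Y$.
   Context: **Conventions.** Languages are first-order and many-sorted, with a unique main sort and a distinguished collection of auxiliary sorts; the universe of the main sort of $\mathcal M$ is denoted $M$. "Definable" means definable with parameters (from any sorts); "$A$-definable" means definable with parameters in $A$. A point is a singleton. A definable set is auxiliary if it is a subset of a finite Cartesian product of universes of auxiliary sorts. The zeroth Cartesian power of any sort is one fixed $\emptyset$-definable point. **Balls.** $\mathcal L_B$ is the language with one predicate $B$, interpreted in a model $\mathcal M$ as a nonempty set $B(\mathcal M)\subset A_B\times M$, with $A_B$ a finite Cartesian product of sorts of $\mathcal M$. For $a\in A_B$ put $B(a)=\{m\in M\mid (a,m)\in B(\mathcal M)\}$; if $B(a)$ is nonempty it is called a ball. **$b$-minimality.** Let $\mathcal L$ be an expansion of $\mathcal L_B$. An $\mathcal L$-model $\mathcal M$ is $b$-minimal if for every set of parameters $A$ (from any sorts), every $A$-definable $X\subset M$ and every $A$-definable $F:X\to M$: (b1) there is an $A$-definable function $f:X\to S$ with $S$ auxiliary such that for each $s\in f(X)$ the fiber $f^{-1}(s)$ is a point or a ball; (b2) if $g$ is a definable function from an auxiliary set to a ball, then $g$ is not surjective; (b3) there is an $A$-definable function $f:X\to S$ with $S$ auxiliary such that for each $s\in f(X)$ the restriction $F_{|f^{-1}(s)}$ is injective or constant. An $\mathcal L$-theory is $b$-minimal if all its models are $b$-minimal (the theory need not be complete). **Cells over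 $Y$.** A function into $S\times Y$ is "over $Y$" if it commutes with the projections to $Y$. For $X\subset M\times Y$ definable and $f:X\to S\times Y$ definable over $Y$ with $S$ auxiliary, $X$ is a $(1)$-cell (resp. $(0)$-cell) over $Y$ with presentation $f$ if all nonempty fibers of $f$, identified with subsets of $M$ by projecting on the $M$-coordinate, are balls (resp. points). Inductively, for $n\ge 2$ and $(j_1,\dots,j_n)\in\{0,1\}^n$, a definable set $X\subset M^n\times Y$ is a $(j_1,\dots,j_n)$-cell over $Y$ with presentation $f:X\to S\times Y$ (a definable function over $Y$, $S$ auxiliary) if, with $p:M^n\times Y\to M^{n-1}\times Y$ the coordinate projection $(x_1,\dots,x_n,y)\mapsto(x_1,\dots,x_{n-1},y)$: for each $(\hat x,y)\in p(X)$ the fiber $X\cap p^{-1}(\hat x,y)$, identified with a subset of $M$ via the coordinate $x_n$, is a $(j_n)$-cell with presentation $x_n\mapsto f(\hat x,x_n,y)$, and $p(X)$ is a $(j_1,\dots,j_{n-1})$-cell over $Y$ with some presentation $f':p(X)\to S'\times Y$ satisfying $f'\circ p=p'\circ f$ for some definable $p':S\times Y\to S'\times Y$. (An ordering of the coordinates of $M^n$ is fixed.) A cell over $Y$ is a $(j_1,\dots,j_n)$-cell over $Y$ for some $(j_1,\dots,j_n)$ and some presentation. *)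

theory Defs
  imports Main "HOL-Library.Disjoint_Sets"
begin

section \<open>Many-sorted first-order logic\<close>

text \<open>
  The sorts of a language are all elements of \<open>'s\<close> and its relation symbols are all elements of
  \<open>'r\<close>; there is no loss in this, since both kinds of symbols always exist here (the main sort and
  the ball predicate). A language may have no function symbols, so the function symbols are only
  the \<open>f\<close> with \<open>fun_sig L f \<noteq> None\<close>. Constants are function symbols without arguments.
\<close>

record ('s, 'f, 'r) lang =
  fun_sig :: "'f \<Rightarrow> ('s list \<times> 's) option"
  rel_sig :: "'r \<Rightarrow> 's list"
  main_sort :: 's
  aux_sorts :: "'s set"
  ball_rel :: 'r

text \<open>
  Expansions of the language of balls: the predicate \<open>ball_rel\<close> is a subset of a finite product of
  sorts times the main sort.
\<close>

definition language :: "('s, 'f, 'r) lang \<Rightarrow> bool" where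
  "language L \<longleftrightarrow>
     main_sort L \<notin> aux_sorts L \<and> (\<exists>\<sigma>. rel_sig L (ball_rel L) = \<sigma> @ [main_sort L])"

definition ball_sorts :: "('s, 'f, 'r) lang \<Rightarrow> 's list" where
  "ball_sorts L = butlast (rel_sig L (ball_rel L))"

text \<open>A variable is a pair of its sort and an index.\<close>

type_synonym 's var = "'s \<times> nat"

datatype ('s, 'f) trm = Var "'s var" | Fun 'f "('s, 'f) trm list"

datatype ('s, 'f, 'r) fm =
    Eq "('s, 'f) trm" "('s, 'f) trm"
  | Rel 'r "('s, 'f) trm list"
  | Neg "('s, 'f, 'r) fm"
  | Conj "('s, 'f, 'r) fm" "('s, 'f, 'r) fm"
  | Ex "'s var" "('s, 'f, 'r) fm"

inductive has_sort :: "('s, 'f, 'r) lang \<Rightarrow> ('s, 'f) trm \<Rightarrow> 's \<Rightarrow> bool" for L where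
  has_sort_Var: "has_sort L (Var v) (fst v)"
| has_sort_Fun: "fun_sig L f = Some (\<sigma>, s) \<Longrightarrow> list_all2 (has_sort L) ts \<sigma> \<Longrightarrow>
    has_sort L (Fun f ts) s"

primrec wf_fm :: "('s, 'f, 'r) lang \<Rightarrow> ('s, 'f, 'r) fm \<Rightarrow> bool" where
  "wf_fm L (Eq t u) \<longleftrightarrow> (\<exists>s. has_sort L t s \<and> has_sort L u s)"
| "wf_fm L (Rel r ts) \<longleftrightarrow> list_all2 (has_sort L) ts (rel_sig L r)"
| "wf_fm L (Neg \<phi>) \<longleftrightarrow> wf_fm L \<phi>"
| "wf_fm L (Conj \<phi> \<psi>) \<longleftrightarrow> wf_fm L \<phi> \<and> wf_fm L \<psi>"
| "wf_fm L (Ex v \<phi>) \<longleftrightarrow> wf_fm L \<phi>"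

primrec fv_trm :: "('s, 'f) trm \<Rightarrow> 's var set" where
  "fv_trm (Var v) = {v}"
| "fv_trm (Fun f ts) = \<Union> (set (map fv_trm ts))"

primrec fv :: "('s, 'f, 'r) fm \<Rightarrow> 's var set" where
  "fv (Eq t u) = fv_trm t \<union> fv_trm u"
| "fv (Rel r ts) = \<Union> (set (map fv_trm ts))"
| "fv (Neg \<phi>) = fv \<phi>"
| "fv (Conj \<phi> \<psi>) = fv \<phi> \<union> fv \<psi>"
| "fv (Ex v \<phi>) = fv \<phi> - {v}"

text \<open>The universes of different sorts need not be disjoint.\<close>

record ('s, 'f, 'r, 'u) struct =
  univ :: "'s \<Rightarrow> 'u set"
  fun_int :: "'f \<Rightarrow> 'u list \<Rightarrow> 'u"
  rel_int :: "'r \<Rightarrow> 'u list set"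

definition tuples :: "('s, 'f, 'r, 'u) struct \<Rightarrow> 's list \<Rightarrow> 'u list set" where
  "tuples M \<sigma> = {xs. list_all2 (\<lambda>x s. x \<in> univ M s) xs \<sigma>}"

definition is_struct :: "('s, 'f, 'r) lang \<Rightarrow> ('s, 'f, 'r, 'u) struct \<Rightarrow> bool" where
  "is_struct L M \<longleftrightarrow>
     (\<forall>s. univ M s \<noteq> {}) \<and>
     (\<forall>f \<sigma> s. fun_sig L f = Some (\<sigma>, s) \<longrightarrow> (\<forall>xs\<in>tuples M \<sigma>. fun_int M f xs \<in> univ M s)) \<and>
     (\<forall>r. rel_int M r \<subseteq> tuples M (rel_sig L r)) \<and>
     rel_int M (ball_rel L) \<noteq> {}"

definition assignment :: "('s, 'f, 'r, 'u) struct \<Rightarrow> ('s var \<Rightarrow> 'u) \<Rightarrow> bool" where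
  "assignment M e \<longleftrightarrow> (\<forall>v. e v \<in> univ M (fst v))"

primrec val :: "('s, 'f, 'r, 'u) struct \<Rightarrow> ('s var \<Rightarrow> 'u) \<Rightarrow> ('s, 'f) trm \<Rightarrow> 'u" where
  "val M e (Var v) = e v"
| "val M e (Fun f ts) = fun_int M f (map (val M e) ts)"

primrec sat :: "('s, 'f, 'r, 'u) struct \<Rightarrow> ('s var \<Rightarrow> 'u) \<Rightarrow> ('s, 'f, 'r) fm \<Rightarrow> bool" where
  "sat M e (Eq t u) \<longleftrightarrow> val M e t = val M e u"
| "sat M e (Rel r ts) \<longleftrightarrow> map (val M e) ts \<in> rel_int M r"
| "sat M e (Neg \<phi>) \<longleftrightarrow> \<not> sat M e \<phi>"
| "sat M e (Conj \<phi> \<psi>) \<longleftrightarrow> sat M e \<phi> \<and> sat M e \<psi>"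
| "sat M e (Ex v \<phi>) \<longleftrightarrow> (\<exists>x\<in>univ M (fst v). sat M (e(v := x)) \<phi>)"

definition is_theory :: "('s, 'f, 'r) lang \<Rightarrow> ('s, 'f, 'r) fm set \<Rightarrow> bool" where
  "is_theory L T \<longleftrightarrow> (\<forall>\<phi>\<in>T. wf_fm L \<phi> \<and> fv \<phi> = {})"

definition is_model ::
  "('s, 'f, 'r) lang \<Rightarrow> ('s, 'f, 'r) fm set \<Rightarrow> ('s, 'f, 'r, 'u) struct \<Rightarrow> bool" where
  "is_model L T M \<longleftrightarrow> is_struct L M \<and> (\<forall>\<phi>\<in>T. \<forall>e. assignment M e \<longrightarrow> sat M e \<phi>)"


section \<open>Definable sets and functions\<close>

text \<open>
  A parameter is an element together with the sort it is taken from. The sort has to be recorded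
  because universes may overlap.
\<close>

definition params :: "('s, 'f, 'r, 'u) struct \<Rightarrow> ('s \<times> 'u) set" where
  "params M = {(s, x). x \<in> univ M s}"

text \<open>
  \<open>X\<close> is an \<open>A\<close>-definable subset of the product of the sorts \<open>\<sigma>\<close>. The formula \<open>\<phi>\<close> has the object
  variables \<open>vs\<close>; \<open>e\<close> gives its other free variables values in \<open>A\<close>.
\<close>

definition definable :: "('s, 'f, 'r) lang \<Rightarrow> ('s, 'f, 'r, 'u) struct \<Rightarrow> ('s \<times> 'u) set \<Rightarrow>
    's list \<Rightarrow> 'u list set \<Rightarrow> bool" where
  "definable L M A \<sigma> X \<longleftrightarrow>
     (\<exists>\<phi> vs e. wf_fm L \<phi> \<and> distinct vs \<and> map fst vs = \<sigma> \<and> assignment M e \<and>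
        (\<forall>v\<in>fv \<phi> - set vs. (fst v, e v) \<in> A) \<and>
        X = {map e' vs |e'. assignment M e' \<and> (\<forall>v. v \<notin> set vs \<longrightarrow> e' v = e v) \<and> sat M e' \<phi>})"

text \<open>
  \<open>f\<close> restricts to an \<open>A\<close>-definable function from \<open>X\<close> (of sorts \<open>\<sigma>\<close>) to \<open>Z\<close> (of sorts \<open>\<rho>\<close>); its values
  outside \<open>X\<close> are irrelevant.
\<close>

definition definable_fun :: "('s, 'f, 'r) lang \<Rightarrow> ('s, 'f, 'r, 'u) struct \<Rightarrow> ('s \<times> 'u) set \<Rightarrow>
    's list \<Rightarrow> 's list \<Rightarrow> 'u list set \<Rightarrow> 'u list set \<Rightarrow> ('u list \<Rightarrow> 'u list) \<Rightarrow> bool" where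
  "definable_fun L M A \<sigma> \<rho> X Z f \<longleftrightarrow>
     X \<subseteq> tuples M \<sigma> \<and> Z \<subseteq> tuples M \<rho> \<and> f ` X \<subseteq> Z \<and> definable L M A (\<sigma> @ \<rho>) {x @ f x |x. x \<in> X}"

text \<open>
  \<open>S\<close> is an auxiliary set, of sorts \<open>\<rho>\<close>. The list \<open>\<rho>\<close> may be empty, which is the case of a zeroth
  Cartesian power, represented by \<open>{[]}\<close>.
\<close>

definition aux_set :: "('s, 'f, 'r) lang \<Rightarrow> ('s, 'f, 'r, 'u) struct \<Rightarrow> 's list \<Rightarrow> 'u list set \<Rightarrow> bool"
  where "aux_set L M \<rho> S \<longleftrightarrow> set \<rho> \<subseteq> aux_sorts L \<and> definable L M (params M) \<rho> S"


section \<open>b-minimality\<close>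

definition is_ball :: "('s, 'f, 'r) lang \<Rightarrow> ('s, 'f, 'r, 'u) struct \<Rightarrow> 'u set \<Rightarrow> bool" where
  "is_ball L M C \<longleftrightarrow>
     (\<exists>a\<in>tuples M (ball_sorts L). C = {m \<in> univ M (main_sort L). a @ [m] \<in> rel_int M (ball_rel L)})
     \<and> C \<noteq> {}"

text \<open>Below, subsets of the main sort occur as sets of one-element lists.\<close>

definition b1 :: "('s, 'f, 'r) lang \<Rightarrow> ('s, 'f, 'r, 'u) struct \<Rightarrow> ('s \<times> 'u) set \<Rightarrow> 'u list set \<Rightarrow> bool"
  where
  "b1 L M A X \<longleftrightarrow>
     (\<exists>\<rho> S f. aux_set L M \<rho> S \<and> definable_fun L M A [main_sort L] \<rho> X S f \<and>
        (\<forall>s\<in>f ` X. is_singleton {m. [m] \<in> X \<and> f [m] = s} \<or> is_ball L M {m. [m] \<in> X \<and> f [m] = s}))"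

definition b2 :: "('s, 'f, 'r) lang \<Rightarrow> ('s, 'f, 'r, 'u) struct \<Rightarrow> bool" where
  "b2 L M \<longleftrightarrow>
     (\<forall>\<rho> S C g. aux_set L M \<rho> S \<and> is_ball L M C \<and>
        definable_fun L M (params M) \<rho> [main_sort L] S ((\<lambda>m. [m]) ` C) g \<longrightarrow>
        g ` S \<noteq> (\<lambda>m. [m]) ` C)"

definition b3 :: "('s, 'f, 'r) lang \<Rightarrow> ('s, 'f, 'r, 'u) struct \<Rightarrow> ('s \<times> 'u) set \<Rightarrow> 'u list set \<Rightarrow>
    ('u list \<Rightarrow> 'u list) \<Rightarrow> bool" where
  "b3 L M A X F \<longleftrightarrow>
     (\<exists>\<rho> S f. aux_set L M \<rho> S \<and> definable_fun L M A [main_sort L] \<rho> X S f \<and>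
        (\<forall>s\<in>f ` X. inj_on F {x \<in> X. f x = s} \<or> (\<exists>c. \<forall>x\<in>{x \<in> X. f x = s}. F x = c)))"

definition b_minimal :: "('s, 'f, 'r) lang \<Rightarrow> ('s, 'f, 'r, 'u) struct \<Rightarrow> bool" where
  "b_minimal L M \<longleftrightarrow>
     (\<forall>A X F. A \<subseteq> params M \<and> definable L M A [main_sort L] X \<and>
        definable_fun L M A [main_sort L] [main_sort L] X (tuples M [main_sort L]) F \<longrightarrow>
        b1 L M A X \<and> b2 L M \<and> b3 L M A X F)"

text \<open>
  All models of \<open>T\<close> are b-minimal. HOL cannot quantify over types inside a formula, so the models
  range over the structures with universes in one type \<open>'w\<close>. This is b-minimality of \<open>T\<close> as soon as
  \<open>'w\<close> has at least as many elements as there are formulas: a failure of (b1), (b2) or (b3)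
  involves finitely many parameters and is inherited by every elementary substructure containing
  them, so by the downward Loewenheim-Skolem theorem a model that is not b-minimal yields one that
  fits into \<open>'w\<close>.
\<close>

definition b_minimal_theory ::
  "'w itself \<Rightarrow> ('s, 'f, 'r) lang \<Rightarrow> ('s, 'f, 'r) fm set \<Rightarrow> bool" where
  "b_minimal_theory _ L T \<longleftrightarrow> (\<forall>N :: ('s, 'f, 'r, 'w) struct. is_model L T N \<longrightarrow> b_minimal L N)"

text \<open>
  A type that is large enough in this sense for every \<open>'u\<close>, and that also has room for the
  ultrapowers, indexed by lists of formulas, of a structure with universes in \<open>'u\<close>.
\<close>

type_synonym ('s, 'f, 'r, 'u) big = "('s, 'f, 'r) fm list \<Rightarrow> 'u option"


section \<open>Cells\<close>

text \<open>
  For \<open>Y\<close> of sorts \<open>\<tau>\<close>, a subset of \<open>M\<^sup>n \<times> Y\<close> is a set of concatenations \<open>xs @ y\<close> with \<open>length xs = n\<close>.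
  The next definition says that \<open>f\<close> is a definable function over \<open>Y\<close> from \<open>X \<subseteq> M\<^sup>n \<times> Y\<close> to \<open>S \<times> Y\<close>,
  with \<open>S\<close> auxiliary of sorts \<open>\<rho>\<close>.
\<close>

definition prod_set :: "'u list set \<Rightarrow> 'u list set \<Rightarrow> 'u list set" where
  "prod_set S Y = {s @ y |s y. s \<in> S \<and> y \<in> Y}"

definition main_power :: "('s, 'f, 'r) lang \<Rightarrow> nat \<Rightarrow> 's list" where
  "main_power L n = replicate n (main_sort L)"

definition fun_over :: "('s, 'f, 'r) lang \<Rightarrow> ('s, 'f, 'r, 'u) struct \<Rightarrow> 's list \<Rightarrow> 'u list set \<Rightarrow>
    nat \<Rightarrow> 'u list set \<Rightarrow> 's list \<Rightarrow> 'u list set \<Rightarrow> ('u list \<Rightarrow> 'u list) \<Rightarrow> bool" where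
  "fun_over L M \<tau> Y n X \<rho> S f \<longleftrightarrow>
     definable L M (params M) \<tau> Y \<and>
     definable L M (params M) (main_power L n @ \<tau>) X \<and>
     X \<subseteq> prod_set (tuples M (main_power L n)) Y \<and>
     aux_set L M \<rho> S \<and>
     definable_fun L M (params M) (main_power L n @ \<tau>) (\<rho> @ \<tau>) X (prod_set S Y) f \<and>
     (\<forall>z\<in>X. drop (length \<rho>) (f z) = drop n z)"

text \<open>\<open>X \<subseteq> M \<times> Y\<close> is a \<open>(j)\<close>-cell over \<open>Y\<close> with presentation \<open>f : X \<rightarrow> S \<times> Y\<close>.\<close>

definition cell1 :: "('s, 'f, 'r) lang \<Rightarrow> ('s, 'f, 'r, 'u) struct \<Rightarrow> 's list \<Rightarrow> 'u list set \<Rightarrow>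
    nat \<Rightarrow> 'u list set \<Rightarrow> 's list \<Rightarrow> 'u list set \<Rightarrow> ('u list \<Rightarrow> 'u list) \<Rightarrow> bool" where
  "cell1 L M \<tau> Y j X \<rho> S f \<longleftrightarrow>
     fun_over L M \<tau> Y 1 X \<rho> S f \<and>
     (j = 0 \<and> (\<forall>t\<in>f ` X. is_singleton {m. \<exists>y. m # y \<in> X \<and> f (m # y) = t}) \<or>
      j = 1 \<and> (\<forall>t\<in>f ` X. is_ball L M {m. \<exists>y. m # y \<in> X \<and> f (m # y) = t}))"

definition drop_coord :: "nat \<Rightarrow> 'u list \<Rightarrow> 'u list" where
  "drop_coord n z = take (n - 1) z @ drop n z"

text \<open>
  \<open>X\<close> is a \<open>js\<close>-cell over \<open>Y\<close> with presentation \<open>f : X \<rightarrow> S \<times> Y\<close>. In the inductive step the fiber of \<open>X\<close>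
  over \<open>(x, y)\<close> is a cell with the presentation \<open>m \<mapsto> f (x, m, y)\<close>, whose values lie in \<open>S \<times> {y}\<close>;
  it is therefore taken as a cell over the point \<open>{y}\<close>.
\<close>

inductive cell :: "('s, 'f, 'r) lang \<Rightarrow> ('s, 'f, 'r, 'u) struct \<Rightarrow> 's list \<Rightarrow> 'u list set \<Rightarrow>
    nat list \<Rightarrow> 'u list set \<Rightarrow> 's list \<Rightarrow> 'u list set \<Rightarrow> ('u list \<Rightarrow> 'u list) \<Rightarrow> bool"
  for L M \<tau> Y where
  cell_base: "cell1 L M \<tau> Y j X \<rho> S f \<Longrightarrow> cell L M \<tau> Y [j] X \<rho> S f"
| cell_step:
    "\<lbrakk> n = length js + 1; j \<in> {0, 1};
       fun_over L M \<tau> Y n X \<rho> S f;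
       \<And>x y. \<lbrakk> length x = n - 1; x @ y \<in> drop_coord n ` X \<rbrakk> \<Longrightarrow>
         cell1 L M \<tau> {y} j {m # y |m. x @ m # y \<in> X} \<rho> S (\<lambda>z. f (x @ z));
       cell L M \<tau> Y js (drop_coord n ` X) \<rho>' S' f';
       definable_fun L M (params M) (\<rho> @ \<tau>) (\<rho>' @ \<tau>) (prod_set S Y) (prod_set S' Y) p';
       \<forall>z\<in>X. f' (drop_coord n z) = p' (f z) \<rbrakk>
     \<Longrightarrow> cell L M \<tau> Y (js @ [j]) X \<rho> S f"

definition is_cell_over :: "('s, 'f, 'r) lang \<Rightarrow> ('s, 'f, 'r, 'u) struct \<Rightarrow> nat \<Rightarrow> 's list \<Rightarrow>
    'u list set \<Rightarrow> 'u list set \<Rightarrow> bool" where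
  "is_cell_over L M n \<tau> Y X \<longleftrightarrow> (\<exists>js \<rho> S f. length js = n \<and> cell L M \<tau> Y js X \<rho> S f)"

end

theory Submission
  imports Defs
begin

text \<open>
  Only (b1) is needed. By compactness, carried out in an ultrapower indexed by finite lists of
  formulas, finitely many formulas provide the functions of (b1) for all members of a definable
  family of subsets of \<open>M\<close>. Applied to the family of fibers of \<open>X\<close> over the remaining coordinates, this
  cuts \<open>X\<close> into finitely many pieces which are unions of points or of balls along the last
  coordinate. The projections of the pieces are partitioned into cells by induction. Over such a
  cell a piece is again a cell: its presentation is extended by the presentation of the projection,
  which leaves the fibers over a point of the projection unchanged and makes \<open>p'\<close> a coordinate
  projection.
\<close>

section \<open>Formulas and substitution of values\<close>

text \<open>The obstacle is that (b1) speaks of one subset of \<open>M\<close> at a time, so the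
  function it gives for the fiber over \<open>y\<close> may vary with \<open>y\<close> without any
  bound. Two features make a uniform choice possible. The function is definable over the parameters
  that define the fiber, so it comes from a formula in which \<open>y\<close> is a variable and
  which has no parameters beyond those of the family. And that such a formula does what (b1) asks is
  a first-order condition on \<open>y\<close>, because balls are given by a predicate of the
  language. A parameter bad for all formulas at once would live in another model of the theory, so
  b-minimality of \<open>M\<close> alone would not suffice for this argument.

  A presentation from (b1) may mix points with balls, whereas a cell has one type; being the only
  point of a fiber is definable, so one cut separates the two. Moreover the presentation of a cell
  has to determine that of its projection. The function from (b1) need not do this, since it may
  take equal values over base points which the cell below distinguishes; this forces the
  presentation to be enlarged.\<close>

definition upd :: "('s var \<Rightarrow> 'u) \<Rightarrow> 's var list \<Rightarrow> 'u list \<Rightarrow> 's var \<Rightarrow> 'u" where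
  "upd e vs xs v = (case map_of (zip vs xs) v of None \<Rightarrow> e v | Some x \<Rightarrow> x)"

lemma upd_Nil [simp]: "upd e [] xs = e" "upd e vs [] = e"
  by (auto simp: upd_def fun_eq_iff)

lemma upd_Cons: "upd e (v # vs) (x # xs) = (upd e vs xs)(v := x)"
  by (auto simp: upd_def fun_eq_iff)

lemma upd_notin: "v \<notin> set vs \<Longrightarrow> upd e vs xs v = e v"
proof -
  assume "v \<notin> set vs"
  then have "map_of (zip vs xs) v = None"
    by (metis map_of_eq_None_iff set_zip_leftD imageE prod.collapse)
  then show ?thesis by (simp add: upd_def)
qed

lemma upd_nth: "distinct vs \<Longrightarrow> length xs = length vs \<Longrightarrow> i < length vs \<Longrightarrow> upd e vs xs (vs ! i) = xs ! i"
  by (simp add: upd_def map_of_zip_nth)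

lemma map_upd: "distinct vs \<Longrightarrow> length xs = length vs \<Longrightarrow> map (upd e vs xs) vs = xs"
  by (simp add: list_eq_iff_nth_eq upd_nth)

lemma map_upd_disjoint: "set us \<inter> set vs = {} \<Longrightarrow> map (upd e vs xs) us = map e us"
proof -
  assume "set us \<inter> set vs = {}"
  then have "u \<notin> set vs" if "u \<in> set us" for u using that by blast
  then show ?thesis by (simp add: upd_notin)
qed

lemma upd_append:
  "length xs = length vs \<Longrightarrow> upd e (vs @ ws) (xs @ ys) = upd (upd e ws ys) vs xs"
  by (induction vs xs rule: list_induct2') (auto simp: upd_Cons)

lemma upd_append_swap:
  assumes "length xs = length vs" "set vs \<inter> set ws = {}"
  shows "upd (upd e ws ys) vs xs = upd (upd e vs xs) ws ys"
  using assms
proof (induction vs xs rule: list_induct2')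
  case (4 v vs x xs)
  then have "(upd (upd e vs xs) ws ys)(v := x) = upd ((upd e vs xs)(v := x)) ws ys"
    by (auto simp: fun_eq_iff upd_def split: option.splits dest!: map_of_SomeD set_zip_leftD)
  with 4 show ?case by (simp add: upd_Cons del: fun_upd_apply)
qed auto

lemma upd_eqI:
  assumes "distinct vs" "length xs = length vs" "map E vs = xs" "\<And>v. v \<notin> set vs \<Longrightarrow> E v = e v"
  shows "upd e vs xs = E"
proof
  fix v show "upd e vs xs v = E v"
  proof (cases "v \<in> set vs")
    case True
    then obtain i where "i < length vs" "v = vs ! i" by (auto simp: in_set_conv_nth)
    with assms show ?thesis by (auto simp: upd_nth)
  qed (simp add: assms upd_notin)
qed

section \<open>Dependence on the free variables\<close>

lemma val_cong: "(\<And>v. v \<in> fv_trm t \<Longrightarrow> e v = e' v) \<Longrightarrow> val M e t = val M e' t"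
proof (induction t)
  case (Fun f ts)
  then have "map (val M e) ts = map (val M e') ts" by auto
  then show ?case by (metis val.simps(2))
qed auto

lemma sat_cong: "(\<And>v. v \<in> fv \<phi> \<Longrightarrow> e v = e' v) \<Longrightarrow> sat M e \<phi> \<longleftrightarrow> sat M e' \<phi>"
proof (induction \<phi> arbitrary: e e')
  case (Eq t u)
  have "val M e t = val M e' t" "val M e u = val M e' u" by (rule val_cong, simp add: Eq)+
  then show ?case by simp
next
  case (Rel r ts)
  then have "map (val M e) ts = map (val M e') ts" by (auto intro!: val_cong)
  then show ?case by (metis sat.simps(2))
next
  case (Ex v \<phi>)
  have "sat M (e(v := x)) \<phi> \<longleftrightarrow> sat M (e'(v := x)) \<phi>" for x
    by (rule Ex.IH) (use Ex.prems in auto)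
  then show ?case by simp
next
  case (Neg \<phi>)
  have "sat M e \<phi> \<longleftrightarrow> sat M e' \<phi>" by (rule Neg.IH) (simp add: Neg.prems)
  then show ?case by simp
next
  case (Conj \<phi> \<psi>)
  have "sat M e \<phi> \<longleftrightarrow> sat M e' \<phi>" by (rule Conj.IH) (simp add: Conj.prems)
  moreover have "sat M e \<psi> \<longleftrightarrow> sat M e' \<psi>" by (rule Conj.IH) (simp add: Conj.prems)
  ultimately show ?case by simp
qed

lemma finite_fv_trm [simp]: "finite (fv_trm t)"
  by (induction t) auto

lemma finite_fv [simp]: "finite (fv \<phi>)"
  by (induction \<phi>) auto

section \<open>Renaming and fresh variables\<close>

primrec ren_trm :: "('s var \<Rightarrow> 's var) \<Rightarrow> ('s, 'f) trm \<Rightarrow> ('s, 'f) trm" where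
  "ren_trm \<pi> (Var v) = Var (\<pi> v)"
| "ren_trm \<pi> (Fun f ts) = Fun f (map (ren_trm \<pi>) ts)"

text \<open>Bound variables are renamed along with the free ones, so an injective \<pi> cannot cause
  capture and no substitution machinery is required.\<close>

primrec ren :: "('s var \<Rightarrow> 's var) \<Rightarrow> ('s, 'f, 'r) fm \<Rightarrow> ('s, 'f, 'r) fm" where
  "ren \<pi> (Eq t u) = Eq (ren_trm \<pi> t) (ren_trm \<pi> u)"
| "ren \<pi> (Rel r ts) = Rel r (map (ren_trm \<pi>) ts)"
| "ren \<pi> (Neg \<phi>) = Neg (ren \<pi> \<phi>)"
| "ren \<pi> (Conj \<phi> \<psi>) = Conj (ren \<pi> \<phi>) (ren \<pi> \<psi>)"
| "ren \<pi> (Ex v \<phi>) = Ex (\<pi> v) (ren \<pi> \<phi>)"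

lemma val_ren: "val M e (ren_trm \<pi> t) = val M (e \<circ> \<pi>) t"
proof (induction t)
  case (Fun f ts)
  then have "map (val M e) (map (ren_trm \<pi>) ts) = map (val M (e \<circ> \<pi>)) ts"
    by (simp del: o_apply add: o_apply[of "val M e"])
  then show ?case by (metis ren_trm.simps(2) val.simps(2))
qed auto

lemma sat_ren:
  assumes "inj \<pi>" "\<And>v. fst (\<pi> v) = fst v"
  shows "sat M e (ren \<pi> \<phi>) \<longleftrightarrow> sat M (e \<circ> \<pi>) \<phi>"
proof (induction \<phi> arbitrary: e)
  case (Rel r ts)
  have "map (val M e) (map (ren_trm \<pi>) ts) = map (val M (e \<circ> \<pi>)) ts" by (simp add: val_ren)
  then show ?case by (metis ren.simps(2) sat.simps(2))
next
  case (Ex v \<phi>)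
  \<comment> \<open>Injectivity enters here: otherwise the update at \<open>\<pi> v\<close> would
    change other variables as well.\<close>
  have "e(\<pi> v := x) \<circ> \<pi> = (e \<circ> \<pi>)(v := x)" for x
    using assms(1) by (auto simp: fun_eq_iff inj_eq)
  then show ?case using Ex by (simp add: assms(2) del: o_apply fun_upd_apply)
qed (auto simp: val_ren)

lemma fv_ren_trm: "fv_trm (ren_trm \<pi> t) = \<pi> ` fv_trm t"
  by (induction t) auto

lemma fv_ren: "inj \<pi> \<Longrightarrow> fv (ren \<pi> \<phi>) = \<pi> ` fv \<phi>"
  by (induction \<phi>) (auto simp: fv_ren_trm inj_eq)

lemma has_sort_ren:
  assumes "\<And>v. fst (\<pi> v) = fst v"
  shows "has_sort L t s \<Longrightarrow> has_sort L (ren_trm \<pi> t) s"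
proof (induction rule: has_sort.induct)
  case (has_sort_Var v)
  then show ?case by (metis assms has_sort.has_sort_Var ren_trm.simps(1))
next
  case (has_sort_Fun f \<sigma> s ts)
  then have "list_all2 (has_sort L) (map (ren_trm \<pi>) ts) \<sigma>"
    by (simp add: list_all2_conv_all_nth)
  with has_sort_Fun(1) show ?case by (auto intro: has_sort.has_sort_Fun)
qed

lemma wf_ren:
  assumes "\<And>v. fst (\<pi> v) = fst v"
  shows "wf_fm L \<phi> \<Longrightarrow> wf_fm L (ren \<pi> \<phi>)"
proof (induction \<phi>)
  case (Rel r ts)
  then show ?case using has_sort_ren[of \<pi> L, OF assms] by (simp add: list_all2_conv_all_nth)
qed (use has_sort_ren[of \<pi> L, OF assms] in auto)

text \<open>The indices lie above all those in \<open>V\<close>, whatever the sort, and increase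
  along the list, so repeated sorts cause no clash. The inserted 0 keeps \<open>Max\<close>
  meaningful for empty \<open>V\<close>.\<close>

definition fresh :: "'s var set \<Rightarrow> 's list \<Rightarrow> 's var list" where
  "fresh V \<sigma> = map (\<lambda>i. (\<sigma> ! i, Suc (Max (insert 0 (snd ` V))) + i)) [0..<length \<sigma>]"

lemma map_fst_fresh [simp]: "map fst (fresh V \<sigma>) = \<sigma>"
  by (simp add: fresh_def o_def map_nth)

lemma length_fresh [simp]: "length (fresh V \<sigma>) = length \<sigma>"
  by (simp add: fresh_def)

lemma distinct_fresh [simp]: "distinct (fresh V \<sigma>)"
  by (auto simp: fresh_def distinct_map inj_on_def)

lemma fresh_disjoint: "finite V \<Longrightarrow> set (fresh V \<sigma>) \<inter> V = {}"
proof -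
  assume "finite V"
  then have "snd v \<le> Max (insert 0 (snd ` V))" if "v \<in> V" for v using that by auto
  then show ?thesis by (fastforce simp: fresh_def)
qed

text \<open>The matching of \<open>vs\<close> with \<open>ws\<close> has to be extended to an
  injection on all variables, because \<open>ren\<close> also acts on bound ones. Every other
  variable keeps its sort and is shifted by an amount \<open>?K\<close> exceeding all indices in
  \<open>W\<close> and \<open>ws\<close>.\<close>

lemma ex_renaming:
  fixes vs ws :: "'s var list"
  assumes "distinct vs" "distinct ws" "map fst vs = map fst ws" "finite W"
  shows "\<exists>\<pi>. inj \<pi> \<and> (\<forall>v. fst (\<pi> v) = fst v) \<and> map \<pi> vs = ws \<and> (\<forall>v. v \<notin> set vs \<longrightarrow> \<pi> v \<notin> W \<union> set ws)"
proof -
  let ?K = "Suc (Max (insert 0 (snd ` (W \<union> set ws))))"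
  let ?h = "map_of (zip vs ws)"
  define \<pi> where "\<pi> v = (case ?h v of None \<Rightarrow> (fst v, snd v + ?K) | Some w \<Rightarrow> w)" for v
  have len: "length vs = length ws" using assms(3) by (metis length_map)
  have nth: "\<pi> (vs ! i) = ws ! i" if "i < length vs" for i
    using assms(1) len that by (simp add: \<pi>_def map_of_zip_nth)
  have out: "\<pi> v = (fst v, snd v + ?K)" if "v \<notin> set vs" for v
  proof -
    have "?h v = None" using that by (metis map_of_eq_None_iff set_zip_leftD imageE prod.collapse)
    then show ?thesis by (simp add: \<pi>_def)
  qed
  have big: "(s, k + ?K) \<notin> W \<union> set ws" for s k
  proof
    assume "(s, k + ?K) \<in> W \<union> set ws"
    then have "k + ?K \<in> insert 0 (snd ` (W \<union> set ws))" by (metis image_eqI insertCI snd_conv)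
    then have "k + ?K \<le> Max (insert 0 (snd ` (W \<union> set ws)))" using assms(4) by (intro Max_ge) auto
    then show False by simp
  qed
  have "inj \<pi>"
  proof (rule injI)
    fix u v assume eq: "\<pi> u = \<pi> v"
    have no: False if "a \<in> set vs" "b \<notin> set vs" "\<pi> a = \<pi> b" for a b
    proof -
      obtain i where "i < length vs" "a = vs ! i" using \<open>a \<in> set vs\<close> by (auto simp: in_set_conv_nth)
      then have "\<pi> a \<in> set ws" using nth len by auto
      moreover have "\<pi> a \<notin> set ws" unfolding that(3) out[OF that(2)] using big[of "fst b" "snd b"] by blast
      ultimately show False by blast
    qed
    consider "u \<in> set vs" "v \<in> set vs" | "u \<notin> set vs" "v \<notin> set vs" using no[of u v] no[of v u] eq by auto
    then show "u = v"
    proof cases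
      case 1
      then obtain i j where "i < length vs" "u = vs ! i" "j < length vs" "v = vs ! j"
        by (auto simp: in_set_conv_nth)
      then show ?thesis using nth eq len assms(2) by (auto simp: nth_eq_iff_index_eq)
    next
      case 2
      then show ?thesis using eq by (simp add: out prod_eq_iff)
    qed
  qed
  moreover have "fst (\<pi> v) = fst v" for v
  proof (cases "v \<in> set vs")
    case True
    then obtain i where i: "i < length vs" "v = vs ! i" by (auto simp: in_set_conv_nth)
    then show ?thesis using nth assms(3) len by (metis nth_map)
  qed (simp add: out)
  moreover have "map \<pi> vs = ws" using nth len by (auto simp: list_eq_iff_nth_eq)
  moreover have "\<pi> v \<notin> W \<union> set ws" if "v \<notin> set vs" for v
    unfolding out[OF that] by (rule big)
  ultimately show ?thesis by blast
qed

section \<open>Tuples and assignments\<close>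

lemma tuples_Nil [simp]: "xs \<in> tuples M [] \<longleftrightarrow> xs = []"
  by (simp add: tuples_def)

lemma tuples_Cons: "xs \<in> tuples M (s # \<sigma>) \<longleftrightarrow> (\<exists>x ys. xs = x # ys \<and> x \<in> univ M s \<and> ys \<in> tuples M \<sigma>)"
  by (auto simp: tuples_def list_all2_Cons2)

lemma bex_tuples_Cons:
  "(\<exists>xs\<in>tuples M (s # \<sigma>). P xs) \<longleftrightarrow> (\<exists>x\<in>univ M s. \<exists>xs\<in>tuples M \<sigma>. P (x # xs))"
  unfolding Bex_def tuples_Cons by metis

lemma tuples_append: "xs \<in> tuples M (\<sigma> @ \<rho>) \<longleftrightarrow> (\<exists>ys zs. xs = ys @ zs \<and> ys \<in> tuples M \<sigma> \<and> zs \<in> tuples M \<rho>)"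
  by (auto simp: tuples_def list_all2_append2 dest: list_all2_lengthD)

lemma tuples_length: "xs \<in> tuples M \<sigma> \<Longrightarrow> length xs = length \<sigma>"
  by (auto simp: tuples_def dest: list_all2_lengthD)

lemma tuples_append_iff:
  "xs @ ys \<in> tuples M (\<sigma> @ \<rho>) \<longleftrightarrow> xs \<in> tuples M \<sigma> \<and> ys \<in> tuples M \<rho>" if "length xs = length \<sigma>"
  using that by (auto simp: tuples_def list_all2_append)

lemma assignment_map: "assignment M e \<Longrightarrow> map e vs \<in> tuples M (map fst vs)"
  by (auto simp: assignment_def tuples_def list_all2_conv_all_nth simp del: split_paired_All)

lemma assignment_upd:
  assumes "assignment M e" "xs \<in> tuples M (map fst vs)"
  shows "assignment M (upd e vs xs)"
  using assms(2)
  by (induction vs arbitrary: xs) (use assms(1) in \<open>auto simp: tuples_Cons upd_Cons assignment_def\<close>)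

section \<open>Derived connectives and blocks of quantifiers\<close>

definition Forall :: "'s var \<Rightarrow> ('s, 'f, 'r) fm \<Rightarrow> ('s, 'f, 'r) fm" where
  "Forall v \<phi> = Neg (Ex v (Neg \<phi>))"

definition Imp :: "('s, 'f, 'r) fm \<Rightarrow> ('s, 'f, 'r) fm \<Rightarrow> ('s, 'f, 'r) fm" where
  "Imp \<phi> \<psi> = Neg (Conj \<phi> (Neg \<psi>))"

definition Disj :: "('s, 'f, 'r) fm \<Rightarrow> ('s, 'f, 'r) fm \<Rightarrow> ('s, 'f, 'r) fm" where
  "Disj \<phi> \<psi> = Neg (Conj (Neg \<phi>) (Neg \<psi>))"

definition Iff :: "('s, 'f, 'r) fm \<Rightarrow> ('s, 'f, 'r) fm \<Rightarrow> ('s, 'f, 'r) fm" where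
  "Iff \<phi> \<psi> = Conj (Imp \<phi> \<psi>) (Imp \<psi> \<phi>)"

definition Exs :: "'s var list \<Rightarrow> ('s, 'f, 'r) fm \<Rightarrow> ('s, 'f, 'r) fm" where
  "Exs = foldr Ex"

definition Alls :: "'s var list \<Rightarrow> ('s, 'f, 'r) fm \<Rightarrow> ('s, 'f, 'r) fm" where
  "Alls = foldr Forall"

text \<open>The fold starts from truth, coded as an equation of a variable with itself; the variable
  must have some sort, hence \<open>undefined\<close>. \<open>Eqs [] []\<close> therefore also
  serves as a true formula.\<close>

definition Eqs :: "'s var list \<Rightarrow> 's var list \<Rightarrow> ('s, 'f, 'r) fm" where
  "Eqs us vs = foldr (\<lambda>(u, v). Conj (Eq (Var u) (Var v))) (zip us vs)
     (Eq (Var (undefined, 0)) (Var (undefined, 0)))"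

lemma sat_connectives [simp]:
  "sat M e (Forall v \<phi>) \<longleftrightarrow> (\<forall>x\<in>univ M (fst v). sat M (e(v := x)) \<phi>)"
  "sat M e (Imp \<phi> \<psi>) \<longleftrightarrow> (sat M e \<phi> \<longrightarrow> sat M e \<psi>)"
  "sat M e (Disj \<phi> \<psi>) \<longleftrightarrow> sat M e \<phi> \<or> sat M e \<psi>"
  "sat M e (Iff \<phi> \<psi>) \<longleftrightarrow> (sat M e \<phi> \<longleftrightarrow> sat M e \<psi>)"
  by (auto simp: Forall_def Imp_def Disj_def Iff_def)

lemma wf_connectives [simp]:
  "wf_fm L (Forall v \<phi>) \<longleftrightarrow> wf_fm L \<phi>"
  "wf_fm L (Imp \<phi> \<psi>) \<longleftrightarrow> wf_fm L \<phi> \<and> wf_fm L \<psi>"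
  "wf_fm L (Disj \<phi> \<psi>) \<longleftrightarrow> wf_fm L \<phi> \<and> wf_fm L \<psi>"
  "wf_fm L (Iff \<phi> \<psi>) \<longleftrightarrow> wf_fm L \<phi> \<and> wf_fm L \<psi>"
  by (auto simp: Forall_def Imp_def Disj_def Iff_def)

lemma wf_quantifiers [simp]:
  "wf_fm L (Exs vs \<phi>) \<longleftrightarrow> wf_fm L \<phi>" "wf_fm L (Alls vs \<phi>) \<longleftrightarrow> wf_fm L \<phi>"
  by (induction vs) (auto simp: Exs_def Alls_def)

lemma has_sort_Var_iff [simp]: "has_sort L (Var v) s \<longleftrightarrow> s = fst v"
  by (auto intro: has_sort.intros elim: has_sort.cases)

lemma wf_Eqs [simp]: "map fst us = map fst vs \<Longrightarrow> wf_fm L (Eqs us vs)"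
  by (induction us vs rule: list_induct2') (auto simp: Eqs_def)

lemma sat_Exs:
  assumes "distinct vs"
  shows "sat M e (Exs vs \<phi>) \<longleftrightarrow> (\<exists>xs\<in>tuples M (map fst vs). sat M (upd e vs xs) \<phi>)"
  using assms
proof (induction vs arbitrary: e)
  case (Cons v vs)
  \<comment> \<open>\<open>Exs\<close> assigns the head of the list first and \<open>upd\<close>
    assigns it last; distinctness makes the two orders agree.\<close>
  have "upd (e(v := x)) vs xs = (upd e vs xs)(v := x)" for x xs
  proof
    fix w show "upd (e(v := x)) vs xs w = ((upd e vs xs)(v := x)) w"
      using Cons.prems by (cases "w = v") (simp add: upd_notin, simp add: upd_def split: option.split)
  qed
  moreover have "Exs (v # vs) \<phi> = Ex v (Exs vs \<phi>)" by (simp add: Exs_def)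
  ultimately have "sat M e (Exs (v # vs) \<phi>) \<longleftrightarrow>
      (\<exists>x\<in>univ M (fst v). \<exists>xs\<in>tuples M (map fst vs). sat M ((upd e vs xs)(v := x)) \<phi>)"
    using Cons by (simp del: fun_upd_apply)
  also have "\<dots> \<longleftrightarrow> (\<exists>xs\<in>tuples M (map fst (v # vs)). sat M (upd e (v # vs) xs) \<phi>)"
    by (simp add: bex_tuples_Cons upd_Cons)
  finally show ?case .
qed (simp add: Exs_def)

lemma sat_Alls:
  assumes "distinct vs"
  shows "sat M e (Alls vs \<phi>) \<longleftrightarrow> (\<forall>xs\<in>tuples M (map fst vs). sat M (upd e vs xs) \<phi>)"
proof -
  have "sat M e (Alls vs \<phi>) \<longleftrightarrow> \<not> sat M e (Exs vs (Neg \<phi>))" for e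
    by (induction vs arbitrary: e) (auto simp: Alls_def Exs_def)
  then show ?thesis by (simp add: sat_Exs[OF assms])
qed

lemma sat_Eqs [simp]: "length us = length vs \<Longrightarrow> sat M e (Eqs us vs) \<longleftrightarrow> map e us = map e vs"
  by (induction us vs rule: list_induct2') (auto simp: Eqs_def)

section \<open>Sets defined by formulas\<close>

definition dset :: "('s, 'f, 'r, 'u) struct \<Rightarrow> ('s var \<Rightarrow> 'u) \<Rightarrow> 's var list \<Rightarrow> ('s, 'f, 'r) fm \<Rightarrow>
    'u list set" where
  "dset M e vs \<phi> = {xs \<in> tuples M (map fst vs). sat M (upd e vs xs) \<phi>}"

lemma dset_eq:
  assumes "assignment M e" "distinct vs"
  shows "{map e' vs |e'. assignment M e' \<and> (\<forall>v. v \<notin> set vs \<longrightarrow> e' v = e v) \<and> sat M e' \<phi>} = dset M e vs \<phi>"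
    (is "?L = _")
proof (intro set_eqI iffI)
  fix xs assume "xs \<in> ?L"
  then obtain e' where e': "xs = map e' vs" "assignment M e'" "\<forall>v. v \<notin> set vs \<longrightarrow> e' v = e v"
    "sat M e' \<phi>" by blast
  have "upd e vs xs = e'" by (rule upd_eqI) (use e' assms in auto)
  with e' show "xs \<in> dset M e vs \<phi>" by (simp add: dset_def assignment_map)
next
  fix xs assume xs: "xs \<in> dset M e vs \<phi>"
  then have len: "length xs = length vs" by (auto simp: dset_def dest: tuples_length)
  show "xs \<in> ?L"
    using xs len assms
    by (auto intro!: exI[of _ "upd e vs xs"] simp: dset_def assignment_upd map_upd upd_notin)
qed

lemma definable_iff:
  "definable L M A \<sigma> X \<longleftrightarrow> (\<exists>\<phi> vs e. wf_fm L \<phi> \<and> distinct vs \<and> map fst vs = \<sigma> \<and> assignment M e \<and>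
     (\<forall>v\<in>fv \<phi> - set vs. (fst v, e v) \<in> A) \<and> X = dset M e vs \<phi>)"
proof -
  have "(assignment M e \<and> distinct vs \<and> X = {map e' vs |e'. assignment M e' \<and> (\<forall>v. v \<notin> set vs \<longrightarrow> e' v = e v) \<and> sat M e' \<phi>}) \<longleftrightarrow>
     (assignment M e \<and> distinct vs \<and> X = dset M e vs \<phi>)" for \<phi> vs e
    using dset_eq[of M e vs \<phi>] by auto
  then show ?thesis unfolding definable_def by (metis (no_types, lifting))
qed

lemma definable_subset: "definable L M A \<sigma> X \<Longrightarrow> X \<subseteq> tuples M \<sigma>"
  by (auto simp: definable_iff dset_def)

lemma assignment_params: "assignment M e \<Longrightarrow> (fst v, e v) \<in> params M"
  by (simp add: assignment_def params_def del: split_paired_All)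

lemma definable_dset:
  "wf_fm L \<phi> \<Longrightarrow> distinct vs \<Longrightarrow> assignment M e \<Longrightarrow> definable L M (params M) (map fst vs) (dset M e vs \<phi>)"
  unfolding definable_iff by (metis assignment_params)

text \<open>Renaming puts the object variables wherever they are wanted and moves the parameter
  variables off \<open>W\<close>. With \<open>W\<close> the variables of another formula, two
  definitions can be merged under one assignment.\<close>

lemma definable_obtain:
  assumes "definable L M (params M) \<sigma> X" "distinct ws" "map fst ws = \<sigma>" "finite W"
  obtains \<phi> e where "wf_fm L \<phi>" "assignment M e" "fv \<phi> \<inter> W \<subseteq> set ws" "X = dset M e ws \<phi>"
proof -
  obtain \<phi> vs e where \<phi>: "wf_fm L \<phi>" "distinct vs" "map fst vs = \<sigma>" "assignment M e" "X = dset M e vs \<phi>"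
    using assms(1) unfolding definable_iff by blast
  obtain \<pi> where \<pi>: "inj \<pi>" "\<And>v. fst (\<pi> v) = fst v" "map \<pi> vs = ws"
    "\<And>v. v \<notin> set vs \<Longrightarrow> \<pi> v \<notin> W \<union> set ws"
    using ex_renaming[of vs ws W] \<phi>(2,3) assms(2-4) by metis
  \<comment> \<open>The assignment is transported along the renaming; outside the range of \<pi> any
    value of the right sort would do.\<close>
  define e' where "e' v = (if v \<in> range \<pi> then e (inv \<pi> v) else e v)" for v
  have e'\<pi>: "e' (\<pi> v) = e v" for v using \<pi>(1) by (simp add: e'_def)
  have ass: "assignment M e'"
    using \<phi>(4) \<pi>(2) unfolding assignment_def e'_def by (metis f_inv_into_f)
  have "dset M e vs \<phi> = dset M e' ws (ren \<pi> \<phi>)"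
  proof -
    have "sat M (upd e' ws xs) (ren \<pi> \<phi>) \<longleftrightarrow> sat M (upd e vs xs) \<phi>" if "xs \<in> tuples M \<sigma>" for xs
    proof -
      have len: "length xs = length vs" "length ws = length vs"
        using that \<phi>(3) \<pi>(3) by (auto dest: tuples_length)
      have "upd e vs xs = upd e' ws xs \<circ> \<pi>"
      proof (rule upd_eqI)
        show "map (upd e' ws xs \<circ> \<pi>) vs = xs"
          using map_upd[of ws xs e'] assms(2) len \<pi>(3) by (metis map_map)
      qed (use \<phi> len e'\<pi> \<pi>(4) in \<open>auto simp: upd_notin\<close>)
      then show ?thesis by (simp add: sat_ren \<pi>)
    qed
    then show ?thesis using \<phi>(3) assms(3) by (auto simp: dset_def)
  qed
  moreover have "fv (ren \<pi> \<phi>) \<inter> W \<subseteq> set ws"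
  proof
    fix w assume "w \<in> fv (ren \<pi> \<phi>) \<inter> W"
    then obtain v where v: "w = \<pi> v" "\<pi> v \<in> W" unfolding fv_ren[OF \<pi>(1)] by blast
    then have "v \<in> set vs" using \<pi>(4)[of v] by blast
    then show "w \<in> set ws" using v(1) \<pi>(3) by (metis image_eqI set_map)
  qed
  ultimately show ?thesis using that[of "ren \<pi> \<phi>" e'] \<phi> ass wf_ren[OF \<pi>(2)] by metis
qed

text \<open>
  Several parameter variables of the given formula may need the same variable in \<open>V\<close>, so they are not
  renamed but quantified away and equated with variables in \<open>V\<close>.
\<close>

lemma definable_dset_obtain:
  assumes "definable L M A \<sigma> X" "assignment M e" "\<And>a. a \<in> A \<Longrightarrow> \<exists>v\<in>V. a = (fst v, e v)" "finite V"
    and ws: "distinct ws" "map fst ws = \<sigma>" "set ws \<inter> V = {}"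
  obtains \<phi> where "wf_fm L \<phi>" "X = dset M e ws \<phi>"
proof -
  obtain \<phi> vs e0 where \<phi>: "wf_fm L \<phi>" "distinct vs" "map fst vs = \<sigma>" "assignment M e0"
    "\<And>v. v \<in> fv \<phi> - set vs \<Longrightarrow> (fst v, e0 v) \<in> A" "X = dset M e0 vs \<phi>"
    using assms(1) unfolding definable_iff by blast
  obtain \<pi> where \<pi>: "inj \<pi>" "\<And>v. fst (\<pi> v) = fst v" "map \<pi> vs = ws"
    "\<And>v. v \<notin> set vs \<Longrightarrow> \<pi> v \<notin> V \<union> set ws"
    using ex_renaming[of vs ws V] \<phi>(2,3) assms(4-6) by metis
  obtain us where us: "set us = fv \<phi> - set vs" "distinct us"
    using finite_distinct_list[of "fv \<phi> - set vs"] by auto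
  have "\<exists>w\<in>V. fst v = fst w \<and> e0 v = e w" if "v \<in> set us" for v
  proof -
    have "(fst v, e0 v) \<in> A" using that \<phi>(5) us(1) by simp
    from assms(3)[OF this] show ?thesis by auto
  qed
  then have "\<forall>v\<in>set us. \<exists>w. w \<in> V \<and> fst v = fst w \<and> e0 v = e w" by blast
  from bchoice[OF this] obtain g where
    g: "\<And>v. v \<in> set us \<Longrightarrow> g v \<in> V \<and> fst v = fst (g v) \<and> e0 v = e (g v)" by blast
  define \<chi> where "\<chi> = Exs (map \<pi> us) (Conj (Eqs (map \<pi> us) (map g us)) (ren \<pi> \<phi>))"
  have "map fst (map \<pi> us) = map fst (map g us)" using g \<pi>(2) by simp
  then have wf: "wf_fm L \<chi>" unfolding \<chi>_def by (simp add: wf_ren[OF \<pi>(2) \<phi>(1)] del: map_map)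
  have dist: "distinct (map \<pi> us)" using us(2) inj_on_subset[OF \<pi>(1)] by (simp add: distinct_map)
  have dis: "set (map \<pi> us) \<inter> (V \<union> set ws) = {}"
  proof -
    have "\<pi> v \<notin> V \<union> set ws" if "v \<in> set us" for v using that us(1) by (intro \<pi>(4)) simp
    then show ?thesis unfolding set_map by blast
  qed
  have "sat M (upd e ws xs) \<chi> \<longleftrightarrow> sat M (upd e0 vs xs) \<phi>" if "xs \<in> tuples M \<sigma>" for xs
  proof -
    have len: "length xs = length vs" "length ws = length vs"
      using that \<phi>(3) \<pi>(3) by (auto dest: tuples_length)
    let ?E = "\<lambda>a. upd (upd e ws xs) (map \<pi> us) a"
    have gus: "map (?E a) (map g us) = map e0 us" for a
    proof -
      have "?E a (g v) = e0 v" if "v \<in> set us" for v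
      proof -
        have "g v \<in> V" using g[OF that] by simp
        then have "g v \<notin> set (map \<pi> us)" "g v \<notin> set ws" using dis ws(3) by blast+
        then show ?thesis using g[OF that] by (simp add: upd_notin)
      qed
      then show ?thesis by simp
    qed
    have pus: "map (?E a) (map \<pi> us) = a" if "a \<in> tuples M (map fst (map \<pi> us))" for a
      using map_upd[OF dist, of a] that by (auto dest: tuples_length)
    have "map e0 us \<in> tuples M (map fst (map \<pi> us))"
      using assignment_map[OF \<phi>(4), of us] \<pi>(2) by (simp add: o_def)
    then have "sat M (upd e ws xs) \<chi> \<longleftrightarrow> sat M (?E (map e0 us)) (ren \<pi> \<phi>)"
      unfolding \<chi>_def sat_Exs[OF dist] sat.simps using gus pus by (auto simp del: map_map)
    also have "\<dots> \<longleftrightarrow> sat M (?E (map e0 us) \<circ> \<pi>) \<phi>" by (simp add: sat_ren \<pi>)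
    also have "\<dots> \<longleftrightarrow> sat M (upd e0 vs xs) \<phi>"
    proof (rule sat_cong)
      fix v assume v: "v \<in> fv \<phi>"
      show "(?E (map e0 us) \<circ> \<pi>) v = upd e0 vs xs v"
      proof (cases "v \<in> set vs")
        case True
        then obtain i where i: "i < length vs" "v = vs ! i" by (auto simp: in_set_conv_nth)
        then have \<pi>v: "\<pi> v = ws ! i" using \<pi>(3) by (metis nth_map)
        have "\<pi> v \<in> set ws" using True \<pi>(3) by (metis image_eqI set_map)
        then have "\<pi> v \<notin> set (map \<pi> us)" using dis by blast
        then have "(?E (map e0 us) \<circ> \<pi>) v = upd e ws xs (ws ! i)"
          unfolding \<pi>v[symmetric] o_apply by (rule upd_notin)
        also have "\<dots> = upd e0 vs xs v"
          unfolding i(2) using i(1) len ws(1) \<phi>(2) by (simp add: upd_nth)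
        finally show ?thesis .
      next
        case False
        then have "v \<in> set us" using v us(1) by simp
        then obtain i where i: "i < length us" "v = us ! i" by (auto simp: in_set_conv_nth)
        have "?E (map e0 us) (map \<pi> us ! i) = map e0 us ! i" by (rule upd_nth[OF dist]) (simp_all add: i)
        then have "(?E (map e0 us) \<circ> \<pi>) v = e0 v" unfolding o_apply i(2) nth_map[OF i(1)] .
        then show ?thesis using False by (simp add: upd_notin del: o_apply)
      qed
    qed
    finally show ?thesis .
  qed
  then have "X = dset M e ws \<chi>" using \<phi>(3,6) ws(2) by (auto simp: dset_def)
  with wf that show ?thesis by blast
qed

section \<open>Closure properties of definable sets\<close>

abbreviation (input) dfn :: "('s, 'f, 'r) lang \<Rightarrow> ('s, 'f, 'r, 'u) struct \<Rightarrow> 's list \<Rightarrow> 'u list set \<Rightarrow> bool" where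
  "dfn L M \<equiv> definable L M (params M)"

lemma ex_assignment: "is_struct L M \<Longrightarrow> \<exists>e. assignment M e"
proof -
  assume "is_struct L M"
  then have "\<exists>x. x \<in> univ M (fst v)" for v by (simp add: is_struct_def ex_in_conv)
  then show ?thesis unfolding assignment_def by metis
qed

lemma dfnI:
  assumes "wf_fm L \<phi>" "distinct vs" "assignment M e" "map fst vs = \<sigma>" "X \<subseteq> tuples M \<sigma>"
    "\<And>xs. xs \<in> tuples M \<sigma> \<Longrightarrow> xs \<in> X \<longleftrightarrow> sat M (upd e vs xs) \<phi>"
  shows "dfn L M \<sigma> X"
proof -
  have "X = dset M e vs \<phi>" using assms(4-) by (auto simp: dset_def)
  then show ?thesis using definable_dset[OF assms(1-3)] assms(4) by simp
qed

lemma sat_upd_cong: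
  assumes "\<And>v. v \<in> fv \<phi> - set vs \<Longrightarrow> e v = e' v" "length xs = length vs"
  shows "sat M (upd e vs xs) \<phi> \<longleftrightarrow> sat M (upd e' vs xs) \<phi>"
proof (rule sat_cong)
  fix v assume v: "v \<in> fv \<phi>"
  show "upd e vs xs v = upd e' vs xs v"
  proof (cases "v \<in> set vs")
    case True
    then obtain x where "map_of (zip vs xs) v = Some x"
      using map_of_zip_is_Some[of vs xs v] assms(2) by auto
    then show ?thesis by (simp add: upd_def)
  qed (use v assms(1) in \<open>simp add: upd_notin\<close>)
qed

lemma dfn_tuples:
  assumes "is_struct L M"
  shows "dfn L M \<sigma> (tuples M \<sigma>)"
proof -
  obtain e where "assignment M e" using ex_assignment[OF assms] by blast
  then show ?thesis by (intro dfnI[of L "Eqs [] []" "fresh {} \<sigma>" M e]) auto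
qed

lemma dfn_Int:
  assumes "dfn L M \<sigma> X" "dfn L M \<sigma> Y"
  shows "dfn L M \<sigma> (X \<inter> Y)"
proof -
  let ?vs = "fresh {} \<sigma>"
  obtain \<phi> e where \<phi>: "wf_fm L \<phi>" "assignment M e" "X = dset M e ?vs \<phi>"
    using definable_obtain[OF assms(1), of ?vs "{}"] by auto
  obtain \<psi> d where \<psi>: "wf_fm L \<psi>" "assignment M d" "fv \<psi> \<inter> fv \<phi> \<subseteq> set ?vs" "Y = dset M d ?vs \<psi>"
    using definable_obtain[OF assms(2), of ?vs "fv \<phi>"] by auto
  \<comment> \<open>All variables shared by the two formulas are object variables, so a single
    assignment can hold the parameters of both.\<close>
  define E where "E v = (if v \<in> fv \<phi> then e v else d v)" for v
  have "sat M (upd E ?vs xs) \<phi> \<longleftrightarrow> sat M (upd e ?vs xs) \<phi>" if "xs \<in> tuples M \<sigma>" for xs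
    by (rule sat_upd_cong) (use that in \<open>auto simp: E_def tuples_length\<close>)
  moreover have "sat M (upd E ?vs xs) \<psi> \<longleftrightarrow> sat M (upd d ?vs xs) \<psi>" if "xs \<in> tuples M \<sigma>" for xs
  proof (rule sat_upd_cong)
    show "E v = d v" if "v \<in> fv \<psi> - set ?vs" for v
      using that \<psi>(3) by (cases "v \<in> fv \<phi>") (blast, simp add: E_def)
  qed (use that in \<open>simp add: tuples_length\<close>)
  moreover have "assignment M E" using \<phi>(2) \<psi>(2) by (simp add: assignment_def E_def del: split_paired_All)
  ultimately show ?thesis using \<phi>(1,3) \<psi>(1,4)
    by (intro dfnI[of L "Conj \<phi> \<psi>" ?vs M E]) (auto simp: dset_def)
qed

lemma dfn_compl:
  assumes "dfn L M \<sigma> X"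
  shows "dfn L M \<sigma> (tuples M \<sigma> - X)"
proof -
  let ?vs = "fresh {} \<sigma>"
  obtain \<phi> e where \<phi>: "wf_fm L \<phi>" "assignment M e" "X = dset M e ?vs \<phi>"
    using definable_obtain[OF assms(1), of ?vs "{}"] by auto
  then show ?thesis by (intro dfnI[of L "Neg \<phi>" ?vs M e]) (auto simp: dset_def)
qed

lemma dfn_Diff: "dfn L M \<sigma> X \<Longrightarrow> dfn L M \<sigma> Y \<Longrightarrow> dfn L M \<sigma> (X - Y)"
  using dfn_Int[OF _ dfn_compl, of L M \<sigma> X Y] definable_subset[of L M _ \<sigma> X]
  by (metis Diff_Int_distrib2 Int_Diff inf.absorb1)

lemma dfn_Ex:
  assumes "dfn L M (\<sigma> @ \<rho>) X"
  shows "dfn L M \<sigma> {xs \<in> tuples M \<sigma>. \<exists>b\<in>tuples M \<rho>. xs @ b \<in> X}"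
proof -
  define vs where "vs = fresh {} \<sigma>"
  define us where "us = fresh (set vs) \<rho>"
  have disj: "set vs \<inter> set us = {}" using fresh_disjoint[of "set vs" \<rho>] unfolding us_def by auto
  obtain \<phi> e where \<phi>: "wf_fm L \<phi>" "assignment M e" "X = dset M e (vs @ us) \<phi>"
    using definable_obtain[OF assms(1), of "vs @ us" "{}"] disj by (auto simp: vs_def us_def)
  have "xs @ b \<in> X \<longleftrightarrow> sat M (upd (upd e vs xs) us b) \<phi>" if "xs \<in> tuples M \<sigma>" "b \<in> tuples M \<rho>" for xs b
  proof -
    have "length xs = length vs" using that by (simp add: vs_def tuples_length)
    then have "upd e (vs @ us) (xs @ b) = upd (upd e vs xs) us b"
      using upd_append_swap disj by (metis upd_append)
    then show ?thesis using that \<phi>(3) by (auto simp: dset_def tuples_append vs_def us_def)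
  qed
  then show ?thesis using \<phi>(1,2)
    by (intro dfnI[of L "Exs us \<phi>" vs M e]) (auto simp: sat_Exs vs_def us_def)
qed

lemma dfn_singleton:
  assumes "is_struct L M" "c \<in> tuples M \<sigma>"
  shows "dfn L M \<sigma> {c}"
proof -
  define vs where "vs = fresh {} \<sigma>"
  define us where "us = fresh (set vs) \<sigma>"
  have disj: "set us \<inter> set vs = {}" using fresh_disjoint[of "set vs" \<sigma>] unfolding us_def by auto
  obtain e where e: "assignment M e" using ex_assignment assms(1) by blast
  have len: "length c = length us" using assms(2) by (simp add: us_def tuples_length)
  have us: "map (upd (upd e us c) vs xs) us = c" for xs
    unfolding map_upd_disjoint[OF disj] using map_upd[of us c e] len by (simp add: us_def)
  have vs: "map (upd (upd e us c) vs xs) vs = xs" if "xs \<in> tuples M \<sigma>" for xs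
    using map_upd[of vs xs] that by (simp add: vs_def tuples_length)
  show ?thesis
    by (rule dfnI[of L "Eqs vs us" vs M "upd e us c"])
      (use assms e us vs in \<open>auto simp: vs_def us_def assignment_upd\<close>)
qed

lemma append_eq_double: "a @ b = c @ c \<Longrightarrow> length a = length b \<Longrightarrow> a = b"
  by (metis append_eq_append_conv length_append mult_2 nat_mult_eq_cancel1 zero_less_numeral)

lemma dfn_diag:
  assumes "is_struct L M"
  shows "dfn L M (\<sigma> @ \<sigma>) {a @ a |a. a \<in> tuples M \<sigma>}"
proof -
  define vs where "vs = fresh {} \<sigma>"
  define us where "us = fresh (set vs) \<sigma>"
  have disj: "set vs \<inter> set us = {}" using fresh_disjoint[of "set vs" \<sigma>] unfolding us_def by auto
  obtain e where e: "assignment M e" using ex_assignment assms(1) by blast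
  have eq: "map (upd e (vs @ us) (a @ b)) vs = a" "map (upd e (vs @ us) (a @ b)) us = b"
    if "a \<in> tuples M \<sigma>" "b \<in> tuples M \<sigma>" for a b
  proof -
    have "map (upd e (vs @ us) (a @ b)) (vs @ us) = a @ b"
      using that disj by (intro map_upd) (auto simp: vs_def us_def tuples_length)
    then show "map (upd e (vs @ us) (a @ b)) vs = a" "map (upd e (vs @ us) (a @ b)) us = b"
      using tuples_length[OF that(1)] by (simp_all add: vs_def)
  qed
  show ?thesis
  proof (rule dfnI[of L "Eqs vs us" "vs @ us" M e])
    fix xs assume "xs \<in> tuples M (\<sigma> @ \<sigma>)"
    then obtain a b where ab: "xs = a @ b" "a \<in> tuples M \<sigma>" "b \<in> tuples M \<sigma>" by (auto simp: tuples_append)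
    then show "xs \<in> {a @ a |a. a \<in> tuples M \<sigma>} \<longleftrightarrow> sat M (upd e (vs @ us) xs) (Eqs vs us)"
    proof -
      have "length vs = length us" by (simp add: vs_def us_def)
      then have "sat M (upd e (vs @ us) xs) (Eqs vs us) \<longleftrightarrow> a = b"
        unfolding ab(1) by (simp only: sat_Eqs eq[OF ab(2,3)])
      moreover have "xs \<in> {a @ a |a. a \<in> tuples M \<sigma>} \<longleftrightarrow> a = b"
        using tuples_length[OF ab(2)] tuples_length[OF ab(3)] ab(1,2) by (auto simp: dest!: append_eq_double)
      ultimately show ?thesis by simp
    qed
  qed (use disj e in \<open>auto simp: vs_def us_def tuples_append_iff tuples_length\<close>)
qed

text \<open>Permuting, repeating and omitting coordinates are covered at once. Since
  \<open>us\<close> may contain a variable twice, a renaming cannot do this; fresh variables are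
  quantified and equated with \<open>us\<close> instead. \<open>d\<close> is only a default, as
  every entry of \<open>us\<close> receives its value from \<open>zs\<close>.\<close>

lemma dfn_pullback:
  assumes "dfn L M (map fst us) X" "distinct ws" "set us \<subseteq> set ws"
  shows "dfn L M (map fst ws) {zs \<in> tuples M (map fst ws). map (upd d ws zs) us \<in> X}"
proof -
  define vs where "vs = fresh (set ws) (map fst us)"
  have vs: "set vs \<inter> set ws = {}" "distinct vs" "map fst vs = map fst us" "length vs = length us"
    using fresh_disjoint[of "set ws" "map fst us"] by (simp_all add: vs_def)
  obtain \<phi> e where \<phi>: "wf_fm L \<phi>" "assignment M e" "fv \<phi> \<inter> set ws \<subseteq> set vs" "X = dset M e vs \<phi>"
    using definable_obtain[OF assms(1), of vs "set ws"] vs by auto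
  show ?thesis
  proof (rule dfnI[of L "Exs vs (Conj (Eqs vs us) \<phi>)" ws M e])
    fix zs assume zs: "zs \<in> tuples M (map fst ws)"
    let ?E = "upd e ws zs"
    have [simp]: "length zs = length ws" using zs by (auto dest: tuples_length)
    have ass: "assignment M ?E" by (rule assignment_upd[OF \<phi>(2) zs])
    have "upd d ws zs v = ?E v" if "v \<in> set ws" for v
      using that assms(2) by (auto simp: in_set_conv_nth upd_nth)
    then have Eus: "map (upd d ws zs) us = map ?E us" using assms(3) by auto
    have "set us \<inter> set vs = {}" using vs(1) assms(3) by blast
    then have 1: "map (upd ?E vs a) us = map ?E us" for a by (rule map_upd_disjoint)
    have 2: "map (upd ?E vs a) vs = a" if "a \<in> tuples M (map fst vs)" for a
      using that vs(2) by (intro map_upd) (auto dest: tuples_length)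
    have 3: "sat M (upd ?E vs a) \<phi> \<longleftrightarrow> sat M (upd e vs a) \<phi>" if "a \<in> tuples M (map fst vs)" for a
    proof (rule sat_upd_cong)
      fix v assume "v \<in> fv \<phi> - set vs"
      then have "v \<notin> set ws" using \<phi>(3) by blast
      then show "?E v = e v" by (rule upd_notin)
    qed (use that in \<open>auto dest: tuples_length\<close>)
    have "map ?E us \<in> tuples M (map fst vs)" using assignment_map[OF ass] vs(3) by metis
    then show "zs \<in> {zs \<in> tuples M (map fst ws). map (upd d ws zs) us \<in> X} \<longleftrightarrow>
        sat M ?E (Exs vs (Conj (Eqs vs us) \<phi>))"
      using zs unfolding sat_Exs[OF vs(2)] \<phi>(4) dset_def mem_Collect_eq Eus
      by (auto simp: vs(4) 1 2 3)
  qed (use \<phi> assms vs in auto)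
qed

subsection \<open>Subsets of products of blocks of sorts\<close>

definition blocks :: "('s, 'f, 'r, 'u) struct \<Rightarrow> 's list list \<Rightarrow> 'u list list set" where
  "blocks M \<sigma>s = {bs. list_all2 (\<lambda>b \<sigma>. b \<in> tuples M \<sigma>) bs \<sigma>s}"

lemma blocks_Nil [simp]: "bs \<in> blocks M [] \<longleftrightarrow> bs = []"
  by (simp add: blocks_def)

lemma blocks_Cons: "bs \<in> blocks M (\<sigma> # \<sigma>s) \<longleftrightarrow> (\<exists>b cs. bs = b # cs \<and> b \<in> tuples M \<sigma> \<and> cs \<in> blocks M \<sigma>s)"
  by (auto simp: blocks_def list_all2_Cons2)

lemma blocks_snoc: "bs @ [b] \<in> blocks M (\<sigma>s @ [\<sigma>]) \<longleftrightarrow> bs \<in> blocks M \<sigma>s \<and> b \<in> tuples M \<sigma>"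
  by (induction bs \<sigma>s rule: list_induct2') (auto simp: blocks_def list_all2_append1 list_all2_append2 list_all2_Cons1 list_all2_Cons2)

lemma tuples_concat: "tuples M (concat \<sigma>s) = concat ` blocks M \<sigma>s"
proof (induction \<sigma>s)
  case (Cons \<sigma> \<sigma>s)
  show ?case
  proof (intro set_eqI iffI)
    fix x assume "x \<in> tuples M (concat (\<sigma> # \<sigma>s))"
    then obtain b cs where "x = b @ concat cs" "b \<in> tuples M \<sigma>" "cs \<in> blocks M \<sigma>s"
      using Cons.IH by (auto simp: tuples_append)
    then show "x \<in> concat ` blocks M (\<sigma> # \<sigma>s)" by (auto simp: blocks_Cons intro!: image_eqI[of _ _ "b # cs"])
  next
    fix x assume "x \<in> concat ` blocks M (\<sigma> # \<sigma>s)"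
    then obtain b cs where "x = b @ concat cs" "b \<in> tuples M \<sigma>" "cs \<in> blocks M \<sigma>s"
      by (auto simp: blocks_Cons)
    then show "x \<in> tuples M (concat (\<sigma> # \<sigma>s))"
      using Cons.IH unfolding concat.simps tuples_append by blast
  qed
qed auto

lemma blocks_lengths: "bs \<in> blocks M \<sigma>s \<Longrightarrow> map length bs = map length \<sigma>s"
  by (auto simp: blocks_def list_eq_iff_nth_eq list_all2_conv_all_nth tuples_length)

lemma concat_inj:
  assumes "concat bs = concat cs" "map length bs = map length cs"
  shows "bs = cs"
proof -
  have "length bs = length cs" by (metis assms(2) length_map)
  moreover have "\<forall>(x, y)\<in>set (zip bs cs). length x = length y"
    using assms(2) by (auto simp: set_zip) (metis nth_map)
  ultimately show ?thesis using assms(1) concat_eq_concat_iff by blast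
qed

lemma blocks_concat_inj: "bs \<in> blocks M \<sigma>s \<Longrightarrow> cs \<in> blocks M \<sigma>s \<Longrightarrow> concat bs = concat cs \<Longrightarrow> bs = cs"
  using concat_inj blocks_lengths by metis

text \<open>Definability of a set is reduced to that of a predicate on the blocks its elements are
  made of. Nothing is lost, because the sorts fix the lengths of the blocks and concatenation is
  injective on \<open>blocks\<close>; so logical operations on predicates become operations on
  definable sets.\<close>

definition bdef :: "('s, 'f, 'r) lang \<Rightarrow> ('s, 'f, 'r, 'u) struct \<Rightarrow> 's list list \<Rightarrow>
    ('u list list \<Rightarrow> bool) \<Rightarrow> bool" where
  "bdef L M \<sigma>s P \<longleftrightarrow> dfn L M (concat \<sigma>s) {concat bs |bs. bs \<in> blocks M \<sigma>s \<and> P bs}"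

lemma bdef_dfn:
  assumes "bdef L M \<sigma>s P" "concat \<sigma>s = \<sigma>" "\<And>z. z \<in> X \<longleftrightarrow> (\<exists>bs\<in>blocks M \<sigma>s. z = concat bs \<and> P bs)"
  shows "dfn L M \<sigma> X"
proof -
  have "X = {concat bs |bs. bs \<in> blocks M \<sigma>s \<and> P bs}" using assms(3) by blast
  then show ?thesis using assms(1,2) by (simp add: bdef_def)
qed

lemma bdef_conj:
  assumes "bdef L M \<sigma>s P" "bdef L M \<sigma>s Q"
  shows "bdef L M \<sigma>s (\<lambda>bs. P bs \<and> Q bs)"
proof -
  have "{concat bs |bs. bs \<in> blocks M \<sigma>s \<and> P bs \<and> Q bs} =
      {concat bs |bs. bs \<in> blocks M \<sigma>s \<and> P bs} \<inter> {concat bs |bs. bs \<in> blocks M \<sigma>s \<and> Q bs}"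
    using blocks_concat_inj by blast
  then show ?thesis using dfn_Int assms by (simp add: bdef_def)
qed

lemma bdef_not:
  assumes "bdef L M \<sigma>s P"
  shows "bdef L M \<sigma>s (\<lambda>bs. \<not> P bs)"
proof -
  have "{concat bs |bs. bs \<in> blocks M \<sigma>s \<and> \<not> P bs} =
      tuples M (concat \<sigma>s) - {concat bs |bs. bs \<in> blocks M \<sigma>s \<and> P bs}"
    unfolding tuples_concat using blocks_concat_inj by blast
  then show ?thesis using dfn_compl assms by (simp add: bdef_def)
qed

lemma bdef_imp: "bdef L M \<sigma>s P \<Longrightarrow> bdef L M \<sigma>s Q \<Longrightarrow> bdef L M \<sigma>s (\<lambda>bs. P bs \<longrightarrow> Q bs)"
  using bdef_not[OF bdef_conj[OF _ bdef_not]] by auto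

text \<open>Only the last block can be projected away; a block that is to be quantified is for this
  reason listed last wherever this is applied.\<close>

lemma bdef_ex:
  assumes "bdef L M (\<sigma>s @ [\<sigma>]) P"
  shows "bdef L M \<sigma>s (\<lambda>bs. \<exists>b\<in>tuples M \<sigma>. P (bs @ [b]))"
proof -
  let ?X = "{concat bs |bs. bs \<in> blocks M (\<sigma>s @ [\<sigma>]) \<and> P bs}"
  have "concat bs @ b \<in> ?X \<longleftrightarrow> P (bs @ [b])" if "bs \<in> blocks M \<sigma>s" "b \<in> tuples M \<sigma>" for bs b
  proof -
    have *: "bs @ [b] \<in> blocks M (\<sigma>s @ [\<sigma>])" using that by (simp add: blocks_snoc)
    have "concat bs @ b \<in> ?X \<longleftrightarrow> (\<exists>cs\<in>blocks M (\<sigma>s @ [\<sigma>]). concat (bs @ [b]) = concat cs \<and> P cs)" by auto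
    also have "\<dots> \<longleftrightarrow> P (bs @ [b])" using * blocks_concat_inj[OF *] by metis
    finally show ?thesis .
  qed
  then have "{concat bs |bs. bs \<in> blocks M \<sigma>s \<and> (\<exists>b\<in>tuples M \<sigma>. P (bs @ [b]))} =
      {xs \<in> tuples M (concat \<sigma>s). \<exists>b\<in>tuples M \<sigma>. xs @ b \<in> ?X}"
    unfolding tuples_concat by blast
  then show ?thesis using dfn_Ex[of L M "concat \<sigma>s" \<sigma> ?X] assms by (simp add: bdef_def)
qed

lemma bdef_all:
  assumes "bdef L M (\<sigma>s @ [\<sigma>]) P"
  shows "bdef L M \<sigma>s (\<lambda>bs. \<forall>b\<in>tuples M \<sigma>. P (bs @ [b]))"
  using bdef_not[OF bdef_ex[OF bdef_not[OF assms]]] by simp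

lemma ex_variable_blocks: "\<exists>wss :: 's var list list. map (map fst) wss = \<sigma>s \<and> distinct (concat wss)"
proof (induction \<sigma>s)
  case (Cons \<sigma> \<sigma>s)
  then obtain wss :: "'s var list list" where wss: "map (map fst) wss = \<sigma>s" "distinct (concat wss)" by blast
  have "distinct (concat (fresh (set (concat wss)) \<sigma> # wss))"
    using wss(2) fresh_disjoint[of "set (concat wss)" \<sigma>] by auto
  then show ?case using wss(1) by (intro exI[of _ "fresh (set (concat wss)) \<sigma> # wss"]) simp
qed auto

text \<open>\<open>idx\<close> tells which blocks are fed to \<open>X\<close>, in any order and with
  repetitions. This is a pullback once each block is given its own list of variables.\<close>

lemma bdef_mem:
  fixes \<sigma>s :: "'s list list"
  assumes "dfn L M \<rho> X" "\<rho> = concat (map ((!) \<sigma>s) idx)" "set idx \<subseteq> {..<length \<sigma>s}"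
    and P: "\<And>bs. P bs \<longleftrightarrow> concat (map ((!) bs) idx) \<in> X"
  shows "bdef L M \<sigma>s P"
proof -
  obtain wss :: "'s var list list" where wss: "map (map fst) wss = \<sigma>s" "distinct (concat wss)"
    using ex_variable_blocks[of \<sigma>s] by auto
  have len: "length wss = length \<sigma>s" using wss(1) by (metis length_map)
  let ?ws = "concat wss" and ?us = "concat (map ((!) wss) idx)"
  have sorts: "map fst ?ws = concat \<sigma>s" by (simp add: map_concat wss(1))
  have "map (map fst) (map ((!) wss) idx) = map ((!) \<sigma>s) idx"
    unfolding wss(1)[symmetric] using assms(3) len by auto
  then have us: "map fst ?us = \<rho>" unfolding assms(2) map_concat by (simp del: map_map)
  have "wss ! i \<in> set wss" if "i \<in> set idx" for i using that assms(3) len by auto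
  then have sub: "set ?us \<subseteq> set ?ws" by auto
  have "map (upd undefined ?ws (concat bs)) ?us = concat (map ((!) bs) idx)" if "bs \<in> blocks M \<sigma>s" for bs
  proof -
    let ?E = "upd undefined ?ws (concat bs)"
    have lens: "map length bs = map length wss"
      unfolding blocks_lengths[OF that] wss(1)[symmetric] by simp
    have "map ?E ?ws = concat bs"
      using lens wss(2) by (intro map_upd) (simp_all add: length_concat)
    then have "map (map ?E) wss = bs"
      using lens by (intro concat_inj) (simp_all add: map_concat o_def)
    moreover have "i < length wss" if "i \<in> set idx" for i using that assms(3) len by auto
    ultimately have "map ?E (wss ! i) = bs ! i" if "i \<in> set idx" for i
      using that nth_map[of i wss "map ?E"] by simp
    then have "map (map ?E) (map ((!) wss) idx) = map ((!) bs) idx" by simp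
    then show ?thesis unfolding map_concat by (simp only:)
  qed
  then have "{concat bs |bs. bs \<in> blocks M \<sigma>s \<and> P bs} =
      {zs \<in> tuples M (map fst ?ws). map (upd undefined ?ws zs) ?us \<in> X}"
    unfolding sorts tuples_concat P by auto
  then show ?thesis using dfn_pullback[OF _ wss(2) sub, of L M X undefined] us assms(1)
    by (simp add: bdef_def sorts)
qed

lemma bdef_eq:
  assumes "is_struct L M" "i < length \<sigma>s" "j < length \<sigma>s" "\<sigma>s ! i = \<sigma>s ! j"
  shows "bdef L M \<sigma>s (\<lambda>bs. bs ! i = bs ! j)"
proof -
  let ?D = "{a @ a |a. a \<in> tuples M (\<sigma>s ! i)}"
  have "bdef L M \<sigma>s (\<lambda>bs. bs ! i @ bs ! j \<in> ?D)"
    by (rule bdef_mem[OF dfn_diag[OF assms(1)], of _ _ "[i, j]"]) (use assms in auto)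
  moreover have "bs ! i @ bs ! j \<in> ?D \<longleftrightarrow> bs ! i = bs ! j" if "bs \<in> blocks M \<sigma>s" for bs
  proof -
    have "bs ! i \<in> tuples M (\<sigma>s ! i)" "bs ! j \<in> tuples M (\<sigma>s ! i)"
      using that assms by (auto simp: blocks_def list_all2_conv_all_nth)
    then show ?thesis by (fastforce dest: tuples_length)
  qed
  ultimately show ?thesis by (simp add: bdef_def cong: conj_cong)
qed

lemma bdef_const:
  assumes "is_struct L M" "i < length \<sigma>s" "c \<in> tuples M (\<sigma>s ! i)"
  shows "bdef L M \<sigma>s (\<lambda>bs. bs ! i = c)"
  by (rule bdef_mem[OF dfn_singleton[OF assms(1,3)], of _ "[i]"]) (use assms in auto)

section \<open>Ultrapowers\<close>

text \<open>Zorn's lemma yields a maximal family with the finite intersection property containing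
  \<open>B\<close>. By maximality, a set outside the family misses some finite intersection of
  members; if a set and its complement were both outside, joining the two finite subfamilies would
  give an empty intersection.\<close>

lemma ex_ultrafilter:
  fixes B :: "'i set set"
  assumes "\<And>K. finite K \<Longrightarrow> K \<subseteq> B \<Longrightarrow> \<Inter>K \<noteq> {}"
  obtains U :: "'i filter" where "U \<noteq> bot" "\<And>P. eventually P U \<or> eventually (\<lambda>i. \<not> P i) U"
    "\<And>S. S \<in> B \<Longrightarrow> eventually (\<lambda>i. i \<in> S) U"
proof -
  define \<A> where "\<A> = {V. B \<subseteq> V \<and> (\<forall>K. finite K \<and> K \<subseteq> V \<longrightarrow> \<Inter>K \<noteq> {})}"
  have "\<exists>V\<in>\<A>. \<forall>W\<in>\<A>. V \<subseteq> W \<longrightarrow> W = V"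
  proof (rule subset_Zorn_nonempty)
    show "\<A> \<noteq> {}" using assms by (auto simp: \<A>_def)
    fix \<C> assume ne: "\<C> \<noteq> {}" and chain: "subset.chain \<A> \<C>"
    then have sub: "\<C> \<subseteq> \<A>" by (simp add: subset.chain_def)
    have "\<Inter>K \<noteq> {}" if K: "finite K" "K \<subseteq> \<Union>\<C>" for K
    proof -
      obtain V where "V \<in> \<C>" "K \<subseteq> V"
        using finite_subset_Union_chain[OF K ne chain] by blast
      then show ?thesis using sub K(1) unfolding \<A>_def by blast
    qed
    then show "\<Union>\<C> \<in> \<A>" using ne sub unfolding \<A>_def by blast
  qed
  then obtain V where V: "V \<in> \<A>" and max: "\<And>W. W \<in> \<A> \<Longrightarrow> V \<subseteq> W \<Longrightarrow> W = V" by blast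
  have fip: "\<Inter>K \<noteq> {}" if "finite K" "K \<subseteq> V" for K using V that unfolding \<A>_def by blast
  have ex: "\<exists>K. finite K \<and> K \<subseteq> V \<and> \<Inter>K \<inter> S = {}" if "S \<notin> V" for S
  proof -
    have "insert S V \<notin> \<A>" using max[of "insert S V"] that by blast
    then obtain K where K: "finite K" "K \<subseteq> insert S V" "\<Inter>K = {}" using V unfolding \<A>_def by blast
    then have "\<Inter>(K - {S}) \<inter> S = {}" by blast
    then show ?thesis using K by (intro exI[of _ "K - {S}"]) auto
  qed
  have ultra: "S \<in> V \<or> - S \<in> V" for S
  proof (rule ccontr)
    assume "\<not> ?thesis"
    then obtain K K' where "finite K" "K \<subseteq> V" "\<Inter>K \<inter> S = {}" "finite K'" "K' \<subseteq> V" "\<Inter>K' \<inter> - S = {}"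
      using ex by (metis (no_types))
    then show False using fip[of "K \<union> K'"] by blast
  qed
  have disj: "S \<inter> S' \<noteq> {}" if "S \<in> V" "S' \<in> V" for S S' using fip[of "{S, S'}"] that by simp
  have inter: "S \<inter> S' \<in> V" if "S \<in> V" "S' \<in> V" for S S'
    using ultra[of "S \<inter> S'"] fip[of "{S, S', - (S \<inter> S')}"] that by auto
  have mono: "S' \<in> V" if "S \<in> V" "S \<subseteq> S'" for S S'
    using ultra[of S'] disj[of S "- S'"] that by blast
  define U where "U = Abs_filter (\<lambda>P. Collect P \<in> V)"
  have ev: "eventually P U \<longleftrightarrow> Collect P \<in> V" for P
    unfolding U_def
  proof (rule eventually_Abs_filter, rule is_filter.intro)
    show "Collect (\<lambda>x. True) \<in> V" using ultra[of UNIV] fip[of "{{}}"] by auto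
    show "Collect P \<in> V \<Longrightarrow> Collect Q \<in> V \<Longrightarrow> Collect (\<lambda>x. P x \<and> Q x) \<in> V" for P Q
      using inter[of "Collect P" "Collect Q"] by (simp add: Collect_conj_eq)
    show "\<forall>x. P x \<longrightarrow> Q x \<Longrightarrow> Collect P \<in> V \<Longrightarrow> Collect Q \<in> V" for P Q
      using mono[of "Collect P" "Collect Q"] by blast
  qed
  have "\<not> eventually (\<lambda>_. False) U" using fip[of "{{}}"] by (auto simp: ev)
  then have "U \<noteq> bot" by auto
  moreover have "eventually P U \<or> eventually (\<lambda>i. \<not> P i) U" for P
    using ultra[of "Collect P"] by (simp add: ev Collect_neg_eq)
  moreover have "eventually (\<lambda>i. i \<in> S) U" if "S \<in> B" for S using that V by (auto simp: ev \<A>_def)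
  ultimately show ?thesis using that by blast
qed

text \<open>
  The element of the ultrapower given by a sequence is a chosen representative of its class;
  the values are wrapped in \<open>Some\<close> only to land in the type \<open>big\<close>.
\<close>

definition uclass :: "'i filter \<Rightarrow> ('i \<Rightarrow> 'u) \<Rightarrow> 'i \<Rightarrow> 'u option" where
  "uclass U g i = Some ((SOME h. eventually (\<lambda>j. h j = g j) U) i)"

text \<open>Classes are formed among all sequences and the sort enters only through
  \<open>univ\<close>, so overlapping universes of the structure give overlapping universes here.
  Functions read the chosen representatives back with \<open>the\<close>.\<close>

definition ultrapower :: "'i filter \<Rightarrow> ('s, 'f, 'r, 'u) struct \<Rightarrow> ('s, 'f, 'r, 'i \<Rightarrow> 'u option) struct" where
  "ultrapower U M = \<lparr>
     univ = (\<lambda>s. uclass U ` {g. eventually (\<lambda>i. g i \<in> univ M s) U}),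
     fun_int = (\<lambda>f xs. uclass U (\<lambda>i. fun_int M f (map (\<lambda>x. the (x i)) xs))),
     rel_int = (\<lambda>r. {map (uclass U) gs |gs. eventually (\<lambda>i. map (\<lambda>g. g i) gs \<in> rel_int M r) U})\<rparr>"

lemma eventually_the_uclass: "eventually (\<lambda>i. the (uclass U g i) = g i) U"
proof -
  have "eventually (\<lambda>j. (SOME h. eventually (\<lambda>j. h j = g j) U) j = g j) U"
    by (rule someI[of "\<lambda>h. eventually (\<lambda>j. h j = g j) U" g]) simp
  then show ?thesis by (simp add: uclass_def)
qed

lemma uclass_eq_iff: "uclass U g = uclass U h \<longleftrightarrow> eventually (\<lambda>i. g i = h i) U"
proof
  assume eq: "uclass U g = uclass U h"
  show "eventually (\<lambda>i. g i = h i) U"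
    using eventually_the_uclass[of U g] eventually_the_uclass[of U h] unfolding eq
    by eventually_elim simp
next
  assume gh: "eventually (\<lambda>i. g i = h i) U"
  have "eventually (\<lambda>j. k j = g j) U \<longleftrightarrow> eventually (\<lambda>j. k j = h j) U" for k
    by (rule eventually_subst) (use gh in eventually_elim, simp)
  then show "uclass U g = uclass U h" by (simp add: uclass_def fun_eq_iff)
qed

lemma map_uclass_eq:
  "map (uclass U) gs = map (uclass U) hs \<Longrightarrow> eventually (\<lambda>i. map (\<lambda>g. g i) gs = map (\<lambda>g. g i) hs) U"
proof (induction gs hs rule: list_induct2')
  case (4 g gs h hs)
  then have "eventually (\<lambda>i. g i = h i) U" "eventually (\<lambda>i. map (\<lambda>g. g i) gs = map (\<lambda>g. g i) hs) U"
    by (simp_all add: uclass_eq_iff)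
  then show ?case by eventually_elim simp
qed auto

lemma eventually_map_the_uclass:
  "eventually (\<lambda>i. map (\<lambda>x. the (x i)) (map (uclass U) gs) = map (\<lambda>g. g i) gs) U"
proof (induction gs)
  case (Cons g gs)
  with eventually_the_uclass[of U g] show ?case by eventually_elim simp
qed simp

lemma val_ultrapower:
  "val (ultrapower U M) (\<lambda>v. uclass U (\<lambda>i. E i v)) t = uclass U (\<lambda>i. val M (E i) t)"
proof (induction t)
  case (Fun f ts)
  define gs where "gs = map (\<lambda>t i. val M (E i) t) ts"
  have "map (val (ultrapower U M) (\<lambda>v. uclass U (\<lambda>i. E i v))) ts = map (uclass U) gs"
    using Fun by (simp add: gs_def)
  moreover have "map (val M (E i)) ts = map (\<lambda>g. g i) gs" for i by (simp add: gs_def)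
  moreover have "uclass U (\<lambda>i. fun_int M f (map (\<lambda>x. the (x i)) (map (uclass U) gs))) =
      uclass U (\<lambda>i. fun_int M f (map (\<lambda>g. g i) gs))"
    unfolding uclass_eq_iff using eventually_map_the_uclass[of U gs]
    by eventually_elim (simp only:)
  ultimately show ?case by (simp add: ultrapower_def)
qed simp

lemma uclass_mem_univ: "uclass U g \<in> univ (ultrapower U M) s \<longleftrightarrow> eventually (\<lambda>i. g i \<in> univ M s) U"
proof
  assume "uclass U g \<in> univ (ultrapower U M) s"
  then obtain h where "uclass U g = uclass U h" "eventually (\<lambda>i. h i \<in> univ M s) U"
    by (auto simp: ultrapower_def)
  then show "eventually (\<lambda>i. g i \<in> univ M s) U"
    unfolding uclass_eq_iff by eventually_elim simp
qed (simp add: ultrapower_def)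

text \<open>A representative is corrected on a negligible set of indices so that it has the right
  sort at every index. Families of such representatives are assignments of \<open>M\<close> index by
  index.\<close>

lemma univ_ultrapowerE:
  assumes "x \<in> univ (ultrapower U M) s" "univ M s \<noteq> {}"
  obtains g where "x = uclass U g" "\<And>i. g i \<in> univ M s"
proof -
  obtain h where h: "x = uclass U h" "eventually (\<lambda>i. h i \<in> univ M s) U"
    using assms(1) by (auto simp: ultrapower_def)
  obtain c where c: "c \<in> univ M s" using assms(2) by blast
  have "x = uclass U (\<lambda>i. if h i \<in> univ M s then h i else c)"
    unfolding h(1) uclass_eq_iff using h(2) by eventually_elim simp
  then show ?thesis using that c by simp
qed

text \<open>The theorem of Los, for assignments given by a family \<open>E\<close> of assignments
  into \<open>M\<close>. This form is general: choosing a representative for each value brings every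
  assignment of the ultrapower into it.\<close>

theorem Los_ultrapower:
  assumes "U \<noteq> bot" "\<And>P. eventually P U \<or> eventually (\<lambda>i. \<not> P i) U" "\<And>s. univ M s \<noteq> {}"
  shows "sat (ultrapower U M) (\<lambda>v. uclass U (\<lambda>i. E i v)) \<phi> \<longleftrightarrow> eventually (\<lambda>i. sat M (E i) \<phi>) U"
proof (induction \<phi> arbitrary: E)
  case (Eq t u)
  then show ?case by (simp add: val_ultrapower uclass_eq_iff)
next
  case (Rel r ts)
  define gs where "gs = map (\<lambda>t i. val M (E i) t) ts"
  have 1: "map (val (ultrapower U M) (\<lambda>v. uclass U (\<lambda>i. E i v))) ts = map (uclass U) gs"
    by (simp add: gs_def val_ultrapower)
  have 2: "map (val M (E i)) ts = map (\<lambda>g. g i) gs" for i by (simp add: gs_def)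
  have "map (uclass U) gs \<in> rel_int (ultrapower U M) r \<longleftrightarrow> eventually (\<lambda>i. map (\<lambda>g. g i) gs \<in> rel_int M r) U"
  proof
    assume "map (uclass U) gs \<in> rel_int (ultrapower U M) r"
    then obtain hs where hs: "map (uclass U) gs = map (uclass U) hs" "eventually (\<lambda>i. map (\<lambda>g. g i) hs \<in> rel_int M r) U"
      by (auto simp: ultrapower_def)
    show "eventually (\<lambda>i. map (\<lambda>g. g i) gs \<in> rel_int M r) U"
      using map_uclass_eq[OF hs(1)] hs(2) by eventually_elim simp
  qed (auto simp: ultrapower_def)
  then show ?case by (simp only: sat.simps 1 2)
next
  case (Neg \<phi>)
  \<comment> \<open>Negation is the case that needs an ultrafilter: properness gives one direction
    and the dichotomy the other.\<close>
  have "\<not> eventually (\<lambda>i. sat M (E i) \<phi>) U \<longleftrightarrow> eventually (\<lambda>i. \<not> sat M (E i) \<phi>) U"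
  proof
    assume *: "eventually (\<lambda>i. \<not> sat M (E i) \<phi>) U"
    show "\<not> eventually (\<lambda>i. sat M (E i) \<phi>) U"
    proof
      assume "eventually (\<lambda>i. sat M (E i) \<phi>) U"
      with * have "eventually (\<lambda>i. False) U" by eventually_elim simp
      with assms(1) show False by (simp add: eventually_False)
    qed
  qed (use assms(2) in blast)
  then show ?case by (simp add: Neg)
next
  case (Conj \<phi> \<psi>)
  then show ?case by (simp add: eventually_conj_iff)
next
  case (Ex v \<phi>)
  have upd: "(\<lambda>w. uclass U (\<lambda>i. E i w))(v := uclass U g) = (\<lambda>w. uclass U (\<lambda>i. ((E i)(v := g i)) w))" for g
    by (auto simp: fun_eq_iff)
  have step: "sat (ultrapower U M) ((\<lambda>w. uclass U (\<lambda>i. E i w))(v := uclass U g)) \<phi> \<longleftrightarrow>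
      eventually (\<lambda>i. sat M ((E i)(v := g i)) \<phi>) U" for g
    unfolding upd by (rule Ex)
  show ?case
  proof
    assume "sat (ultrapower U M) (\<lambda>v. uclass U (\<lambda>i. E i v)) (Ex v \<phi>)"
    then obtain x where x: "x \<in> univ (ultrapower U M) (fst v)"
      "sat (ultrapower U M) ((\<lambda>w. uclass U (\<lambda>i. E i w))(v := x)) \<phi>" unfolding sat.simps by blast
    obtain g where g: "x = uclass U g" "\<And>i. g i \<in> univ M (fst v)"
      using univ_ultrapowerE[OF x(1)] assms(3) by metis
    have "eventually (\<lambda>i. sat M ((E i)(v := g i)) \<phi>) U" using x(2) unfolding g(1) step .
    then show "eventually (\<lambda>i. sat M (E i) (Ex v \<phi>)) U"
      unfolding sat.simps by eventually_elim (use g(2) in blast)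
  next
    assume ev: "eventually (\<lambda>i. sat M (E i) (Ex v \<phi>)) U"
    \<comment> \<open>A witness is picked at each index that has one; the values of \<open>g\<close>
      at the remaining, negligible set of indices are arbitrary.\<close>
    have "\<forall>i. \<exists>x. sat M (E i) (Ex v \<phi>) \<longrightarrow> x \<in> univ M (fst v) \<and> sat M ((E i)(v := x)) \<phi>" by auto
    from choice[OF this] obtain g where g: "\<And>i. sat M (E i) (Ex v \<phi>) \<Longrightarrow>
      g i \<in> univ M (fst v) \<and> sat M ((E i)(v := g i)) \<phi>" by blast
    have "uclass U g \<in> univ (ultrapower U M) (fst v)"
      unfolding uclass_mem_univ using ev by eventually_elim (use g in blast)
    moreover have "sat (ultrapower U M) ((\<lambda>w. uclass U (\<lambda>i. E i w))(v := uclass U g)) \<phi>"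
      unfolding step using ev by eventually_elim (use g in blast)
    ultimately show "sat (ultrapower U M) (\<lambda>v. uclass U (\<lambda>i. E i v)) (Ex v \<phi>)" unfolding sat.simps by blast
  qed
qed

lemma map_uclass_mem_tuples:
  "U \<noteq> bot \<Longrightarrow> map (uclass U) gs \<in> tuples (ultrapower U M) \<sigma> \<longleftrightarrow> eventually (\<lambda>i. map (\<lambda>g. g i) gs \<in> tuples M \<sigma>) U"
proof (induction gs \<sigma> rule: list_induct2')
  case (4 g gs s \<sigma>)
  then show ?case by (simp add: tuples_def uclass_mem_univ eventually_conj_iff)
qed (auto simp: tuples_def eventually_False)

lemma tuples_ultrapowerE:
  assumes "xs \<in> tuples (ultrapower U M) \<sigma>"
  obtains gs where "xs = map (uclass U) gs"
proof -
  have "\<forall>x\<in>set xs. \<exists>g. x = uclass U g"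
    using assms by (force simp: tuples_def ultrapower_def list_all2_conv_all_nth in_set_conv_nth)
  then show ?thesis using that by (metis ex_map_conv)
qed

lemma is_model_ultrapower:
  assumes U: "U \<noteq> bot" "\<And>P. eventually P U \<or> eventually (\<lambda>i. \<not> P i) U" and "is_model L T M"
  shows "is_model L T (ultrapower U M)"
proof -
  have M: "is_struct L M" and T: "\<And>\<phi> e. \<phi> \<in> T \<Longrightarrow> assignment M e \<Longrightarrow> sat M e \<phi>"
    using assms(3) by (auto simp: is_model_def)
  have ne: "univ M s \<noteq> {}" for s using M by (simp add: is_struct_def)
  let ?N = "ultrapower U M"
  have "univ ?N s \<noteq> {}" for s
  proof -
    obtain c where "c \<in> univ M s" using ne by blast
    then have "uclass U (\<lambda>_. c) \<in> univ ?N s" by (simp add: uclass_mem_univ)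
    then show ?thesis by blast
  qed
  moreover have "fun_int ?N f xs \<in> univ ?N s" if f: "fun_sig L f = Some (\<sigma>, s)" and xs: "xs \<in> tuples ?N \<sigma>" for f \<sigma> s xs
  proof -
    obtain gs where gs: "xs = map (uclass U) gs" using tuples_ultrapowerE[OF xs] .
    have "eventually (\<lambda>i. map (\<lambda>g. g i) gs \<in> tuples M \<sigma>) U"
      using xs unfolding gs by (simp add: map_uclass_mem_tuples U)
    with eventually_map_the_uclass[of U gs]
    have "eventually (\<lambda>i. fun_int M f (map (\<lambda>x. the (x i)) (map (uclass U) gs)) \<in> univ M s) U"
    proof eventually_elim
      case (elim i)
      show ?case unfolding elim(1) using M f elim(2) by (auto simp: is_struct_def)
    qed
    then have "uclass U (\<lambda>i. fun_int M f (map (\<lambda>x. the (x i)) xs)) \<in> univ ?N s"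
      unfolding uclass_mem_univ gs .
    then show ?thesis by (simp add: ultrapower_def)
  qed
  moreover have "rel_int ?N r \<subseteq> tuples ?N (rel_sig L r)" for r
  proof
    fix xs assume "xs \<in> rel_int ?N r"
    then obtain gs where gs: "xs = map (uclass U) gs" "eventually (\<lambda>i. map (\<lambda>g. g i) gs \<in> rel_int M r) U"
      by (auto simp: ultrapower_def)
    from gs(2) have "eventually (\<lambda>i. map (\<lambda>g. g i) gs \<in> tuples M (rel_sig L r)) U"
      by eventually_elim (use M in \<open>auto simp: is_struct_def\<close>)
    then show "xs \<in> tuples ?N (rel_sig L r)" unfolding gs(1) map_uclass_mem_tuples[OF U(1)] .
  qed
  moreover have "rel_int ?N (ball_rel L) \<noteq> {}"
  proof -
    obtain xs where xs: "xs \<in> rel_int M (ball_rel L)" using M by (auto simp: is_struct_def)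
    have "map (uclass U) (map (\<lambda>x i. x) xs) \<in> rel_int ?N (ball_rel L)"
      using xs by (auto simp: ultrapower_def o_def intro!: exI[of _ "map (\<lambda>x i. x) xs"])
    then show ?thesis by blast
  qed
  moreover have "sat ?N e \<phi>" if \<phi>: "\<phi> \<in> T" and e: "assignment ?N e" for e \<phi>
  proof -
    have "\<exists>g. e v = uclass U g \<and> (\<forall>i. g i \<in> univ M (fst v))" for v
    proof -
      have "e v \<in> univ ?N (fst v)" using e by (simp add: assignment_def del: split_paired_All)
      from univ_ultrapowerE[OF this ne] show ?thesis by metis
    qed
    then obtain g where g: "\<And>v. e v = uclass U (g v)" "\<And>v i. g v i \<in> univ M (fst v)" by metis
    have "sat M (\<lambda>v. g v i) \<phi>" for i using T[OF \<phi>] g(2) by (simp add: assignment_def del: split_paired_All)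
    then have "sat ?N (\<lambda>v. uclass U (\<lambda>i. g v i)) \<phi>"
      unfolding Los_ultrapower[OF U ne, of "\<lambda>i v. g v i" \<phi>] by simp
    moreover have "e = (\<lambda>v. uclass U (\<lambda>i. g v i))" by (rule ext) (rule g(1))
    ultimately show ?thesis by (simp only:)
  qed
  ultimately show ?thesis unfolding is_model_def is_struct_def by blast
qed

section \<open>Uniformity of (b1) in parameters\<close>

definition fiber :: "('s, 'f, 'r, 'u) struct \<Rightarrow> ('s, 'f, 'r) fm \<Rightarrow> 's var \<Rightarrow> ('s, 'f, 'r) fm \<Rightarrow>
    's var list \<Rightarrow> ('s var \<Rightarrow> 'u) \<Rightarrow> 'u list \<Rightarrow> 'u set" where
  "fiber M \<psi> x \<phi> ss e s =
     {m \<in> univ M (fst x). sat M (e(x := m)) \<psi> \<and> sat M (upd (e(x := m)) ss s) \<phi>}"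

text \<open>
  \<open>\<phi>\<close> defines the graph of a function as in (b1), from the variable \<open>x\<close> to the variables \<open>ss\<close>, on the
  set defined by \<open>\<psi>\<close>.
\<close>

definition presents :: "('s, 'f, 'r) lang \<Rightarrow> ('s, 'f, 'r, 'u) struct \<Rightarrow> ('s, 'f, 'r) fm \<Rightarrow> 's var \<Rightarrow>
    ('s, 'f, 'r) fm \<Rightarrow> 's var list \<Rightarrow> ('s var \<Rightarrow> 'u) \<Rightarrow> bool" where
  "presents L M \<psi> x \<phi> ss e \<longleftrightarrow>
     (\<forall>m\<in>univ M (fst x). sat M (e(x := m)) \<psi> \<longrightarrow>
        (\<exists>s\<in>tuples M (map fst ss). \<forall>t\<in>tuples M (map fst ss). sat M (upd (e(x := m)) ss t) \<phi> \<longleftrightarrow> t = s)) \<and>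
     (\<forall>s\<in>tuples M (map fst ss). fiber M \<psi> x \<phi> ss e s = {} \<or> is_singleton (fiber M \<psi> x \<phi> ss e s) \<or>
        is_ball L M (fiber M \<psi> x \<phi> ss e s))"

text \<open>This turns \<open>presents\<close> into a formula, so that it can be transferred by the
  theorem of Los and cut out definable sets of parameters. The auxiliary variables are
  \<open>ss'\<close> for the value of the function, \<open>x'\<close> for the point of a fiber and
  \<open>as\<close> for the parameter of a ball.\<close>

definition presents_fm :: "('s, 'f, 'r) lang \<Rightarrow> ('s, 'f, 'r) fm \<Rightarrow> 's var \<Rightarrow> ('s, 'f, 'r) fm \<Rightarrow>
    's var list \<Rightarrow> 's var \<Rightarrow> 's var list \<Rightarrow> 's var list \<Rightarrow> ('s, 'f, 'r) fm" where
  "presents_fm L \<psi> x \<phi> ss x' ss' as =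
     Conj (Forall x (Imp \<psi> (Exs ss' (Alls ss (Iff \<phi> (Eqs ss ss'))))))
       (Alls ss (Disj (Neg (Ex x (Conj \<psi> \<phi>)))
         (Disj (Ex x' (Forall x (Iff (Conj \<psi> \<phi>) (Eq (Var x) (Var x')))))
           (Exs as (Forall x (Iff (Conj \<psi> \<phi>) (Rel (ball_rel L) (map Var as @ [Var x]))))))))"

lemma upd_fun_upd: "x \<notin> set ss \<Longrightarrow> (upd e ss s)(x := m) = upd (e(x := m)) ss s"
  using upd_append_swap[of "[m]" "[x]" ss e s] by (simp add: upd_Cons)

lemma wf_presents_fm:
  assumes "language L" "wf_fm L \<psi>" "wf_fm L \<phi>" "fst x = main_sort L" "fst x' = main_sort L"
    "map fst ss' = map fst ss" "map fst as = ball_sorts L"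
  shows "wf_fm L (presents_fm L \<psi> x \<phi> ss x' ss' as)"
proof -
  have "rel_sig L (ball_rel L) = map fst (as @ [x])"
    using assms(1,4,7) unfolding language_def ball_sorts_def by auto
  then have "list_all2 (has_sort L) (map Var as @ [Var x]) (rel_sig L (ball_rel L))"
    by (auto simp: list_all2_conv_all_nth nth_append)
  then show ?thesis using assms by (simp add: presents_fm_def)
qed

lemma sat_presents_fm:
  assumes x: "fst x = main_sort L" "fst x' = main_sort L" "x' \<noteq> x" "x \<notin> set ss"
    and ss: "distinct ss" "set ss \<inter> fv \<psi> = {}"
    and ss': "distinct ss'" "map fst ss' = map fst ss"
    and as: "distinct as" "map fst as = ball_sorts L"
    and new: "insert x' (set ss' \<union> set as) \<inter> (fv \<psi> \<union> fv \<phi> \<union> insert x (set ss)) = {}"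
  shows "sat M e (presents_fm L \<psi> x \<phi> ss x' ss' as) \<longleftrightarrow> presents L M \<psi> x \<phi> ss e"
proof -
  have lens: "length ss' = length ss" using ss'(2) by (metis length_map)
  have f: "sat M (e(x := m)) (Exs ss' (Alls ss (Iff \<phi> (Eqs ss ss')))) \<longleftrightarrow>
      (\<exists>s\<in>tuples M (map fst ss). \<forall>t\<in>tuples M (map fst ss). sat M (upd (e(x := m)) ss t) \<phi> \<longleftrightarrow> t = s)" for m
  proof -
    let ?e = "e(x := m)"
    have "sat M (upd (upd ?e ss' s) ss t) (Iff \<phi> (Eqs ss ss')) \<longleftrightarrow> (sat M (upd ?e ss t) \<phi> \<longleftrightarrow> t = s)"
      if st: "s \<in> tuples M (map fst ss)" "t \<in> tuples M (map fst ss)" for s t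
    proof -
      have len: "length s = length ss" "length t = length ss" using st by (auto dest: tuples_length)
      have 1: "map (upd (upd ?e ss' s) ss t) ss = t" using len ss(1) by (intro map_upd) auto
      have "map (upd (upd ?e ss' s) ss t) ss' = map (upd ?e ss' s) ss'"
        using new by (intro map_upd_disjoint) blast
      also have "\<dots> = s" using len ss'(1) lens by (intro map_upd) auto
      finally have 2: "map (upd (upd ?e ss' s) ss t) ss' = s" .
      have "sat M (upd (upd ?e ss' s) ss t) \<phi> \<longleftrightarrow> sat M (upd ?e ss t) \<phi>"
      proof (rule sat_upd_cong)
        fix v assume "v \<in> fv \<phi> - set ss"
        then have "v \<notin> set ss'" using new by blast
        then show "upd ?e ss' s v = ?e v" by (rule upd_notin)
      qed (rule len)
      then show ?thesis by (simp only: sat_connectives sat_Eqs lens 1 2)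
    qed
    then show ?thesis unfolding sat_Exs[OF ss'(1)] sat_Alls[OF ss(1)] ss'(2) by blast
  qed
  \<comment> \<open>\<open>E'\<close> stands for any assignment met below the quantifiers over
    \<open>x'\<close> or \<open>as\<close>. As these variables occur in neither formula and
    \<open>ss\<close> does not meet \<psi>, it still describes the fiber determined by
    \<open>e\<close> and \<open>s\<close>.\<close>
  have fib: "sat M (E'(x := m)) (Conj \<psi> \<phi>) \<longleftrightarrow> m \<in> fiber M \<psi> x \<phi> ss e s"
    if s: "s \<in> tuples M (map fst ss)" and m: "m \<in> univ M (main_sort L)"
      and E': "\<And>v. v \<notin> insert x' (set as) \<Longrightarrow> E' v = upd e ss s v" for E' s m
  proof -
    have agree: "(E'(x := m)) v = upd (e(x := m)) ss s v" if "v \<in> fv \<psi> \<union> fv \<phi>" for v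
    proof -
      have "v \<notin> insert x' (set as)" using that new by blast
      then have "(E'(x := m)) v = ((upd e ss s)(x := m)) v" using E' by simp
      then show ?thesis by (simp only: upd_fun_upd[OF x(4)])
    qed
    have "sat M (E'(x := m)) \<phi> \<longleftrightarrow> sat M (upd (e(x := m)) ss s) \<phi>"
      by (rule sat_cong) (rule agree, blast)
    moreover have "sat M (E'(x := m)) \<psi> \<longleftrightarrow> sat M (e(x := m)) \<psi>"
    proof (rule sat_cong)
      fix v assume v: "v \<in> fv \<psi>"
      then have "v \<notin> set ss" using ss(2) by blast
      then show "(E'(x := m)) v = (e(x := m)) v" using agree[of v] v by (simp add: upd_notin)
    qed
    ultimately show ?thesis using m x(1) by (simp add: fiber_def)
  qed
  have sub: "fiber M \<psi> x \<phi> ss e s \<subseteq> univ M (main_sort L)" for s using x(1) by (auto simp: fiber_def)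
  have g: "sat M (upd e ss s) (Disj (Neg (Ex x (Conj \<psi> \<phi>)))
         (Disj (Ex x' (Forall x (Iff (Conj \<psi> \<phi>) (Eq (Var x) (Var x')))))
           (Exs as (Forall x (Iff (Conj \<psi> \<phi>) (Rel (ball_rel L) (map Var as @ [Var x]))))))) \<longleftrightarrow>
      fiber M \<psi> x \<phi> ss e s = {} \<or> is_singleton (fiber M \<psi> x \<phi> ss e s) \<or> is_ball L M (fiber M \<psi> x \<phi> ss e s)"
    if s: "s \<in> tuples M (map fst ss)" for s
  proof -
    let ?F = "fiber M \<psi> x \<phi> ss e s" and ?E = "upd e ss s"
    have 1: "sat M ?E (Neg (Ex x (Conj \<psi> \<phi>))) \<longleftrightarrow> ?F = {}"
      using fib[OF s, of _ ?E] sub[of s] x(1) by (simp del: sat.simps(4) fun_upd_apply) blast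
    have 2: "sat M ?E (Ex x' (Forall x (Iff (Conj \<psi> \<phi>) (Eq (Var x) (Var x'))))) \<longleftrightarrow> is_singleton ?F"
    proof -
      have "sat M (?E(x' := c, x := m)) (Conj \<psi> \<phi>) \<longleftrightarrow> m \<in> ?F" if "m \<in> univ M (main_sort L)" for c m
        by (rule fib[OF s that]) auto
      then have "sat M ?E (Ex x' (Forall x (Iff (Conj \<psi> \<phi>) (Eq (Var x) (Var x'))))) \<longleftrightarrow>
          (\<exists>c\<in>univ M (main_sort L). \<forall>m\<in>univ M (main_sort L). m \<in> ?F \<longleftrightarrow> m = c)"
        using x(1-3) by (simp del: sat.simps(4))
      also have "\<dots> \<longleftrightarrow> is_singleton ?F" using sub[of s] unfolding is_singleton_def by blast
      finally show ?thesis .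
    qed
    have 3: "sat M ?E (Exs as (Forall x (Iff (Conj \<psi> \<phi>) (Rel (ball_rel L) (map Var as @ [Var x]))))) \<longleftrightarrow>
        (\<exists>a\<in>tuples M (ball_sorts L). ?F = {m \<in> univ M (main_sort L). a @ [m] \<in> rel_int M (ball_rel L)})"
    proof -
      have "sat M ((upd ?E as a)(x := m)) (Iff (Conj \<psi> \<phi>) (Rel (ball_rel L) (map Var as @ [Var x]))) \<longleftrightarrow>
          (m \<in> ?F \<longleftrightarrow> a @ [m] \<in> rel_int M (ball_rel L))"
        if a: "a \<in> tuples M (ball_sorts L)" and m: "m \<in> univ M (main_sort L)" for a m
      proof -
        have "sat M ((upd ?E as a)(x := m)) (Conj \<psi> \<phi>) \<longleftrightarrow> m \<in> ?F"
          by (rule fib[OF s m]) (simp add: upd_notin)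
        moreover have "map ((upd ?E as a)(x := m)) as = a"
        proof -
          have "x \<notin> set as" using new by blast
          then have "map ((upd ?E as a)(x := m)) as = map (upd ?E as a) as" by auto
          also have "length a = length as" using tuples_length[OF a] unfolding as(2)[symmetric] by simp
          then have "map (upd ?E as a) as = a" by (rule map_upd[OF as(1)])
          finally show ?thesis .
        qed
        then have "map (val M ((upd ?E as a)(x := m))) (map Var as @ [Var x]) = a @ [m]"
          by (simp add: o_def del: fun_upd_apply) simp
        ultimately show ?thesis by (simp only: sat_connectives sat.simps(2))
      qed
      then have "sat M ?E (Exs as (Forall x (Iff (Conj \<psi> \<phi>) (Rel (ball_rel L) (map Var as @ [Var x]))))) \<longleftrightarrow>
          (\<exists>a\<in>tuples M (ball_sorts L). \<forall>m\<in>univ M (main_sort L). m \<in> ?F \<longleftrightarrow> a @ [m] \<in> rel_int M (ball_rel L))"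
        unfolding sat_Exs[OF as(1)] as(2) sat_connectives(1) x(1) by simp
      also have "\<dots> \<longleftrightarrow> (\<exists>a\<in>tuples M (ball_sorts L). ?F = {m \<in> univ M (main_sort L). a @ [m] \<in> rel_int M (ball_rel L)})"
        using sub[of s] by (intro bex_cong refl) blast
      finally show ?thesis .
    qed
    show ?thesis unfolding sat_connectives(3) 1 2 3 is_ball_def by blast
  qed
  show ?thesis
    unfolding presents_fm_def presents_def sat.simps(4) sat_connectives(1,2) f sat_Alls[OF ss(1)]
    by (rule conj_cong[OF refl ball_cong[OF refl g]])
qed

text \<open>
  The index type of the ultrapower has to be lists of formulas, but the candidates in the compactness
  argument also carry value variables; these are coded into the formula.
\<close>

definition code_pair :: "('s, 'f, 'r) fm \<times> 's var list \<Rightarrow> ('s, 'f, 'r) fm" where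
  "code_pair p = Conj (fst p) (Exs (snd p) (Eqs [] []))"

lemma inj_code_pair: "inj code_pair"
proof -
  have "Exs us (Eqs [] []) = Exs vs (Eqs [] []) \<Longrightarrow> us = vs" for us vs :: "'s var list"
    by (induction us vs rule: list_induct2') (auto simp: Exs_def Eqs_def)
  then show ?thesis by (auto simp: inj_def code_pair_def)
qed

text \<open>\<open>V\<close> will contain \<open>x\<close>, the variables of \<psi> and the
  parameter variables, so that assigning the value variables disturbs none of them.\<close>

definition admissible :: "('s, 'f, 'r) lang \<Rightarrow> 's var set \<Rightarrow> ('s, 'f, 'r) fm \<times> 's var list \<Rightarrow> bool" where
  "admissible L V p \<longleftrightarrow> wf_fm L (fst p) \<and> distinct (snd p) \<and> fst ` set (snd p) \<subseteq> aux_sorts L \<and>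
     set (snd p) \<inter> V = {}"

text \<open>(b1) is applied over exactly the parameters that \<psi> uses, namely the values under
  \<open>e\<close> of its variables other than \<open>x\<close>. The graph it provides is then
  described by a formula read under the same \<open>e\<close>, which is what lets the parameters
  vary later.\<close>

lemma ex_presentation:
  assumes "b_minimal L M" "wf_fm L \<psi>" "fst x = main_sort L" "assignment M e" "finite V" "fv \<psi> \<subseteq> V" "x \<in> V"
  shows "\<exists>p. admissible L V p \<and> presents L M \<psi> x (fst p) (snd p) e"
proof -
  let ?m = "main_sort L"
  define A where "A = (\<lambda>v. (fst v, e v)) ` (fv \<psi> - {x})"
  define X where "X = dset M e [x] \<psi>"
  have A: "A \<subseteq> params M" using assignment_params[OF assms(4)] by (auto simp: A_def)
  have X: "definable L M A [?m] X" unfolding definable_iff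
    by (rule exI[of _ \<psi>], rule exI[of _ "[x]"], rule exI[of _ e])
      (use assms in \<open>auto simp: A_def X_def\<close>)
  have memX: "[m] \<in> X \<longleftrightarrow> m \<in> univ M ?m \<and> sat M (e(x := m)) \<psi>" for m
    by (auto simp: X_def dset_def tuples_Cons assms(3) upd_Cons)
  have XE: "\<exists>m. z = [m]" if "z \<in> X" for z
    using that by (auto simp: X_def dset_def tuples_Cons)
  \<comment> \<open>\<open>b_minimal\<close> speaks of a set together with a definable function on
    it; the identity of \<open>X\<close> is supplied, and this is its graph.\<close>
  have graph: "definable L M A ([?m] @ [?m]) {z @ z |z. z \<in> X}"
  proof -
    obtain x' where x': "x' \<notin> V" "fst x' = ?m"
      using fresh_disjoint[OF assms(5), of "[?m]"] by (auto simp: fresh_def)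
    have "x' \<noteq> x" "x' \<notin> fv \<psi>" using x'(1) assms(6,7) by auto
    have "sat M (e(x' := m', x := m)) \<psi> \<longleftrightarrow> sat M (e(x := m)) \<psi>" for m m'
      by (rule sat_cong) (use \<open>x' \<notin> fv \<psi>\<close> in auto)
    then have mem: "[m, m'] \<in> dset M e [x, x'] (Conj \<psi> (Eq (Var x) (Var x'))) \<longleftrightarrow> [m] \<in> X \<and> m = m'" for m m'
      using \<open>x' \<noteq> x\<close> x'(2) assms(3) by (auto simp: memX dset_def tuples_Cons upd_Cons)
    have "{z @ z |z. z \<in> X} = dset M e [x, x'] (Conj \<psi> (Eq (Var x) (Var x')))"
    proof (intro set_eqI iffI)
      fix w assume "w \<in> {z @ z |z. z \<in> X}"
      then obtain m where "w = [m, m]" "[m] \<in> X" using XE by fastforce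
      then show "w \<in> dset M e [x, x'] (Conj \<psi> (Eq (Var x) (Var x')))" using mem by simp
    next
      fix w assume w: "w \<in> dset M e [x, x'] (Conj \<psi> (Eq (Var x) (Var x')))"
      then obtain m m' where "w = [m, m']" by (auto simp: dset_def tuples_Cons)
      then have "w = [m] @ [m]" "[m] \<in> X" using mem w by auto
      then show "w \<in> {z @ z |z. z \<in> X}" by blast
    qed
    then show ?thesis unfolding definable_iff
      by (intro exI[of _ "Conj \<psi> (Eq (Var x) (Var x'))"] exI[of _ "[x, x']"] exI[of _ e])
        (use assms x' \<open>x' \<noteq> x\<close> in \<open>auto simp: A_def\<close>)
  qed
  have "definable_fun L M A [?m] [?m] X (tuples M [?m]) (\<lambda>z. z)"
    using graph definable_subset[OF X] by (simp add: definable_fun_def)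
  then have "b1 L M A X" using assms(1) A X unfolding b_minimal_def by blast
  then obtain \<rho> S f where \<rho>: "aux_set L M \<rho> S" and f: "definable_fun L M A [?m] \<rho> X S f"
    and fibs: "\<And>s. s \<in> f ` X \<Longrightarrow> is_singleton {m. [m] \<in> X \<and> f [m] = s} \<or> is_ball L M {m. [m] \<in> X \<and> f [m] = s}"
    unfolding b1_def by (elim exE conjE) (rule that, auto)
  define ss where "ss = fresh V \<rho>"
  have ss: "set ss \<inter> V = {}" "distinct ss" "map fst ss = \<rho>" using fresh_disjoint[OF assms(5)] by (simp_all add: ss_def)
  have xss: "x \<notin> set ss" using ss(1) assms(7) by blast
  have "definable L M A ([?m] @ \<rho>) {z @ f z |z. z \<in> X}" using f by (simp add: definable_fun_def)
  \<comment> \<open>Every element of \<open>A\<close> is the value of a variable of \<psi>, so the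
    graph can be defined under \<open>e\<close> itself and not merely under some assignment of its
    own.\<close>
  then obtain \<phi> where \<phi>: "wf_fm L \<phi>" "{z @ f z |z. z \<in> X} = dset M e (x # ss) \<phi>"
  proof (rule definable_dset_obtain[where V = "fv \<psi> - {x}" and ws = "x # ss", OF _ assms(4)])
    show "set (x # ss) \<inter> (fv \<psi> - {x}) = {}" using ss(1) assms(6) by auto
  qed (use ss xss assms(3) in \<open>auto simp: A_def\<close>)
  have graph_iff: "sat M (upd (e(x := m)) ss t) \<phi> \<longleftrightarrow> [m] \<in> X \<and> t = f [m]"
    if "m \<in> univ M ?m" "t \<in> tuples M \<rho>" for m t
  proof -
    have "sat M (upd (e(x := m)) ss t) \<phi> \<longleftrightarrow> m # t \<in> dset M e (x # ss) \<phi>"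
      using that by (simp add: dset_def tuples_Cons ss(3) assms(3) upd_Cons upd_fun_upd[OF xss] del: fun_upd_apply)
    also have "\<dots> \<longleftrightarrow> [m] \<in> X \<and> t = f [m]" 
      unfolding \<phi>(2)[symmetric]
    proof
      assume "m # t \<in> {z @ f z |z. z \<in> X}"
      then obtain z where z: "m # t = z @ f z" "z \<in> X" by blast
      with XE obtain m' where "z = [m']" by blast
      with z show "[m] \<in> X \<and> t = f [m]" by simp
    next
      assume "[m] \<in> X \<and> t = f [m]"
      then have "m # t = [m] @ f [m]" "[m] \<in> X" by simp_all
      then show "m # t \<in> {z @ f z |z. z \<in> X}" by blast
    qed
    finally show ?thesis .
  qed
  have fX: "f [m] \<in> tuples M \<rho>" if "[m] \<in> X" for m using f that unfolding definable_fun_def by blast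
  have fiber: "fiber M \<psi> x \<phi> ss e s = {m. [m] \<in> X \<and> f [m] = s}" if "s \<in> tuples M \<rho>" for s
    using graph_iff[OF _ that] by (auto simp: fiber_def assms(3) memX simp del: fun_upd_apply)
  have "presents L M \<psi> x \<phi> ss e"
    unfolding presents_def ss(3)
  proof (intro conjI ballI impI)
    fix m assume "m \<in> univ M (fst x)" "sat M (e(x := m)) \<psi>"
    then show "\<exists>s\<in>tuples M \<rho>. \<forall>t\<in>tuples M \<rho>. sat M (upd (e(x := m)) ss t) \<phi> \<longleftrightarrow> t = s"
      using graph_iff fX memX assms(3) by (intro bexI[of _ "f [m]"]) auto
  next
    fix s assume s: "s \<in> tuples M \<rho>"
    show "fiber M \<psi> x \<phi> ss e s = {} \<or> is_singleton (fiber M \<psi> x \<phi> ss e s) \<or> is_ball L M (fiber M \<psi> x \<phi> ss e s)"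
      unfolding fiber[OF s] using fibs[of s] by blast
  qed
  moreover have "admissible L V (\<phi>, ss)"
    using \<phi>(1) ss \<rho> unfolding admissible_def aux_set_def by (auto simp flip: ss(3))
  ultimately show ?thesis by (intro exI[of _ "(\<phi>, ss)"]) simp
qed

text \<open>One and the same formula is read in \<open>M\<close> and in its ultrapower, whose
  universes lie in different types; hence one equivalence for each type, with a common choice of
  variables.\<close>

lemma presents_fm_fresh:
  assumes "language L" "fst x = main_sort L" "admissible L V p" "wf_fm L \<psi>" "finite V" "fv \<psi> \<subseteq> V" "x \<in> V"
  obtains x' ss' as where "wf_fm L (presents_fm L \<psi> x (fst p) (snd p) x' ss' as)"
    "\<And>(M :: ('s, 'f, 'r, 'u) struct) e. sat M e (presents_fm L \<psi> x (fst p) (snd p) x' ss' as) \<longleftrightarrow>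
       presents L M \<psi> x (fst p) (snd p) e"
    "\<And>(M :: ('s, 'f, 'r, 'w) struct) e. sat M e (presents_fm L \<psi> x (fst p) (snd p) x' ss' as) \<longleftrightarrow>
       presents L M \<psi> x (fst p) (snd p) e"
proof -
  define \<phi> ss where "\<phi> = fst p" and "ss = snd p"
  define W where "W = V \<union> fv \<phi> \<union> set ss"
  define vs where "vs = fresh W (main_sort L # map fst ss @ ball_sorts L)"
  define x' ss' as where "x' = hd vs" and "ss' = take (length ss) (tl vs)" and "as = drop (length ss) (tl vs)"
  have p: "wf_fm L \<phi>" "distinct ss" "set ss \<inter> V = {}"
    using assms(3) by (auto simp: admissible_def \<phi>_def ss_def)
  have len: "vs \<noteq> []" by (simp add: vs_def fresh_def)
  then have vs: "vs = x' # ss' @ as" by (simp add: x'_def ss'_def as_def)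
  have "map fst vs = main_sort L # map fst ss @ ball_sorts L" by (simp add: vs_def)
  moreover have "length ss' = length ss" by (simp add: ss'_def vs_def)
  ultimately have sorts: "fst x' = main_sort L" "map fst ss' = map fst ss" "map fst as = ball_sorts L"
    unfolding vs by (auto simp: append_eq_append_conv)
  have dist: "distinct (x' # ss' @ as)" unfolding vs[symmetric] by (simp add: vs_def)
  have "finite W" using assms(5) by (simp add: W_def)
  then have new: "insert x' (set ss' \<union> set as) \<inter> W = {}"
    using fresh_disjoint[of W "main_sort L # map fst ss @ ball_sorts L"] unfolding vs_def[symmetric] vs by auto
  have *: "x' \<noteq> x" "x \<notin> set ss" "set ss \<inter> fv \<psi> = {}"
    "insert x' (set ss' \<union> set as) \<inter> (fv \<psi> \<union> fv \<phi> \<union> insert x (set ss)) = {}"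
    using new p(3) assms(6,7) unfolding W_def by blast+
  have dist': "distinct ss'" "distinct as" using dist by auto
  show ?thesis
  proof (rule that[unfolded \<phi>_def[symmetric] ss_def[symmetric]])
    show "wf_fm L (presents_fm L \<psi> x \<phi> ss x' ss' as)"
      by (rule wf_presents_fm) (fact assms p sorts)+
  qed (rule sat_presents_fm; fact assms p sorts * dist')+
qed

text \<open>
  Compactness: otherwise choose, for every list of candidate formulas, a bad parameter; (b1) in the
  ultrapower, at the class of these parameters, gives a formula which is good at almost all of them.
\<close>

lemma finite_presentations:
  fixes M :: "('s, 'f, 'r, 'u) struct"
  assumes L: "language L" and T: "b_minimal_theory TYPE(('s, 'f, 'r, 'u) big) L T" and M: "is_model L T M"
    and \<psi>: "wf_fm L \<psi>" "fst x = main_sort L" and e: "assignment M e"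
    and V: "finite V" "fv \<psi> \<subseteq> V" "x \<in> V"
  shows "\<exists>G. finite G \<and> (\<forall>p\<in>G. admissible L V p) \<and>
    (\<forall>y\<in>tuples M (map fst ys). \<exists>p\<in>G. presents L M \<psi> x (fst p) (snd p) (upd e ys y))"
proof (rule ccontr)
  assume contra: "\<not> ?thesis"
  define G where "G l = {p. admissible L V p \<and> code_pair p \<in> set l}" for l :: "('s, 'f, 'r) fm list"
  have fin: "finite (G l)" for l
  proof -
    have "finite (code_pair -` set l)" by (intro finite_vimageI inj_code_pair) simp
    then show ?thesis by (rule rev_finite_subset) (auto simp: G_def)
  qed
  have adm: "\<forall>p\<in>G l. admissible L V p" for l by (simp add: G_def)
  have "\<exists>y. y \<in> tuples M (map fst ys) \<and> (\<forall>p\<in>G l. \<not> presents L M \<psi> x (fst p) (snd p) (upd e ys y))" for l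
  proof (rule ccontr)
    assume "\<not> ?thesis"
    then have "\<forall>y\<in>tuples M (map fst ys). \<exists>p\<in>G l. presents L M \<psi> x (fst p) (snd p) (upd e ys y)" by blast
    with fin[of l] adm[of l] have *: "finite (G l) \<and> (\<forall>p\<in>G l. admissible L V p) \<and>
      (\<forall>y\<in>tuples M (map fst ys). \<exists>p\<in>G l. presents L M \<psi> x (fst p) (snd p) (upd e ys y))" by simp
    show False by (rule notE[OF contra], rule exI, rule *)
  qed
  then obtain y where y: "\<And>l. y l \<in> tuples M (map fst ys)"
    "\<And>l p. p \<in> G l \<Longrightarrow> \<not> presents L M \<psi> x (fst p) (snd p) (upd e ys (y l))" by metis
  \<comment> \<open>Finitely many formulas fit into one list, so these sets have the finite
    intersection property. An ultrafilter containing them sees every fixed formula in almost all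
    lists.\<close>
  define B where "B = range (\<lambda>a. {l :: ('s, 'f, 'r) fm list. a \<in> set l})"
  have fip: "\<Inter>K \<noteq> {}" if K: "finite K" "K \<subseteq> B" for K
  proof -
    obtain F where F: "finite F" "K = (\<lambda>a. {l. a \<in> set l}) ` F"
      using finite_subset_image[OF K[unfolded B_def]] by blast
    obtain l where "set l = F" using finite_list[OF F(1)] by blast
    then have "l \<in> \<Inter>K" using F(2) by auto
    then show ?thesis by blast
  qed
  obtain U :: "('s, 'f, 'r) fm list filter" where U: "U \<noteq> bot"
    "\<And>P. eventually P U \<or> eventually (\<lambda>l. \<not> P l) U" "\<And>S. S \<in> B \<Longrightarrow> eventually (\<lambda>i. i \<in> S) U"
    by (rule ex_ultrafilter[of B]) (rule fip, assumption+, rule that)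
  define N where "N = ultrapower U M"
  \<comment> \<open>\<open>E l\<close> carries the parameter that is bad for all candidates in
    \<open>l\<close>. Taking classes variable by variable turns the family into one assignment of
    the ultrapower.\<close>
  define E where "E l = upd e ys (y l)" for l
  have E: "assignment M (E l)" for l unfolding E_def by (rule assignment_upd[OF e y(1)])
  have "is_model L T N" unfolding N_def by (rule is_model_ultrapower[OF U(1,2) M])
  then have "b_minimal L N" using T by (simp add: b_minimal_theory_def)
  moreover have "assignment N (\<lambda>v. uclass U (\<lambda>l. E l v))"
    using E by (simp add: assignment_def N_def uclass_mem_univ del: split_paired_All)
  ultimately obtain p where p: "admissible L V p"
    "presents L N \<psi> x (fst p) (snd p) (\<lambda>v. uclass U (\<lambda>l. E l v))"
    using ex_presentation[OF _ \<psi> _ V] by blast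
  obtain x' ss' as where sat: "\<And>(M :: ('s, 'f, 'r, 'u) struct) e.
      sat M e (presents_fm L \<psi> x (fst p) (snd p) x' ss' as) \<longleftrightarrow> presents L M \<psi> x (fst p) (snd p) e"
    "\<And>(M :: ('s, 'f, 'r, ('s, 'f, 'r, 'u) big) struct) e.
      sat M e (presents_fm L \<psi> x (fst p) (snd p) x' ss' as) \<longleftrightarrow> presents L M \<psi> x (fst p) (snd p) e"
    by (rule presents_fm_fresh[OF L \<psi>(2) p(1) \<psi>(1) V]) (rule that; assumption)
  have ne: "univ M s \<noteq> {}" for s using M by (simp add: is_model_def is_struct_def)
  have "eventually (\<lambda>l. presents L M \<psi> x (fst p) (snd p) (E l)) U"
    using p(2) Los_ultrapower[OF U(1,2) ne, of E "presents_fm L \<psi> x (fst p) (snd p) x' ss' as"]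
    by (simp only: sat N_def)
  moreover have "eventually (\<lambda>l. p \<in> G l) U"
    using U(3)[of "{l. code_pair p \<in> set l}"] p(1) by (simp add: B_def G_def)
  ultimately have "eventually (\<lambda>l. False) U"
    by eventually_elim (use y(2) in \<open>auto simp: E_def\<close>)
  then show False using U(1) by (simp add: eventually_False)
qed

text \<open>The condition \<open>presents\<close> with formulas replaced by the sets they define, so
  that syntax is not mentioned in the geometric part. The order is the point, then the base, then
  the value.\<close>

definition presents_over :: "('s, 'f, 'r) lang \<Rightarrow> ('s, 'f, 'r, 'u) struct \<Rightarrow> 'u list set \<Rightarrow> 's list \<Rightarrow>
    'u list set \<Rightarrow> 'u list \<Rightarrow> bool" where
  "presents_over L M X \<rho> R y \<longleftrightarrow>
     (\<forall>m. m # y \<in> X \<longrightarrow> (\<exists>s\<in>tuples M \<rho>. \<forall>t\<in>tuples M \<rho>. m # y @ t \<in> R \<longleftrightarrow> t = s)) \<and>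
     (\<forall>s\<in>tuples M \<rho>. {m. m # y \<in> X \<and> m # y @ s \<in> R} = {} \<or>
        is_singleton {m. m # y \<in> X \<and> m # y @ s \<in> R} \<or> is_ball L M {m. m # y \<in> X \<and> m # y @ s \<in> R})"

text \<open>A relation \<open>R\<close> is defined over all of the base, also where it presents
  nothing. The locus where it does present the fiber is definable because \<open>presents_fm\<close>
  expresses it, and the base can later be cut along these loci.\<close>

lemma uniform_b1:
  fixes M :: "('s, 'f, 'r, 'u) struct"
  assumes L: "language L" and T: "b_minimal_theory TYPE(('s, 'f, 'r, 'u) big) L T" and M: "is_model L T M"
    and X: "dfn L M (main_sort L # \<tau>) X"
  shows "\<exists>H. finite H \<and>
    (\<forall>(\<rho>, R)\<in>H. set \<rho> \<subseteq> aux_sorts L \<and> dfn L M (main_sort L # \<tau> @ \<rho>) R \<and>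
       dfn L M \<tau> {y \<in> tuples M \<tau>. presents_over L M X \<rho> R y}) \<and>
    (\<forall>y\<in>tuples M \<tau>. \<exists>(\<rho>, R)\<in>H. presents_over L M X \<rho> R y)"
proof -
  define x where "x = (main_sort L, 0 :: nat)"
  define ys where "ys = fresh {x} \<tau>"
  have x: "fst x = main_sort L" by (simp add: x_def)
  have ys: "distinct ys" "map fst ys = \<tau>" "x \<notin> set ys"
    using fresh_disjoint[of "{x}" \<tau>] by (auto simp: ys_def)
  obtain \<psi> e where \<psi>: "wf_fm L \<psi>" "assignment M e" "X = dset M e (x # ys) \<psi>"
    using definable_obtain[OF X, of "x # ys" "{}"] ys x by auto
  \<comment> \<open>Including \<open>ys\<close> keeps the value variables of the candidates apart
    from the parameter variables, so all of them can be object variables of one formula.\<close>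
  define V where "V = fv \<psi> \<union> insert x (set ys)"
  have V: "finite V" "fv \<psi> \<subseteq> V" "x \<in> V" by (auto simp: V_def)
  obtain G where G: "finite G" "\<And>p. p \<in> G \<Longrightarrow> admissible L V p"
    "\<And>y. y \<in> tuples M \<tau> \<Longrightarrow> \<exists>p\<in>G. presents L M \<psi> x (fst p) (snd p) (upd e ys y)"
    using finite_presentations[OF L T M \<psi>(1) x \<psi>(2) V, of ys] unfolding ys(2) by blast
  define R where "R p = dset M e (x # ys @ snd p) (fst p)" for p
  define h where "h p = (map fst (snd p), R p)" for p
  have key: "presents_over L M X (map fst (snd p)) (R p) y \<longleftrightarrow> presents L M \<psi> x (fst p) (snd p) (upd e ys y)"
    if p: "p \<in> G" and y: "y \<in> tuples M \<tau>" for p y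
  proof -
    let ?\<phi> = "fst p" and ?ss = "snd p" and ?e = "upd e ys y"
    have ss: "set ?ss \<inter> V = {}" using G(2)[OF p] by (simp add: admissible_def)
    then have xss: "x \<notin> set ?ss" "set ys \<inter> set ?ss = {}" by (auto simp: V_def)
    have len: "length y = length ys" using y ys(2) by (auto dest: tuples_length)
    have memX: "m # y \<in> X \<longleftrightarrow> m \<in> univ M (fst x) \<and> sat M (?e(x := m)) \<psi>" for m
      using y by (simp add: \<psi>(3) dset_def tuples_Cons ys(2) upd_Cons)
    have memR: "m # y @ s \<in> R p \<longleftrightarrow> m \<in> univ M (fst x) \<and> sat M (upd (?e(x := m)) ?ss s) ?\<phi>"
      if s: "s \<in> tuples M (map fst ?ss)" for m s
    proof -
      have "upd e (x # ys @ ?ss) (m # y @ s) = (upd ?e ?ss s)(x := m)"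
        unfolding upd_Cons upd_append[OF len] upd_append_swap[OF len xss(2)] ..
      also have "\<dots> = upd (?e(x := m)) ?ss s" by (rule upd_fun_upd[OF xss(1)])
      finally have "upd e (x # ys @ ?ss) (m # y @ s) = upd (?e(x := m)) ?ss s" .
      moreover have "m # y @ s \<in> tuples M (map fst (x # ys @ ?ss)) \<longleftrightarrow> m \<in> univ M (fst x)"
        using y s ys(2) tuples_length[OF y] by (simp add: tuples_Cons tuples_append_iff)
      ultimately show ?thesis by (simp add: R_def dset_def del: fun_upd_apply)
    qed
    have "{m. m # y \<in> X \<and> m # y @ s \<in> R p} = fiber M \<psi> x ?\<phi> ?ss ?e s"
      if "s \<in> tuples M (map fst ?ss)" for s
      using memR[OF that] memX by (auto simp: fiber_def simp del: fun_upd_apply)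
    then show ?thesis unfolding presents_over_def presents_def
      by (intro conj_cong) (auto simp: memX memR simp del: fun_upd_apply)
  qed
  show ?thesis
  proof (intro exI[of _ "h ` G"] conjI)
    show "finite (h ` G)" using G(1) by simp
    show "\<forall>y\<in>tuples M \<tau>. \<exists>(\<rho>, R)\<in>h ` G. presents_over L M X \<rho> R y"
      using G(3) key unfolding h_def by fastforce
    have "set (map fst (snd p)) \<subseteq> aux_sorts L \<and> dfn L M (main_sort L # \<tau> @ map fst (snd p)) (R p) \<and>
       dfn L M \<tau> {y \<in> tuples M \<tau>. presents_over L M X (map fst (snd p)) (R p) y}" if p: "p \<in> G" for p
    proof (intro conjI)
      note adm = G(2)[OF p]
      show "set (map fst (snd p)) \<subseteq> aux_sorts L" using adm by (simp add: admissible_def)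
      have "distinct (x # ys @ snd p)" using adm ys by (auto simp: admissible_def V_def)
      from definable_dset[OF _ this \<psi>(2), of L "fst p"]
      show "dfn L M (main_sort L # \<tau> @ map fst (snd p)) (R p)"
        using adm ys(2) x by (simp add: admissible_def R_def)
      obtain x' ss' as where "wf_fm L (presents_fm L \<psi> x (fst p) (snd p) x' ss' as)"
        "\<And>(M :: ('s, 'f, 'r, 'u) struct) e.
          sat M e (presents_fm L \<psi> x (fst p) (snd p) x' ss' as) \<longleftrightarrow> presents L M \<psi> x (fst p) (snd p) e"
        by (rule presents_fm_fresh[OF L x adm \<psi>(1) V]) (rule that; assumption)
      then show "dfn L M \<tau> {y \<in> tuples M \<tau>. presents_over L M X (map fst (snd p)) (R p) y}"
        using key[OF p] by (intro dfnI[OF _ ys(1) \<psi>(2) ys(2)]) auto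
    qed
    then show "\<forall>(\<rho>, R)\<in>h ` G. set \<rho> \<subseteq> aux_sorts L \<and> dfn L M (main_sort L # \<tau> @ \<rho>) R \<and>
       dfn L M \<tau> {y \<in> tuples M \<tau>. presents_over L M X \<rho> R y}"
      unfolding h_def by blast
  qed
qed

section \<open>Finite partitions\<close>

definition decomp :: "('a set \<Rightarrow> bool) \<Rightarrow> 'a set \<Rightarrow> bool" where
  "decomp Q X \<longleftrightarrow> (\<exists>P. finite P \<and> partition_on X P \<and> (\<forall>C\<in>P. Q C))"

text \<open>\<open>partition_on\<close> forbids an empty block, so the empty set receives the empty
  partition and not itself as its only block.\<close>

lemma decomp_single: "Q X \<Longrightarrow> decomp Q X"
proof (cases "X = {}")
  case True
  then show ?thesis by (auto simp: decomp_def partition_on_empty)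
next
  case False
  assume "Q X"
  then show ?thesis unfolding decomp_def using partition_on_space[OF False] by (intro exI[of _ "{X}"]) auto
qed

lemma decomp_mono:
  assumes "decomp Q X" "\<And>C. Q C \<Longrightarrow> Q' C"
  shows "decomp Q' X"
proof -
  obtain P where "finite P" "partition_on X P" "\<forall>C\<in>P. Q C" using assms(1) unfolding decomp_def by blast
  then show ?thesis unfolding decomp_def using assms(2) by (intro exI[of _ P]) simp
qed

lemma decomp_restrict: "decomp Q X \<Longrightarrow> decomp (\<lambda>C. C \<subseteq> X \<and> Q C) X"
  unfolding decomp_def partition_on_def by blast

lemma decomp_Un:
  assumes "decomp Q A" "decomp Q B" "A \<inter> B = {}"
  shows "decomp Q (A \<union> B)"
proof -
  obtain P P' where P: "finite P" "partition_on A P" "\<forall>C\<in>P. Q C" "finite P'" "partition_on B P'" "\<forall>C\<in>P'. Q C"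
    using assms(1,2) unfolding decomp_def by blast
  have "partition_on (A \<union> B) (P \<union> P')"
  proof (rule partition_onI)
    show "\<Union> (P \<union> P') = A \<union> B" using P(2,5) by (auto simp: partition_on_def)
    show "{} \<notin> P \<union> P'" using P(2,5) by (auto simp: partition_on_def)
    fix p q assume pq: "p \<in> P \<union> P'" "q \<in> P \<union> P'" "p \<noteq> q"
    have "p \<subseteq> A" if "p \<in> P" for p using that P(2) by (auto simp: partition_on_def)
    moreover have "p \<subseteq> B" if "p \<in> P'" for p using that P(5) by (auto simp: partition_on_def)
    ultimately show "disjnt p q"
      using pq assms(3) disjointD[OF partition_onD2[OF P(2)], of p q]
        disjointD[OF partition_onD2[OF P(5)], of p q]
      unfolding disjnt_def by blast
  qed
  with P show ?thesis unfolding decomp_def by blast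
qed

lemma decomp_UNION:
  "finite I \<Longrightarrow> (\<And>i. i \<in> I \<Longrightarrow> decomp Q (A i)) \<Longrightarrow> disjoint_family_on A I \<Longrightarrow> decomp Q (\<Union>i\<in>I. A i)"
proof (induction I rule: finite_induct)
  case empty
  then show ?case by (auto simp: decomp_def partition_on_empty)
next
  case (insert i I)
  have "A i \<inter> (\<Union>i\<in>I. A i) = {}" using insert.prems(2) insert.hyps(2) by (auto simp: disjoint_family_on_def)
  moreover have "decomp Q (\<Union>i\<in>I. A i)"
    using insert.prems by (intro insert.IH) (auto simp: disjoint_family_on_def)
  ultimately show ?case using decomp_Un[of Q "A i"] insert.prems(1) by simp
qed

text \<open>The preimages of the blocks are disjoint and may be refined independently. With
  \<open>h\<close> a projection or a permutation of coordinates this transports partitions of a base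
  to the set above it.\<close>

lemma decomp_vimage:
  assumes "decomp Q X" "\<And>z. z \<in> Z \<Longrightarrow> h z \<in> X"
    and "\<And>C. C \<subseteq> X \<Longrightarrow> Q C \<Longrightarrow> decomp Q' {z \<in> Z. h z \<in> C}"
  shows "decomp Q' Z"
proof -
  obtain P where P: "finite P" "partition_on X P" "\<forall>C\<in>P. Q C" using assms(1) unfolding decomp_def by blast
  have "decomp Q' (\<Union>C\<in>P. {z \<in> Z. h z \<in> C})"
  proof (rule decomp_UNION[OF P(1)])
    show "decomp Q' {z \<in> Z. h z \<in> C}" if "C \<in> P" for C
      using that P(2,3) by (intro assms(3)) (auto simp: partition_on_def)
    show "disjoint_family_on (\<lambda>C. {z \<in> Z. h z \<in> C}) P"
      using partition_onD2[OF P(2)] unfolding disjoint_family_on_def by (auto dest: disjointD)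
  qed
  moreover have "(\<Union>C\<in>P. {z \<in> Z. h z \<in> C}) = Z" using assms(2) P(2) by (auto simp: partition_on_def)
  ultimately show ?thesis by simp
qed

text \<open>Removing the members of the cover one after another makes it disjoint and keeps the
  pieces definable.\<close>

lemma decomp_cover:
  assumes "finite K" "\<And>B. B \<in> K \<Longrightarrow> dfn L M \<sigma> B" "dfn L M \<sigma> W" "W \<subseteq> \<Union>K"
  shows "decomp (\<lambda>C. dfn L M \<sigma> C \<and> (\<exists>B\<in>K. C \<subseteq> B)) W"
  using assms
proof (induction K arbitrary: W rule: finite_induct)
  case empty
  then show ?case by (auto simp: decomp_def partition_on_empty)
next
  case (insert B K)
  have "decomp (\<lambda>C. dfn L M \<sigma> C \<and> (\<exists>B\<in>K. C \<subseteq> B)) (W - B)"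
    using insert.prems by (intro insert.IH dfn_Diff) auto
  then have "decomp (\<lambda>C. dfn L M \<sigma> C \<and> (\<exists>B\<in>insert B K. C \<subseteq> B)) (W - B)"
    by (rule decomp_mono) blast
  moreover have "dfn L M \<sigma> (W \<inter> B)" by (rule dfn_Int) (simp_all add: insert.prems)
  then have "decomp (\<lambda>C. dfn L M \<sigma> C \<and> (\<exists>B\<in>insert B K. C \<subseteq> B)) (W \<inter> B)"
    by (intro decomp_single) auto
  ultimately have "decomp (\<lambda>C. dfn L M \<sigma> C \<and> (\<exists>B\<in>insert B K. C \<subseteq> B)) ((W - B) \<union> (W \<inter> B))"
    by (rule decomp_Un) auto
  moreover have "(W - B) \<union> (W \<inter> B) = W" by blast
  ultimately show ?case by simp
qed

section \<open>Decomposition in one coordinate\<close>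

text \<open>The presentation of a cell in \<open>M \<times> \<sigma>\<close>, without the component that only copies \<open>\<sigma>\<close>.\<close>

definition fiber_cell :: "('s, 'f, 'r) lang \<Rightarrow> ('s, 'f, 'r, 'u) struct \<Rightarrow> 's list \<Rightarrow> nat \<Rightarrow> 'u list set \<Rightarrow>
    's list \<Rightarrow> ('u list \<Rightarrow> 'u list) \<Rightarrow> bool" where
  "fiber_cell L M \<sigma> j C \<rho> g \<longleftrightarrow> j \<in> {0, 1} \<and> set \<rho> \<subseteq> aux_sorts L \<and> dfn L M (main_sort L # \<sigma>) C \<and>
     g ` C \<subseteq> tuples M \<rho> \<and> dfn L M ((main_sort L # \<sigma>) @ \<rho>) {z @ g z |z. z \<in> C} \<and>
     (\<forall>w s. {m. m # w \<in> C \<and> g (m # w) = s} \<noteq> {} \<longrightarrow>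
        j = 0 \<and> is_singleton {m. m # w \<in> C \<and> g (m # w) = s} \<or>
        j = 1 \<and> is_ball L M {m. m # w \<in> C \<and> g (m # w) = s})"

lemma bex_blocks:
  "(\<exists>bs\<in>blocks M []. Q bs) \<longleftrightarrow> Q []"
  "(\<exists>bs\<in>blocks M (\<sigma> # \<sigma>s). Q bs) \<longleftrightarrow> (\<exists>b\<in>tuples M \<sigma>. \<exists>bs\<in>blocks M \<sigma>s. Q (b # bs))"
  unfolding Bex_def blocks_Cons blocks_Nil by metis+

lemma bex_tuples_single: "(\<exists>b\<in>tuples M [s]. Q b) \<longleftrightarrow> (\<exists>m\<in>univ M s. Q [m])"
  unfolding bex_tuples_Cons by (simp add: Bex_def)

lemma ball_tuples_single: "(\<forall>b\<in>tuples M [s]. Q b) \<longleftrightarrow> (\<forall>m\<in>univ M s. Q [m])"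
  using bex_tuples_single[of M s "\<lambda>b. \<not> Q b"] by blast

lemma is_singleton_iff: "m \<in> S \<Longrightarrow> is_singleton S \<longleftrightarrow> (\<forall>m'. m' \<in> S \<longrightarrow> m' = m)"
  by (auto simp: is_singleton_def)

text \<open>A ball that happens to be a point is counted among the points. Being a singleton can be
  tested without quantifying over parameters of balls, and the fibers that fail the test can only be
  balls.\<close>

lemma presented_decomp:
  assumes M: "is_struct L M" and X: "dfn L M (main_sort L # \<sigma>) X" and \<rho>: "set \<rho> \<subseteq> aux_sorts L"
    and R: "dfn L M (main_sort L # \<sigma> @ \<rho>) R"
    and pres: "\<And>m w. m # w \<in> X \<Longrightarrow> presents_over L M X \<rho> R w"
  shows "decomp (\<lambda>C. \<exists>j g. fiber_cell L M \<sigma> j C \<rho> g) X"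
proof -
  let ?m = "main_sort L"
  have XE: "\<exists>m w. z = m # w \<and> m \<in> univ M ?m \<and> w \<in> tuples M \<sigma>" if "z \<in> X" for z
    using that definable_subset[OF X] by (auto simp: tuples_Cons subset_iff)
  have "\<exists>s. s \<in> tuples M \<rho> \<and> (\<forall>t\<in>tuples M \<rho>. z @ t \<in> R \<longleftrightarrow> t = s)" if z: "z \<in> X" for z
  proof -
    obtain m w where mw: "z = m # w" using XE[OF z] by blast
    then have "presents_over L M X \<rho> R w" using pres z by blast
    then show ?thesis using z unfolding presents_over_def mw by (simp add: Bex_def)
  qed
  then obtain f where f: "\<And>z. z \<in> X \<Longrightarrow> f z \<in> tuples M \<rho>"
    "\<And>z t. z \<in> X \<Longrightarrow> t \<in> tuples M \<rho> \<Longrightarrow> z @ t \<in> R \<longleftrightarrow> t = f z" by metis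
  have f2: "m # w @ t \<in> R \<longleftrightarrow> t = f (m # w)" if "m # w \<in> X" "t \<in> tuples M \<rho>" for m w t
    using f(2)[OF that] by simp
  define F where "F w s = {m. m # w \<in> X \<and> f (m # w) = s}" for w s
  have F: "is_singleton (F w s) \<or> is_ball L M (F w s)" if ne: "F w s \<noteq> {}" for w s
  proof -
    obtain m where m: "m # w \<in> X" "f (m # w) = s" using ne by (auto simp: F_def)
    then have s: "s \<in> tuples M \<rho>" using f(1) by blast
    have eq: "{m. m # w \<in> X \<and> m # w @ s \<in> R} = F w s"
      using f2[OF _ s] by (auto simp: F_def)
    have "\<forall>s\<in>tuples M \<rho>. {m. m # w \<in> X \<and> m # w @ s \<in> R} = {} \<or>
        is_singleton {m. m # w \<in> X \<and> m # w @ s \<in> R} \<or> is_ball L M {m. m # w \<in> X \<and> m # w @ s \<in> R}"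
      using pres[OF m(1)] unfolding presents_over_def by (rule conjunct2)
    from bspec[OF this s] show ?thesis using ne unfolding eq by simp
  qed
  have graph: "dfn L M ((?m # \<sigma>) @ \<rho>) {z @ f z |z. z \<in> D}" if D: "dfn L M (?m # \<sigma>) D" "D \<subseteq> X" for D
  proof (rule bdef_dfn)
    show "bdef L M [?m # \<sigma>, \<rho>] (\<lambda>bs. bs ! 0 \<in> D \<and> bs ! 0 @ bs ! 1 \<in> R)"
      by (intro bdef_conj bdef_mem[OF D(1), of _ "[0]"] bdef_mem[OF R, of _ "[0, 1]"]) auto
    fix z
    show "z \<in> {z @ f z |z. z \<in> D} \<longleftrightarrow>
        (\<exists>bs\<in>blocks M [?m # \<sigma>, \<rho>]. z = concat bs \<and> bs ! 0 \<in> D \<and> bs ! 0 @ bs ! 1 \<in> R)"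
    proof
      assume "z \<in> {z @ f z |z. z \<in> D}"
      then obtain d where d: "z = d @ f d" "d \<in> D" by blast
      moreover from d D(2) have "d \<in> X" by blast
      ultimately show "\<exists>bs\<in>blocks M [?m # \<sigma>, \<rho>]. z = concat bs \<and> bs ! 0 \<in> D \<and> bs ! 0 @ bs ! 1 \<in> R"
        unfolding bex_blocks using f definable_subset[OF D(1)]
        by (intro bexI[of _ d] bexI[of _ "f d"]) auto
    next
      assume "\<exists>bs\<in>blocks M [?m # \<sigma>, \<rho>]. z = concat bs \<and> bs ! 0 \<in> D \<and> bs ! 0 @ bs ! 1 \<in> R"
      then obtain d t where "z = d @ t" "t \<in> tuples M \<rho>" "d \<in> D" "d @ t \<in> R" unfolding bex_blocks by auto
      then show "z \<in> {z @ f z |z. z \<in> D}" using f(2)[of d t] D(2) by blast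
    qed
  qed auto
  define X0 where "X0 = {z \<in> X. is_singleton (F (tl z) (f z))}"
  have X0: "dfn L M (?m # \<sigma>) X0"
  proof -
    \<comment> \<open>Block 0 is the point, block 1 the base, block 2 the value and block 3 a
      competitor of the point. \<open>Q1\<close> says that a competitor with the same value equals
      the point; \<open>Q2\<close> adds that block 2 is the value at the point.\<close>
    define Q1 where "Q1 = (\<lambda>bs :: 'd list list. bs ! 3 @ bs ! 1 \<in> X \<and> bs ! 3 @ bs ! 1 @ bs ! 2 \<in> R \<longrightarrow> bs ! 3 = bs ! 0)"
    have "bdef L M ([[?m], \<sigma>, \<rho>] @ [[?m]]) Q1" unfolding Q1_def
      by (intro bdef_imp bdef_conj bdef_eq M bdef_mem[OF X, of _ "[3, 1]"] bdef_mem[OF R, of _ "[3, 1, 2]"]) auto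
    note Q1 = bdef_all[OF this]
    define Q2 where "Q2 = (\<lambda>bs :: 'd list list. bs ! 0 @ bs ! 1 @ bs ! 2 \<in> R \<and> (\<forall>b\<in>tuples M [?m]. Q1 (bs @ [b])))"
    have "bdef L M [[?m], \<sigma>, \<rho>] Q2" unfolding Q2_def
      by (intro bdef_conj Q1 bdef_mem[OF R, of _ "[0, 1, 2]"]) auto
    then have "bdef L M ([[?m], \<sigma>] @ [\<rho>]) Q2" by simp
    note Q2 = bdef_ex[OF this]
    show ?thesis
    proof (rule bdef_dfn)
      show "bdef L M [[?m], \<sigma>] (\<lambda>bs. bs ! 0 @ bs ! 1 \<in> X \<and> (\<exists>b\<in>tuples M \<rho>. Q2 (bs @ [b])))"
        by (intro bdef_conj Q2 bdef_mem[OF X, of _ "[0, 1]"]) auto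
      have Q2_iff: "(\<exists>s\<in>tuples M \<rho>. Q2 [[m], w, s]) \<longleftrightarrow> is_singleton (F w (f (m # w)))"
        if mw: "m # w \<in> X" for m w
      proof -
        have sub: "m' \<in> univ M ?m" if "m' # w \<in> X" for m' using XE[OF that] by auto
        have "(\<exists>s\<in>tuples M \<rho>. Q2 [[m], w, s]) \<longleftrightarrow> Q2 [[m], w, f (m # w)]"
          using f(1)[OF mw] f2[OF mw] by (auto simp: Q2_def)
        also have "\<dots> \<longleftrightarrow> (\<forall>m'. m' # w \<in> X \<and> f (m' # w) = f (m # w) \<longrightarrow> m' = m)"
        proof -
          have "Q2 [[m], w, f (m # w)] \<longleftrightarrow>
              (\<forall>m'\<in>univ M ?m. m' # w \<in> X \<and> m' # w @ f (m # w) \<in> R \<longrightarrow> m' = m)"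
            using f2[OF mw f(1)[OF mw]] by (simp add: Q2_def Q1_def ball_tuples_single)
          also have "\<dots> \<longleftrightarrow> (\<forall>m'. m' # w \<in> X \<and> f (m' # w) = f (m # w) \<longrightarrow> m' = m)"
            using f2[OF _ f(1)[OF mw]] sub by metis
          finally show ?thesis .
        qed
        also have "\<dots> \<longleftrightarrow> is_singleton (F w (f (m # w)))"
        proof -
          have "m \<in> F w (f (m # w))" using mw by (simp add: F_def)
          then have "is_singleton (F w (f (m # w))) \<longleftrightarrow> (\<forall>m'. m' \<in> F w (f (m # w)) \<longrightarrow> m' = m)"
            by (rule is_singleton_iff)
          then show ?thesis unfolding F_def mem_Collect_eq by (rule sym)
        qed
        finally show ?thesis .
      qed
      fix z
      show "z \<in> X0 \<longleftrightarrow> (\<exists>bs\<in>blocks M [[?m], \<sigma>]. z = concat bs \<and> bs ! 0 @ bs ! 1 \<in> X \<and> (\<exists>b\<in>tuples M \<rho>. Q2 (bs @ [b])))"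
      proof
        assume "z \<in> X0"
        then have z: "z \<in> X" "is_singleton (F (tl z) (f z))" by (auto simp: X0_def)
        obtain m w where mw: "z = m # w" "m \<in> univ M ?m" "w \<in> tuples M \<sigma>" using XE[OF z(1)] by blast
        then show "\<exists>bs\<in>blocks M [[?m], \<sigma>]. z = concat bs \<and> bs ! 0 @ bs ! 1 \<in> X \<and> (\<exists>b\<in>tuples M \<rho>. Q2 (bs @ [b]))"
          using z Q2_iff[of m w] unfolding bex_blocks bex_tuples_single
          by (intro bexI[of _ m] bexI[of _ w]) auto
      next
        assume "\<exists>bs\<in>blocks M [[?m], \<sigma>]. z = concat bs \<and> bs ! 0 @ bs ! 1 \<in> X \<and> (\<exists>b\<in>tuples M \<rho>. Q2 (bs @ [b]))"
        then obtain m w where "z = m # w" "m # w \<in> X" "\<exists>b\<in>tuples M \<rho>. Q2 [[m], w, b]"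
          unfolding bex_blocks bex_tuples_single by auto
        then show "z \<in> X0" using Q2_iff[of m w] by (simp add: X0_def)
      qed
    qed simp
  qed
  have X1: "dfn L M (?m # \<sigma>) (X - X0)" by (rule dfn_Diff[OF X X0])
  have "fiber_cell L M \<sigma> 0 X0 \<rho> f"
  proof -
    \<comment> \<open>Membership in \<open>X0\<close> depends on a point of \<open>X\<close> only
      through its base and its value, so \<open>X0\<close> is a union of whole fibers and the cut
      truncates none of them.\<close>
    have "{m. m # w \<in> X0 \<and> f (m # w) = s} = F w s" if ne: "{m. m # w \<in> X0 \<and> f (m # w) = s} \<noteq> {}" for w s
      using ne by (auto simp: X0_def F_def)
    moreover have "is_singleton (F w s)" if "{m. m # w \<in> X0 \<and> f (m # w) = s} \<noteq> {}" for w s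
      using that by (auto simp: X0_def)
    moreover have sub: "X0 \<subseteq> X" by (auto simp: X0_def)
    moreover have "\<forall>z\<in>X0. f z \<in> tuples M \<rho>" using sub f(1) by blast
    ultimately show ?thesis unfolding fiber_cell_def
      using \<rho> X0 graph[OF X0] by (simp add: image_subset_iff)
  qed
  moreover have "fiber_cell L M \<sigma> 1 (X - X0) \<rho> f"
  proof -
    have "{m. m # w \<in> X - X0 \<and> f (m # w) = s} = F w s \<and> is_ball L M (F w s)"
      if "{m. m # w \<in> X - X0 \<and> f (m # w) = s} \<noteq> {}" for w s
    proof -
      have "\<not> is_singleton (F w s)" "F w s \<noteq> {}" using that by (auto simp: X0_def F_def)
      moreover from this have "{m. m # w \<in> X - X0 \<and> f (m # w) = s} = F w s" by (auto simp: X0_def F_def)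
      ultimately show ?thesis using F by blast
    qed
    then show ?thesis unfolding fiber_cell_def
      using \<rho> X1 graph[OF X1] f(1) by (simp add: image_subset_iff)
  qed
  ultimately have "decomp (\<lambda>C. \<exists>j g. fiber_cell L M \<sigma> j C \<rho> g) (X0 \<union> (X - X0))"
    by (intro decomp_Un decomp_single) auto
  moreover have "X0 \<union> (X - X0) = X" by (auto simp: X0_def)
  ultimately show ?thesis by simp
qed

text \<open>The finitely many presentations work over overlapping parts of the base. Disjoint
  definable parts are chosen, each inside the locus of one presentation, and \<open>X\<close> is cut
  accordingly.\<close>

lemma fiberwise_decomp:
  fixes M :: "('s, 'f, 'r, 'u) struct"
  assumes L: "language L" and T: "b_minimal_theory TYPE(('s, 'f, 'r, 'u) big) L T" and M: "is_model L T M"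
    and X: "dfn L M (main_sort L # \<sigma>) X"
  shows "decomp (\<lambda>C. \<exists>j \<rho> g. fiber_cell L M \<sigma> j C \<rho> g) X"
proof -
  let ?m = "main_sort L"
  have M': "is_struct L M" using M by (simp add: is_model_def)
  obtain H where H: "finite H" "\<And>\<rho> R. (\<rho>, R) \<in> H \<Longrightarrow> set \<rho> \<subseteq> aux_sorts L \<and> dfn L M (?m # \<sigma> @ \<rho>) R \<and>
       dfn L M \<sigma> {y \<in> tuples M \<sigma>. presents_over L M X \<rho> R y}"
    "\<And>y. y \<in> tuples M \<sigma> \<Longrightarrow> \<exists>(\<rho>, R)\<in>H. presents_over L M X \<rho> R y"
    using uniform_b1[OF L T M X] by fast
  define B where "B p = {y \<in> tuples M \<sigma>. presents_over L M X (fst p) (snd p) y}" for p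
  have "decomp (\<lambda>C. dfn L M \<sigma> C \<and> (\<exists>B\<in>B ` H. C \<subseteq> B)) (tuples M \<sigma>)"
  proof (rule decomp_cover)
    show "tuples M \<sigma> \<subseteq> \<Union> (B ` H)" using H(3) unfolding B_def by fastforce
  qed (use H(1,2) dfn_tuples[OF M'] in \<open>auto simp: B_def\<close>)
  then show ?thesis
  proof (rule decomp_vimage[where h = tl])
    show "tl z \<in> tuples M \<sigma>" if "z \<in> X" for z
      using that definable_subset[OF X] by (auto simp: tuples_Cons subset_iff)
    fix W assume "dfn L M \<sigma> W \<and> (\<exists>B\<in>B ` H. W \<subseteq> B)"
    then obtain \<rho> R where W: "dfn L M \<sigma> W" and \<rho>R: "(\<rho>, R) \<in> H" and sub: "W \<subseteq> B (\<rho>, R)" by force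
    define X' where "X' = {z \<in> X. tl z \<in> W}"
    have X': "dfn L M (?m # \<sigma>) X'"
    proof (rule bdef_dfn)
      show "bdef L M [[?m], \<sigma>] (\<lambda>bs. bs ! 0 @ bs ! 1 \<in> X \<and> bs ! 1 \<in> W)"
        by (intro bdef_conj bdef_mem[OF X, of _ "[0, 1]"] bdef_mem[OF W, of _ "[1]"]) auto
      show "z \<in> X' \<longleftrightarrow> (\<exists>bs\<in>blocks M [[?m], \<sigma>]. z = concat bs \<and> bs ! 0 @ bs ! 1 \<in> X \<and> bs ! 1 \<in> W)" for z
      proof
        assume "z \<in> X'"
        then show "\<exists>bs\<in>blocks M [[?m], \<sigma>]. z = concat bs \<and> bs ! 0 @ bs ! 1 \<in> X \<and> bs ! 1 \<in> W"
          using definable_subset[OF X] unfolding bex_blocks bex_tuples_single X'_def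
          by (auto simp: tuples_Cons dest!: subsetD)
      qed (auto simp: bex_blocks bex_tuples_single X'_def)
    qed simp
    have "decomp (\<lambda>C. \<exists>j g. fiber_cell L M \<sigma> j C \<rho> g) X'"
    proof (rule presented_decomp[OF M' X'])
      fix m w assume "m # w \<in> X'"
      then have w: "w \<in> W" by (simp add: X'_def)
      then have "presents_over L M X \<rho> R w" using sub by (auto simp: B_def)
      \<comment> \<open>The cut is made in the base only, so the whole fiber over \<open>w\<close>
        is kept and its presentation survives.\<close>
      moreover have "m # w \<in> X' \<longleftrightarrow> m # w \<in> X" for m using w by (simp add: X'_def)
      ultimately show "presents_over L M X' \<rho> R w" by (simp add: presents_over_def)
    qed (use H(2)[OF \<rho>R] in auto)
    then show "decomp (\<lambda>C. \<exists>j \<rho> g. fiber_cell L M \<sigma> j C \<rho> g) {z \<in> X. tl z \<in> W}"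
      unfolding X'_def[symmetric] by (rule decomp_mono) blast
  qed
qed

section \<open>Cells\<close>

lemma main_power_1 [simp]: "main_power L 1 = [main_sort L]" "main_power L (Suc 0) = [main_sort L]"
  by (simp_all add: main_power_def)

lemma main_power_Suc: "main_power L (Suc n) = main_power L n @ [main_sort L]"
  by (simp add: main_power_def replicate_append_same)

lemma length_main_power [simp]: "length (main_power L n) = n"
  by (simp add: main_power_def)

lemma append_eqD: "xs @ us = ys @ vs \<Longrightarrow> length us = length vs \<Longrightarrow> xs = ys \<and> us = vs"
  by simp

lemma prod_setI: "s \<in> S \<Longrightarrow> y \<in> Y \<Longrightarrow> s @ y \<in> prod_set S Y"
  unfolding prod_set_def by blast

lemma prod_set_subset_tuples:
  assumes "S \<subseteq> tuples M \<rho>" "Y \<subseteq> tuples M \<tau>"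
  shows "prod_set S Y \<subseteq> tuples M (\<rho> @ \<tau>)"
proof
  fix z assume "z \<in> prod_set S Y"
  then obtain s y where "z = s @ y" "s \<in> S" "y \<in> Y" unfolding prod_set_def by auto
  with assms show "z \<in> tuples M (\<rho> @ \<tau>)" unfolding tuples_append by auto
qed

text \<open>Only the component \<open>g\<close> in the auxiliary set requires a definability proof.
  The component in \<open>Y\<close> is a copy of coordinates of \<open>z\<close>, expressed by
  equating the fourth block with the second.\<close>

lemma fun_overI:
  assumes M: "is_struct L M" and Y: "dfn L M \<tau> Y" and X: "dfn L M (main_power L n @ \<tau>) X"
    and sub: "X \<subseteq> prod_set (tuples M (main_power L n)) Y" and S: "aux_set L M \<rho> S"
    and g: "\<And>z. z \<in> X \<Longrightarrow> g z \<in> S" and graph: "dfn L M ((main_power L n @ \<tau>) @ \<rho>) {z @ g z |z. z \<in> X}"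
    and f: "\<And>z. z \<in> X \<Longrightarrow> f z = g z @ drop n z"
  shows "fun_over L M \<tau> Y n X \<rho> S f"
proof -
  have Ssub: "S \<subseteq> tuples M \<rho>" using S definable_subset unfolding aux_set_def by blast
  have Ysub: "Y \<subseteq> tuples M \<tau>" using definable_subset[OF Y] .
  have XE: "\<exists>x y. z = x @ y \<and> x \<in> tuples M (main_power L n) \<and> y \<in> Y \<and> drop n z = y" if z: "z \<in> X" for z
  proof -
    obtain x y where xy: "z = x @ y" "x \<in> tuples M (main_power L n)" "y \<in> Y"
      using z sub unfolding prod_set_def by blast
    then have "drop n z = y" using tuples_length[OF xy(2)] by simp
    with xy show ?thesis by blast
  qed
  have fX: "f z \<in> prod_set S Y" if "z \<in> X" for z
  proof -
    have "drop n z \<in> Y" using XE[OF that] by auto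
    then show ?thesis unfolding f[OF that] by (rule prod_setI[OF g[OF that]])
  qed
  have "dfn L M ((main_power L n @ \<tau>) @ \<rho> @ \<tau>) {z @ f z |z. z \<in> X}"
  proof (rule bdef_dfn)
    define Gr where "Gr = {z @ g z |z. z \<in> X}"
    show "bdef L M [main_power L n, \<tau>, \<rho>, \<tau>] (\<lambda>bs. bs ! 0 @ bs ! 1 @ bs ! 2 \<in> Gr \<and> bs ! 3 = bs ! 1)"
      by (intro bdef_conj bdef_eq M bdef_mem[OF graph[folded Gr_def], of _ "[0, 1, 2]"]) auto
    fix w
    show "w \<in> {z @ f z |z. z \<in> X} \<longleftrightarrow> (\<exists>bs\<in>blocks M [main_power L n, \<tau>, \<rho>, \<tau>]. w = concat bs \<and>
        bs ! 0 @ bs ! 1 @ bs ! 2 \<in> Gr \<and> bs ! 3 = bs ! 1)"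
    proof
      assume "w \<in> {z @ f z |z. z \<in> X}"
      then obtain z where z: "w = z @ f z" "z \<in> X" by blast
      obtain x y where xy: "z = x @ y" "x \<in> tuples M (main_power L n)" "y \<in> Y" "drop n z = y"
        using XE[OF z(2)] by blast
      have "x @ y @ g z = z @ g z" using xy by simp
      then have "x @ y @ g z \<in> Gr" using z(2) unfolding Gr_def by blast
      then show "\<exists>bs\<in>blocks M [main_power L n, \<tau>, \<rho>, \<tau>]. w = concat bs \<and>
          bs ! 0 @ bs ! 1 @ bs ! 2 \<in> Gr \<and> bs ! 3 = bs ! 1"
        unfolding bex_blocks using z f[OF z(2)] xy Ysub Ssub g[OF z(2)]
        by (intro bexI[of _ x] bexI[of _ y] bexI[of _ "g z"]) auto
    next
      assume "\<exists>bs\<in>blocks M [main_power L n, \<tau>, \<rho>, \<tau>]. w = concat bs \<and>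
          bs ! 0 @ bs ! 1 @ bs ! 2 \<in> Gr \<and> bs ! 3 = bs ! 1"
      then obtain x y s where w: "x \<in> tuples M (main_power L n)" "y \<in> tuples M \<tau>" "s \<in> tuples M \<rho>" "w = x @ y @ s @ y"
        "x @ y @ s \<in> Gr" unfolding bex_blocks by auto
      then obtain z where z: "x @ y @ s = z @ g z" "z \<in> X" unfolding Gr_def by blast
      have "length (g z) = length s" using g[OF z(2)] Ssub w(3) by (auto dest!: subsetD tuples_length)
      then have "x @ y = z \<and> s = g z" using z(1) by (metis append.assoc append_eq_append_conv)
      then have "w = z @ f z" using w(1,4) f[OF z(2)] tuples_length[OF w(1)] by auto
      then show "w \<in> {z @ f z |z. z \<in> X}" using z(2) by blast
    qed
  qed auto
  moreover have "prod_set S Y \<subseteq> tuples M (\<rho> @ \<tau>)"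
    using Ssub Ysub by (rule prod_set_subset_tuples)
  moreover have "drop (length \<rho>) (f z) = drop n z" if "z \<in> X" for z
    using g[OF that] Ssub f[OF that] by (auto dest!: subsetD tuples_length)
  ultimately show ?thesis
    using assms fX definable_subset[OF X] unfolding fun_over_def definable_fun_def by blast
qed

lemma cell1I:
  assumes M: "is_struct L M" and Y: "dfn L M \<tau> Y" and X: "dfn L M (main_sort L # \<tau>) X"
    and sub: "\<And>m y. m # y \<in> X \<Longrightarrow> y \<in> Y" and S: "aux_set L M \<rho> S"
    and g: "\<And>z. z \<in> X \<Longrightarrow> g z \<in> S" and graph: "dfn L M ((main_sort L # \<tau>) @ \<rho>) {z @ g z |z. z \<in> X}"
    and f: "\<And>m y. m # y \<in> X \<Longrightarrow> f (m # y) = g (m # y) @ y"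
    and fib: "\<And>y s. {m. m # y \<in> X \<and> g (m # y) = s} \<noteq> {} \<Longrightarrow>
        j = 0 \<and> is_singleton {m. m # y \<in> X \<and> g (m # y) = s} \<or>
        j = 1 \<and> is_ball L M {m. m # y \<in> X \<and> g (m # y) = s}"
    and j: "j \<in> {0, 1}"
  shows "cell1 L M \<tau> Y j X \<rho> S f"
proof -
  have XE: "\<exists>m y. z = m # y \<and> [m] \<in> tuples M [main_sort L] \<and> y \<in> Y" if z: "z \<in> X" for z
  proof -
    obtain m y where "z = m # y" "m \<in> univ M (main_sort L)"
      using definable_subset[OF X] z by (auto simp: tuples_Cons dest!: subsetD)
    then show ?thesis using sub z by (auto simp: tuples_Cons)
  qed
  have "fun_over L M \<tau> Y 1 X \<rho> S f"
  proof (rule fun_overI[OF M Y _ _ S g])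
    show "X \<subseteq> prod_set (tuples M (main_power L 1)) Y"
    proof
      fix z assume "z \<in> X"
      then obtain m y where "z = [m] @ y" "[m] \<in> tuples M (main_power L 1)" "y \<in> Y" using XE by fastforce
      then show "z \<in> prod_set (tuples M (main_power L 1)) Y" by (simp add: prod_setI del: append.simps)
    qed
    show "f z = g z @ drop 1 z" if "z \<in> X" for z using XE[OF that] f that by auto
  qed (use X graph in auto)
  moreover have len: "length (g z) = length \<rho>" if "z \<in> X" for z
    using g[OF that] S definable_subset unfolding aux_set_def by (auto dest!: definable_subset subsetD tuples_length)
  have "j = 0 \<and> is_singleton {m. \<exists>y. m # y \<in> X \<and> f (m # y) = t} \<or>
      j = 1 \<and> is_ball L M {m. \<exists>y. m # y \<in> X \<and> f (m # y) = t}" if t: "t \<in> f ` X" for t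
  proof -
    obtain z where z: "z \<in> X" "t = f z" using t by blast
    obtain m0 y where mz: "z = m0 # y" using XE[OF z(1)] by blast
    \<comment> \<open>The value of \<open>f\<close> contains \<open>y\<close>, so a fiber of
      \<open>f\<close> lies over a single \<open>y\<close> and is a fiber of \<open>g\<close>
      there.\<close>
    have "f (m # y') = t \<longleftrightarrow> y' = y \<and> g (m # y) = g z" if "m # y' \<in> X" for m y'
    proof -
      have "f (m # y') = g (m # y') @ y'" "t = g z @ y" using f that z mz by auto
      then show ?thesis using len[OF that] len[OF z(1)] by auto
    qed
    then have "{m. \<exists>y. m # y \<in> X \<and> f (m # y) = t} = {m. m # y \<in> X \<and> g (m # y) = g z}" by blast
    moreover have "{m. m # y \<in> X \<and> g (m # y) = g z} \<noteq> {}" using z mz by blast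
    ultimately show ?thesis using fib[of y "g z"] by simp
  qed
  then have "j = 0 \<and> (\<forall>t\<in>f ` X. is_singleton {m. \<exists>y. m # y \<in> X \<and> f (m # y) = t}) \<or>
      j = 1 \<and> (\<forall>t\<in>f ` X. is_ball L M {m. \<exists>y. m # y \<in> X \<and> f (m # y) = t})"
    using j by (cases "j = 0") auto
  ultimately show ?thesis unfolding cell1_def by blast
qed

lemma cell_fun_over: "cell L M \<tau> Y js X \<rho> S f \<Longrightarrow> fun_over L M \<tau> Y (length js) X \<rho> S f"
  by (induction rule: cell.cases) (auto simp: cell1_def)

text \<open>\<open>C\<close> carries the last main coordinate in front, whereas a cell has it
  between \<open>x\<close> and \<open>y\<close>; \<open>E\<close> is the part of \<open>C\<close>
  over \<open>Z\<close> with the coordinate put back. By \<open>ZC\<close> the projection of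
  \<open>E\<close> is all of \<open>Z\<close>, the set whose presentation is at hand.\<close>

lemma cell_stepI:
  assumes M: "is_struct L M" and Y: "dfn L M \<tau> Y"
    and C: "fiber_cell L M (main_power L n @ \<tau>) j C \<rho> g"
    and Z: "cell L M \<tau> Y js Z \<rho>' S' f'" and n: "length js = n"
    and ZC: "\<And>w. w \<in> Z \<Longrightarrow> \<exists>m. m # w \<in> C"
    and E: "E = {x @ m # y |x m y. length x = n \<and> m # x @ y \<in> C \<and> x @ y \<in> Z}"
  shows "\<exists>\<rho> S f. cell L M \<tau> Y (js @ [j]) E \<rho> S f"
proof -
  let ?m = "main_sort L" and ?p = "main_power L n"
  have C': "j \<in> {0, 1}" "set \<rho> \<subseteq> aux_sorts L" "dfn L M (?m # ?p @ \<tau>) C"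
    "\<And>z. z \<in> C \<Longrightarrow> g z \<in> tuples M \<rho>" "dfn L M ((?m # ?p @ \<tau>) @ \<rho>) {z @ g z |z. z \<in> C}"
    "\<And>w s. {m. m # w \<in> C \<and> g (m # w) = s} \<noteq> {} \<Longrightarrow>
        j = 0 \<and> is_singleton {m. m # w \<in> C \<and> g (m # w) = s} \<or>
        j = 1 \<and> is_ball L M {m. m # w \<in> C \<and> g (m # w) = s}"
    using C unfolding fiber_cell_def by (simp_all add: image_subset_iff)
  have "fun_over L M \<tau> Y n Z \<rho>' S' f'" using cell_fun_over[OF Z] n by simp
  then have Zd: "dfn L M (?p @ \<tau>) Z" and ZY: "Z \<subseteq> prod_set (tuples M ?p) Y" and S': "aux_set L M \<rho>' S'"
    and f'S: "\<And>z. z \<in> Z \<Longrightarrow> f' z \<in> prod_set S' Y" and f'd: "dfn L M ((?p @ \<tau>) @ \<rho>' @ \<tau>) {z @ f' z |z. z \<in> Z}"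
    and f'Y: "\<And>z. z \<in> Z \<Longrightarrow> drop (length \<rho>') (f' z) = drop n z"
    unfolding fun_over_def definable_fun_def by blast+
  have S'sub: "S' \<subseteq> tuples M \<rho>'" and S'd: "dfn L M \<rho>' S'"
    using S' definable_subset unfolding aux_set_def by blast+
  have Ysub: "Y \<subseteq> tuples M \<tau>" using definable_subset[OF Y] .
  \<comment> \<open>The component of \<open>f'\<close> in \<open>S'\<close>. Its copy of
    \<open>y\<close> is stripped because \<open>f\<close> carries \<open>y\<close> only once, at the
    end.\<close>
  define s' where "s' w = take (length \<rho>') (f' w)" for w
  have xy: "x \<in> tuples M ?p \<and> y \<in> Y \<and> y \<in> tuples M \<tau> \<and> s' (x @ y) \<in> S' \<and> s' (x @ y) \<in> tuples M \<rho>' \<and>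
      f' (x @ y) = s' (x @ y) @ y" if w: "x @ y \<in> Z" "length x = n" for x y
  proof -
    obtain x1 y1 where x1: "x @ y = x1 @ y1" "x1 \<in> tuples M ?p" "y1 \<in> Y"
      using w(1) ZY unfolding prod_set_def by blast
    then have "x = x1" "y = y1" using w(2) tuples_length[OF x1(2)] by auto
    obtain s y2 where s: "f' (x @ y) = s @ y2" "s \<in> S'" using f'S[OF w(1)] unfolding prod_set_def by blast
    then have "length s = length \<rho>'" using S'sub by (auto dest!: subsetD tuples_length)
    then have "s' (x @ y) = s" "y2 = y" using s f'Y[OF w(1)] w(2) by (simp_all add: s'_def)
    then show ?thesis using \<open>x = x1\<close> \<open>y = y1\<close> x1 s S'sub Ysub by auto
  qed
  \<comment> \<open>In \<open>z = x @ m # y\<close> the entry at position \<open>n\<close> is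
    \<open>m\<close>; it is moved to the front for \<open>g\<close> and removed for
    \<open>s'\<close>. With the value of \<open>g\<close> placed first, dropping it recovers the
    value of \<open>f'\<close>.\<close>
  define G where "G z = g (z ! n # take n z @ drop (Suc n) z) @ s' (take n z @ drop (Suc n) z)" for z
  define f where "f z = G z @ drop (Suc n) z" for z
  let ?S = "prod_set (tuples M \<rho>) S'"
  have Gx: "G (x @ m # y) = g (m # x @ y) @ s' (x @ y)" if "length x = n" for x m y
    using that nth_append_length[of x m y] by (simp add: G_def)
  have fx: "f (x @ m # y) = g (m # x @ y) @ s' (x @ y) @ y" if "length x = n" for x m y
    using Gx[OF that] that by (simp add: f_def)
  have EI: "x @ m # y \<in> E \<longleftrightarrow> m # x @ y \<in> C \<and> x @ y \<in> Z" if "length x = n" for x m y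
    unfolding E using that by auto
  have EE: "\<exists>x m y. z = x @ m # y \<and> length x = n \<and> m # x @ y \<in> C \<and> x @ y \<in> Z" if "z \<in> E" for z
    using that unfolding E by blast
  have Cm: "m \<in> univ M ?m" if "m # w \<in> C" for m w
    using that definable_subset[OF C'(3)] by (auto simp: tuples_Cons dest!: subsetD)
  have GS: "G z \<in> ?S" if z: "z \<in> E" for z
  proof -
    obtain x m y where e: "z = x @ m # y" "length x = n" "m # x @ y \<in> C" "x @ y \<in> Z" using EE[OF z] by blast
    show ?thesis unfolding e(1) Gx[OF e(2)] using C'(4)[OF e(3)] xy[OF e(4,2)] by (simp add: prod_setI)
  qed
  have Ssub: "?S \<subseteq> tuples M (\<rho> @ \<rho>')" using S'sub by (intro prod_set_subset_tuples) auto
  have Sd: "aux_set L M (\<rho> @ \<rho>') ?S"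
  proof -
    have "dfn L M (\<rho> @ \<rho>') ?S"
    proof (rule bdef_dfn)
      show "bdef L M [\<rho>, \<rho>'] (\<lambda>bs. bs ! 1 \<in> S')"
        by (rule bdef_mem[OF S'd, of _ "[1]"]) auto
      show "z \<in> ?S \<longleftrightarrow> (\<exists>bs\<in>blocks M [\<rho>, \<rho>']. z = concat bs \<and> bs ! 1 \<in> S')" for z
        unfolding bex_blocks prod_set_def using S'sub by auto
    qed simp
    then show ?thesis using C'(2) S' unfolding aux_set_def by simp
  qed
  have Ed: "dfn L M (main_power L (Suc n) @ \<tau>) E"
  proof (rule bdef_dfn)
    show "bdef L M [?p, [?m], \<tau>] (\<lambda>bs. bs ! 1 @ bs ! 0 @ bs ! 2 \<in> C \<and> bs ! 0 @ bs ! 2 \<in> Z)"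
      by (intro bdef_conj bdef_mem[OF C'(3), of _ "[1, 0, 2]"] bdef_mem[OF Zd, of _ "[0, 2]"]) auto
    fix z
    show "z \<in> E \<longleftrightarrow> (\<exists>bs\<in>blocks M [?p, [?m], \<tau>]. z = concat bs \<and> bs ! 1 @ bs ! 0 @ bs ! 2 \<in> C \<and> bs ! 0 @ bs ! 2 \<in> Z)"
    proof
      assume "z \<in> E"
      then obtain x m y where e: "z = x @ m # y" "length x = n" "m # x @ y \<in> C" "x @ y \<in> Z" using EE by blast
      then show "\<exists>bs\<in>blocks M [?p, [?m], \<tau>]. z = concat bs \<and> bs ! 1 @ bs ! 0 @ bs ! 2 \<in> C \<and> bs ! 0 @ bs ! 2 \<in> Z"
        unfolding bex_blocks bex_tuples_single using xy[OF e(4,2)] Cm[OF e(3)]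
        by (intro bexI[of _ x] bexI[of _ m] bexI[of _ y]) auto
    next
      assume "\<exists>bs\<in>blocks M [?p, [?m], \<tau>]. z = concat bs \<and> bs ! 1 @ bs ! 0 @ bs ! 2 \<in> C \<and> bs ! 0 @ bs ! 2 \<in> Z"
      then obtain x m y where "x \<in> tuples M ?p" "z = x @ m # y" "m # x @ y \<in> C" "x @ y \<in> Z"
        unfolding bex_blocks bex_tuples_single by auto
      then show "z \<in> E" using EI tuples_length[of x M ?p] by auto
    qed
  qed (simp add: main_power_Suc)
  have Gd: "dfn L M ((main_power L (Suc n) @ \<tau>) @ \<rho> @ \<rho>') {z @ G z |z. z \<in> E}"
  proof (rule bdef_dfn)
    define Gg Gf where "Gg = {z @ g z |z. z \<in> C}" and "Gf = {z @ f' z |z. z \<in> Z}"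
    note graphs = C'(5)[folded Gg_def] f'd[folded Gf_def]
    \<comment> \<open>The blocks are \<open>x\<close>, \<open>m\<close>, \<open>y\<close>, the value
      of \<open>g\<close> and that of \<open>s'\<close>. Block 2 appears twice in the second
      condition because the values of \<open>f'\<close> end in \<open>y\<close>.\<close>
    let ?P = "\<lambda>bs. bs ! 1 @ bs ! 0 @ bs ! 2 @ bs ! 3 \<in> Gg \<and> bs ! 0 @ bs ! 2 @ bs ! 4 @ bs ! 2 \<in> Gf"
    show "bdef L M [?p, [?m], \<tau>, \<rho>, \<rho>'] ?P"
      by (intro bdef_conj bdef_mem[OF graphs(1), of _ "[1, 0, 2, 3]"] bdef_mem[OF graphs(2), of _ "[0, 2, 4, 2]"]) auto
    fix w
    show "w \<in> {z @ G z |z. z \<in> E} \<longleftrightarrow> (\<exists>bs\<in>blocks M [?p, [?m], \<tau>, \<rho>, \<rho>']. w = concat bs \<and> ?P bs)"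
    proof
      assume "w \<in> {z @ G z |z. z \<in> E}"
      then obtain z where "w = z @ G z" "z \<in> E" by blast
      then obtain x m y where e: "w = (x @ m # y) @ G (x @ m # y)" "length x = n" "m # x @ y \<in> C" "x @ y \<in> Z"
        using EE by blast
      have "m # x @ y @ g (m # x @ y) = (m # x @ y) @ g (m # x @ y)" by simp
      then have 1: "m # x @ y @ g (m # x @ y) \<in> Gg" using e(3) unfolding Gg_def by blast
      have "x @ y @ s' (x @ y) @ y = (x @ y) @ f' (x @ y)" using xy[OF e(4,2)] by simp
      then have 2: "x @ y @ s' (x @ y) @ y \<in> Gf" using e(4) unfolding Gf_def by blast
      show "\<exists>bs\<in>blocks M [?p, [?m], \<tau>, \<rho>, \<rho>']. w = concat bs \<and> ?P bs"
        unfolding bex_blocks bex_tuples_single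
      proof (intro bexI conjI)
        show "w = concat [x, [m], y, g (m # x @ y), s' (x @ y)]" using e(1) Gx[OF e(2)] by simp
      qed (use 1 2 xy[OF e(4,2)] Cm[OF e(3)] C'(4)[OF e(3)] in simp_all)
    next
      assume "\<exists>bs\<in>blocks M [?p, [?m], \<tau>, \<rho>, \<rho>']. w = concat bs \<and> ?P bs"
      then obtain x m y s t where e: "x \<in> tuples M ?p" "y \<in> tuples M \<tau>" "s \<in> tuples M \<rho>" "t \<in> tuples M \<rho>'"
        "w = x @ m # y @ s @ t" "m # x @ y @ s \<in> Gg" "x @ y @ t @ y \<in> Gf"
        unfolding bex_blocks bex_tuples_single by auto
      have len: "length x = n" using tuples_length[OF e(1)] by simp
      obtain z where z: "(m # x @ y) @ s = z @ g z" "z \<in> C" using e(6) by (auto simp: Gg_def)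
      have "length s = length (g z)" using tuples_length[OF e(3)] tuples_length[OF C'(4)[OF z(2)]] by simp
      from append_eqD[OF z(1) this] have gz: "z = m # x @ y" "s = g (m # x @ y)" by auto
      obtain v where v: "(x @ y) @ t @ y = v @ f' v" "v \<in> Z" using e(7) by (auto simp: Gf_def)
      have "length v = length (x @ y)"
        using definable_subset[OF Zd] v(2) tuples_length[OF e(1)] tuples_length[OF e(2)]
        by (auto dest!: subsetD tuples_length)
      then have vz: "v = x @ y" "f' (x @ y) = t @ y"
        using v(1) append_eq_append_conv[of "x @ y" v "t @ y" "f' v"] by auto
      then have "t = s' (x @ y)" using tuples_length[OF e(4)] by (simp add: s'_def)
      then have "w = (x @ m # y) @ G (x @ m # y)" using e(5) gz Gx[OF len] by simp
      moreover have "x @ m # y \<in> E" using EI[OF len] gz z(2) v(2) vz by simp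
      ultimately show "w \<in> {z @ G z |z. z \<in> E}" by blast
    qed
  qed (simp add: main_power_Suc)
  have over: "fun_over L M \<tau> Y (Suc n) E (\<rho> @ \<rho>') ?S f"
  proof (rule fun_overI[OF M Y Ed _ Sd GS])
    show "E \<subseteq> prod_set (tuples M (main_power L (Suc n))) Y"
    proof
      fix z assume "z \<in> E"
      then obtain x m y where e: "z = x @ m # y" "length x = n" "m # x @ y \<in> C" "x @ y \<in> Z" using EE by blast
      have "z = (x @ [m]) @ y" "x @ [m] \<in> tuples M (main_power L (Suc n))"
        using e(1) xy[OF e(4,2)] Cm[OF e(3)] unfolding main_power_Suc tuples_append by (auto simp: tuples_Cons)
      then show "z \<in> prod_set (tuples M (main_power L (Suc n))) Y"
        using xy[OF e(4,2)] by (simp add: prod_setI del: append_assoc)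
    qed
  qed (use Gd in \<open>simp_all add: f_def\<close>)
  have drop_x: "drop_coord (Suc n) (x @ m # y) = x @ y" if "length x = n" for x m y
    using that by (simp add: drop_coord_def)
  have proj: "drop_coord (Suc n) ` E = Z"
  proof (intro set_eqI iffI)
    fix w assume "w \<in> drop_coord (Suc n) ` E"
    then show "w \<in> Z" using EE drop_x by fastforce
  next
    fix w assume w: "w \<in> Z"
    then obtain x y where "w = x @ y" "x \<in> tuples M ?p" using ZY unfolding prod_set_def by blast
    moreover obtain m where "m # w \<in> C" using ZC[OF w] by blast
    ultimately have "x @ m # y \<in> E" "drop_coord (Suc n) (x @ m # y) = w"
      using w EI[of x m y] drop_x[of x m y] tuples_length[of x M ?p] by simp_all
    then show "w \<in> drop_coord (Suc n) ` E" by force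
  qed
  have fibers: "cell1 L M \<tau> {y} j {m # y |m. x @ m # y \<in> E} (\<rho> @ \<rho>') ?S (\<lambda>z. f (x @ z))"
    if x: "length x = n" "x @ y \<in> Z" for x y
  proof -
    let ?X = "{m # y |m. x @ m # y \<in> E}"
    note xy' = xy[OF x(2,1)]
    show ?thesis
    proof (rule cell1I[OF M dfn_singleton[OF M] _ _ Sd, where g = "\<lambda>z. G (x @ z)"])
      show "y \<in> tuples M \<tau>" using xy' by blast
      \<comment> \<open>Here \<open>x\<close> and \<open>y\<close> are parameters. The block for
        \<open>x\<close> is equated with a constant and then projected away.\<close>
      have Xd: "bdef L M ([[?m], \<tau>] @ [?p]) (\<lambda>bs. bs ! 2 @ bs ! 0 @ bs ! 1 \<in> E \<and> bs ! 2 = x \<and> bs ! 1 = y)"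
        by (intro bdef_conj bdef_const M bdef_mem[OF Ed, of _ "[2, 0, 1]"]) (use xy' in \<open>auto simp: main_power_Suc\<close>)
      show "dfn L M (?m # \<tau>) ?X"
      proof (rule bdef_dfn[OF bdef_ex[OF Xd]])
        show "z \<in> ?X \<longleftrightarrow> (\<exists>bs\<in>blocks M [[?m], \<tau>]. z = concat bs \<and>
            (\<exists>b\<in>tuples M ?p. (bs @ [b]) ! 2 @ (bs @ [b]) ! 0 @ (bs @ [b]) ! 1 \<in> E \<and> (bs @ [b]) ! 2 = x \<and> (bs @ [b]) ! 1 = y))" for z
          unfolding bex_blocks bex_tuples_single using xy' EI[OF x(1)] Cm by auto
      qed simp
      define GE where "GE = {z @ G z |z. z \<in> E}"
      have GE: "x @ m # y @ s \<in> GE \<longleftrightarrow> x @ m # y \<in> E \<and> s = G (x @ m # y)"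
        if s: "s \<in> tuples M (\<rho> @ \<rho>')" for m s
      proof
        assume "x @ m # y @ s \<in> GE"
        then obtain z where z: "(x @ m # y) @ s = z @ G z" "z \<in> E" by (auto simp: GE_def)
        have "length s = length (G z)"
          using tuples_length[OF s] tuples_length[OF subsetD[OF Ssub GS[OF z(2)]]] by simp
        from append_eqD[OF z(1) this] have "z = x @ m # y" "s = G z" by auto
        then show "x @ m # y \<in> E \<and> s = G (x @ m # y)" using z(2) by simp
      next
        assume "x @ m # y \<in> E \<and> s = G (x @ m # y)"
        moreover from this have "x @ m # y @ s = (x @ m # y) @ G (x @ m # y)" by simp
        ultimately show "x @ m # y @ s \<in> GE" unfolding GE_def by blast
      qed
      have Gd': "bdef L M ([[?m], \<tau>, \<rho> @ \<rho>'] @ [?p])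
          (\<lambda>bs. bs ! 3 @ bs ! 0 @ bs ! 1 @ bs ! 2 \<in> GE \<and> bs ! 3 = x \<and> bs ! 1 = y)"
        by (intro bdef_conj bdef_const M bdef_mem[OF Gd[folded GE_def], of _ "[3, 0, 1, 2]"]) (use xy' in \<open>auto simp: main_power_Suc\<close>)
      show "dfn L M ((?m # \<tau>) @ \<rho> @ \<rho>') {z @ G (x @ z) |z. z \<in> ?X}"
      proof (rule bdef_dfn[OF bdef_ex[OF Gd']])
        let ?P = "\<lambda>bs. bs ! 3 @ bs ! 0 @ bs ! 1 @ bs ! 2 \<in> GE \<and> bs ! 3 = x \<and> bs ! 1 = y"
        fix w
        show "w \<in> {z @ G (x @ z) |z. z \<in> ?X} \<longleftrightarrow> (\<exists>bs\<in>blocks M [[?m], \<tau>, \<rho> @ \<rho>'].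
            w = concat bs \<and> (\<exists>b\<in>tuples M ?p. ?P (bs @ [b])))"
        proof
          assume "w \<in> {z @ G (x @ z) |z. z \<in> ?X}"
          then obtain m where m: "w = m # y @ G (x @ m # y)" "x @ m # y \<in> E" by auto
          have "m \<in> univ M ?m" using Cm EI[OF x(1)] m(2) by blast
          moreover have "G (x @ m # y) \<in> tuples M (\<rho> @ \<rho>')" using GS[OF m(2)] Ssub by blast
          ultimately show "\<exists>bs\<in>blocks M [[?m], \<tau>, \<rho> @ \<rho>']. w = concat bs \<and> (\<exists>b\<in>tuples M ?p. ?P (bs @ [b]))"
            unfolding bex_blocks bex_tuples_single using m xy' GE
            by (intro bexI[of _ m] bexI[of _ y] bexI[of _ "G (x @ m # y)"]) (auto intro!: bexI[of _ x])
        next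
          assume "\<exists>bs\<in>blocks M [[?m], \<tau>, \<rho> @ \<rho>']. w = concat bs \<and> (\<exists>b\<in>tuples M ?p. ?P (bs @ [b]))"
          then obtain m s where "s \<in> tuples M (\<rho> @ \<rho>')" "w = m # y @ s" "x @ m # y @ s \<in> GE"
            unfolding bex_blocks bex_tuples_single by auto
          then have "w = (m # y) @ G (x @ m # y)" "x @ m # y \<in> E" using GE by auto
          then show "w \<in> {z @ G (x @ z) |z. z \<in> ?X}" by blast
        qed
      qed simp
      show "G (x @ z) \<in> ?S" if "z \<in> ?X" for z using that GS by auto
      show "f (x @ m # y') = G (x @ m # y') @ y'" for m y' using x(1) by (simp add: f_def)
      fix y' s assume ne: "{m. m # y' \<in> ?X \<and> G (x @ m # y') = s} \<noteq> {}"
      then have y': "y' = y" by auto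
      obtain m0 where m0: "m0 # x @ y \<in> C" "G (x @ m0 # y) = s" using ne EI[OF x(1)] by auto
      \<comment> \<open>With \<open>x\<close> and \<open>y\<close> fixed, \<open>s' (x @ y)\<close>
        is a constant tail of the values of \<open>G\<close> and cancels.\<close>
      have "G (x @ m # y) = s \<longleftrightarrow> g (m # x @ y) = g (m0 # x @ y)" for m
        unfolding m0(2)[symmetric] Gx[OF x(1)] by simp
      then have eq: "{m. m # y' \<in> ?X \<and> G (x @ m # y') = s} = {m. m # x @ y \<in> C \<and> g (m # x @ y) = g (m0 # x @ y)}"
        using y' EI[OF x(1)] x(2) by auto
      show "j = 0 \<and> is_singleton {m. m # y' \<in> ?X \<and> G (x @ m # y') = s} \<or>
        j = 1 \<and> is_ball L M {m. m # y' \<in> ?X \<and> G (x @ m # y') = s}"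
        unfolding eq by (rule C'(6)) (use m0 in auto)
    qed (use C'(1) in auto)
  qed
  have p': "definable_fun L M (params M) ((\<rho> @ \<rho>') @ \<tau>) (\<rho>' @ \<tau>) (prod_set ?S Y) (prod_set S' Y) (drop (length \<rho>))"
  proof -
    have mem: "w \<in> prod_set ?S Y \<longleftrightarrow> (\<exists>s t y. w = s @ t @ y \<and> s \<in> tuples M \<rho> \<and> t \<in> S' \<and> y \<in> Y)" for w
      unfolding prod_set_def by (auto; metis append.assoc)
    have "dfn L M (((\<rho> @ \<rho>') @ \<tau>) @ \<rho>' @ \<tau>) {z @ drop (length \<rho>) z |z. z \<in> prod_set ?S Y}"
    proof (rule bdef_dfn)
      \<comment> \<open>Blocks 0 to 2 form the argument, and blocks 3 and 4 repeat its last two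
        blocks: this is the graph of dropping the first.\<close>
      let ?P = "\<lambda>bs. bs ! 1 \<in> S' \<and> bs ! 2 \<in> Y \<and> bs ! 3 = bs ! 1 \<and> bs ! 4 = bs ! 2"
      show "bdef L M [\<rho>, \<rho>', \<tau>, \<rho>', \<tau>] ?P"
        by (intro bdef_conj bdef_eq M bdef_mem[OF S'd, of _ "[1]"] bdef_mem[OF Y, of _ "[2]"]) auto
      fix w
      have "w \<in> {z @ drop (length \<rho>) z |z. z \<in> prod_set ?S Y} \<longleftrightarrow>
          (\<exists>s\<in>tuples M \<rho>. \<exists>t\<in>S'. \<exists>y\<in>Y. w = s @ t @ y @ t @ y)"
      proof
        assume "w \<in> {z @ drop (length \<rho>) z |z. z \<in> prod_set ?S Y}"
        then obtain z where z: "w = z @ drop (length \<rho>) z" "z \<in> prod_set ?S Y" by blast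
        from iffD1[OF mem z(2)] obtain s t y where "z = s @ t @ y" "s \<in> tuples M \<rho>" "t \<in> S'" "y \<in> Y"
          by blast
        with z(1) show "\<exists>s\<in>tuples M \<rho>. \<exists>t\<in>S'. \<exists>y\<in>Y. w = s @ t @ y @ t @ y" using tuples_length[of s M \<rho>] by auto
      next
        assume "\<exists>s\<in>tuples M \<rho>. \<exists>t\<in>S'. \<exists>y\<in>Y. w = s @ t @ y @ t @ y"
        then obtain s t y where e: "s \<in> tuples M \<rho>" "t \<in> S'" "y \<in> Y" "w = s @ t @ y @ t @ y" by blast
        then have "w = (s @ t @ y) @ drop (length \<rho>) (s @ t @ y)" using tuples_length[OF e(1)] by simp
        moreover have "s @ t @ y \<in> prod_set ?S Y" using mem[of "s @ t @ y"] e(1-3) by blast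
        ultimately show "w \<in> {z @ drop (length \<rho>) z |z. z \<in> prod_set ?S Y}" by blast
      qed
      also have "\<dots> \<longleftrightarrow> (\<exists>bs\<in>blocks M [\<rho>, \<rho>', \<tau>, \<rho>', \<tau>]. w = concat bs \<and> ?P bs)"
      proof
        assume "\<exists>s\<in>tuples M \<rho>. \<exists>t\<in>S'. \<exists>y\<in>Y. w = s @ t @ y @ t @ y"
        then obtain s t y where "s \<in> tuples M \<rho>" "t \<in> S'" "y \<in> Y" "w = s @ t @ y @ t @ y" by blast
        then show "\<exists>bs\<in>blocks M [\<rho>, \<rho>', \<tau>, \<rho>', \<tau>]. w = concat bs \<and> ?P bs"
          unfolding bex_blocks using S'sub Ysub
          by (intro bexI[of _ s] bexI[of _ t] bexI[of _ y]) auto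
      qed (auto simp: bex_blocks)
      finally show "w \<in> {z @ drop (length \<rho>) z |z. z \<in> prod_set ?S Y} \<longleftrightarrow>
          (\<exists>bs\<in>blocks M [\<rho>, \<rho>', \<tau>, \<rho>', \<tau>]. w = concat bs \<and> ?P bs)" .
    qed simp
    moreover have "prod_set ?S Y \<subseteq> tuples M ((\<rho> @ \<rho>') @ \<tau>)"
      using Ssub Ysub by (rule prod_set_subset_tuples)
    moreover have "prod_set S' Y \<subseteq> tuples M (\<rho>' @ \<tau>)"
      using S'sub Ysub by (rule prod_set_subset_tuples)
    moreover have "drop (length \<rho>) w \<in> prod_set S' Y" if w: "w \<in> prod_set ?S Y" for w
    proof -
      from iffD1[OF mem w] obtain s t y where e: "w = s @ t @ y" "s \<in> tuples M \<rho>" "t \<in> S'" "y \<in> Y" by blast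
      then have "drop (length \<rho>) w = t @ y" using tuples_length[OF e(2)] by simp
      then show ?thesis using e(3,4) by (simp add: prod_setI)
    qed
    ultimately show ?thesis unfolding definable_fun_def by blast
  qed
  have "cell L M \<tau> Y (js @ [j]) E (\<rho> @ \<rho>') ?S f"
  proof (rule cell_step[OF _ C'(1) over])
    show "cell1 L M \<tau> {y} j {m # y |m. x @ m # y \<in> E} (\<rho> @ \<rho>') ?S (\<lambda>z. f (x @ z))"
      if "length x = Suc n - 1" "x @ y \<in> drop_coord (Suc n) ` E" for x y
      using that fibers unfolding proj by simp
    show "\<forall>z\<in>E. f' (drop_coord (Suc n) z) = drop (length \<rho>) (f z)"
    proof
      fix z assume "z \<in> E"
      then obtain x m y where e: "z = x @ m # y" "length x = n" "m # x @ y \<in> C" "x @ y \<in> Z" using EE by blast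
      show "f' (drop_coord (Suc n) z) = drop (length \<rho>) (f z)"
        unfolding e(1) drop_x[OF e(2)] fx[OF e(2)] using xy[OF e(4,2)] tuples_length[OF C'(4)[OF e(3)]] by simp
    qed
  qed (use n Z p' proj in auto)
  then show ?thesis by blast
qed

text \<open>All coordinates except the last main one, those of \<open>Y\<close> included, are
  treated as one base for the fiberwise decomposition. Each piece is then cut along a partition of
  its own projection into cells, so the induction has to hold for arbitrary
  \<open>X\<close>.\<close>

lemma cell_decomposition:
  fixes M :: "('s, 'f, 'r, 'u) struct"
  assumes L: "language L" and T: "b_minimal_theory TYPE(('s, 'f, 'r, 'u) big) L T" and M: "is_model L T M"
    and Y: "dfn L M \<tau> Y" and n: "n \<ge> 1"
    and X: "dfn L M (main_power L n @ \<tau>) X" "X \<subseteq> prod_set (tuples M (main_power L n)) Y"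
  shows "decomp (is_cell_over L M n \<tau> Y) X"
  using n X
proof (induction n arbitrary: X rule: nat_induct_at_least)
  case base
  have M': "is_struct L M" using M by (simp add: is_model_def)
  have X: "dfn L M (main_sort L # \<tau>) X" using base by simp
  have "is_cell_over L M 1 \<tau> Y C" if C: "C \<subseteq> X" "fiber_cell L M \<tau> j C \<rho> g" for C j \<rho> g
  proof -
    note C' = C(2)[unfolded fiber_cell_def]
    \<comment> \<open>A presentation need not be surjective, so all tuples of the auxiliary sorts
      can serve as \<open>S\<close>.\<close>
    have "cell1 L M \<tau> Y j C \<rho> (tuples M \<rho>) (\<lambda>z. g z @ tl z)"
    proof (rule cell1I[OF M' Y, where g = g])
      show "aux_set L M \<rho> (tuples M \<rho>)" using C' dfn_tuples[OF M'] by (simp add: aux_set_def)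
      show "y \<in> Y" if "m # y \<in> C" for m y
        using that C(1) base(2) by (auto simp: prod_set_def tuples_Cons dest!: subsetD)
    qed (use C' in \<open>auto simp: image_subset_iff\<close>)
    then have "cell L M \<tau> Y [j] C \<rho> (tuples M \<rho>) (\<lambda>z. g z @ tl z)" by (rule cell_base)
    moreover have "length [j] = 1" by simp
    ultimately show ?thesis unfolding is_cell_over_def by blast
  qed
  note is_cell = this
  show ?case
  proof (rule decomp_mono[OF decomp_restrict[OF fiberwise_decomp[OF L T M X]]])
    show "is_cell_over L M 1 \<tau> Y C" if "C \<subseteq> X \<and> (\<exists>j \<rho> g. fiber_cell L M \<tau> j C \<rho> g)" for C
      using that is_cell by blast
  qed
next
  case (Suc n)
  let ?m = "main_sort L" and ?p = "main_power L n"
  have M': "is_struct L M" using M by (simp add: is_model_def)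
  have XE: "\<exists>x m y. z = x @ m # y \<and> x \<in> tuples M ?p \<and> length x = n \<and> m \<in> univ M ?m \<and> y \<in> Y \<and> y \<in> tuples M \<tau>"
    if z: "z \<in> X" for z
  proof -
    obtain x' y where xy: "z = x' @ y" "x' \<in> tuples M (?p @ [?m])" "y \<in> Y"
      using z Suc.prems(2) unfolding prod_set_def main_power_Suc by blast
    obtain x m where x: "x' = x @ [m]" "x \<in> tuples M ?p" "m \<in> univ M ?m"
      using xy(2) unfolding tuples_append by (auto simp: tuples_Cons)
    have "z = x @ m # y" "length x = n" "y \<in> tuples M \<tau>"
      using xy x tuples_length[OF x(2)] definable_subset[OF Y] by auto
    with x(2,3) xy(3) show ?thesis by blast
  qed
  have XD: "x \<in> tuples M ?p \<and> m \<in> univ M ?m \<and> y \<in> Y \<and> y \<in> tuples M \<tau>"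
    if xmy: "x @ m # y \<in> X" "length x = n" for x m y
  proof -
    obtain x1 m1 y1 where e: "x @ m # y = x1 @ m1 # y1" "x1 \<in> tuples M ?p" "length x1 = n"
      "m1 \<in> univ M ?m" "y1 \<in> Y" "y1 \<in> tuples M \<tau>" using XE[OF xmy(1)] by blast
    then have "x = x1 \<and> m # y = m1 # y1" using xmy(2) by simp
    with e show ?thesis by simp
  qed
  \<comment> \<open>\<open>fiberwise_decomp\<close> works along the first entry, so the last main
    coordinate is brought to the front; \<open>h\<close> below does the same to a single
    point.\<close>
  define X' where "X' = {m # x @ y |m x y. length x = n \<and> x @ m # y \<in> X}"
  have X': "dfn L M (?m # ?p @ \<tau>) X'"
  proof (rule bdef_dfn)
    show "bdef L M [[?m], ?p, \<tau>] (\<lambda>bs. bs ! 1 @ bs ! 0 @ bs ! 2 \<in> X)"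
      by (rule bdef_mem[OF Suc.prems(1), of _ "[1, 0, 2]"]) (auto simp: main_power_Suc)
    fix w
    show "w \<in> X' \<longleftrightarrow> (\<exists>bs\<in>blocks M [[?m], ?p, \<tau>]. w = concat bs \<and> bs ! 1 @ bs ! 0 @ bs ! 2 \<in> X)"
    proof
      assume "w \<in> X'"
      then obtain m x y where e: "w = m # x @ y" "length x = n" "x @ m # y \<in> X" unfolding X'_def by blast
      then have "x \<in> tuples M ?p" "m \<in> univ M ?m" "y \<in> tuples M \<tau>"
        using XD[OF e(3,2)] by auto
      then show "\<exists>bs\<in>blocks M [[?m], ?p, \<tau>]. w = concat bs \<and> bs ! 1 @ bs ! 0 @ bs ! 2 \<in> X"
        unfolding bex_blocks bex_tuples_single using e
        by (intro bexI[of _ m] bexI[of _ x] bexI[of _ y]) auto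
    next
      assume "\<exists>bs\<in>blocks M [[?m], ?p, \<tau>]. w = concat bs \<and> bs ! 1 @ bs ! 0 @ bs ! 2 \<in> X"
      then obtain m x y where "x \<in> tuples M ?p" "w = m # x @ y" "x @ m # y \<in> X"
        unfolding bex_blocks bex_tuples_single by auto
      then show "w \<in> X'" using tuples_length[of x M ?p] unfolding X'_def by auto
    qed
  qed simp
  define h where "h z = z ! n # take n z @ drop (Suc n) z" for z :: "'u list"
  have hx: "h (x @ m # y) = m # x @ y" if "length x = n" for x m y using that nth_append_length[of x m y] by (simp add: h_def)
  show ?case
  proof (rule decomp_vimage[OF fiberwise_decomp[OF L T M X'], where h = h])
    show "h z \<in> X'" if z: "z \<in> X" for z
    proof -
      obtain x m y where "z = x @ m # y" "length x = n" using XE[OF z] by blast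
      then show ?thesis using z hx unfolding X'_def by auto
    qed
    fix C assume CX: "C \<subseteq> X'" and "\<exists>j \<rho> g. fiber_cell L M (?p @ \<tau>) j C \<rho> g"
    then obtain j \<rho> g where C: "fiber_cell L M (?p @ \<tau>) j C \<rho> g" by blast
    have Cd: "dfn L M (?m # ?p @ \<tau>) C" using C by (simp add: fiber_cell_def)
    \<comment> \<open>The induction hypothesis is applied to the projection of the piece, not to
      that of \<open>X\<close>, so that the cells obtained lie entirely under
      \<open>C\<close>.\<close>
    define B where "B = {w. \<exists>m. m # w \<in> C}"
    have CE: "\<exists>x y. w = x @ y \<and> length x = n \<and> x \<in> tuples M ?p \<and> y \<in> Y \<and> y \<in> tuples M \<tau> \<and> m \<in> univ M ?m \<and> x @ m # y \<in> X"
      if mw: "m # w \<in> C" for m w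
    proof -
      obtain x y where e: "w = x @ y" "length x = n" "x @ m # y \<in> X" using mw CX unfolding X'_def by auto
      then show ?thesis using XD[OF e(3,2)] by blast
    qed
    have Bd: "dfn L M (?p @ \<tau>) B"
    proof -
      have "bdef L M ([?p @ \<tau>] @ [[?m]]) (\<lambda>bs. bs ! 1 @ bs ! 0 \<in> C)"
        by (rule bdef_mem[OF Cd, of _ "[1, 0]"]) auto
      then show ?thesis
      proof (rule bdef_dfn[OF bdef_ex])
        show "w \<in> B \<longleftrightarrow> (\<exists>bs\<in>blocks M [?p @ \<tau>]. w = concat bs \<and>
            (\<exists>b\<in>tuples M [?m]. (bs @ [b]) ! 1 @ (bs @ [b]) ! 0 \<in> C))" for w
        proof -
          have "w \<in> tuples M (?p @ \<tau>) \<and> m \<in> univ M ?m" if "m # w \<in> C" for m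
            using subsetD[OF definable_subset[OF Cd] that] by (auto simp: tuples_Cons)
          then show ?thesis unfolding bex_blocks bex_tuples_single B_def by auto
        qed
      qed simp
    qed
    have BY: "B \<subseteq> prod_set (tuples M ?p) Y" using CE unfolding B_def prod_set_def by blast
    show "decomp (is_cell_over L M (Suc n) \<tau> Y) {z \<in> X. h z \<in> C}"
    proof (rule decomp_vimage[OF Suc.IH[OF Bd BY], where h = "tl \<circ> h"])
      show "(tl \<circ> h) z \<in> B" if "z \<in> {z \<in> X. h z \<in> C}" for z using that by (auto simp: B_def h_def)
      fix Z assume ZB: "Z \<subseteq> B" and "is_cell_over L M n \<tau> Y Z"
      then obtain js \<rho>' S' f' where Z: "cell L M \<tau> Y js Z \<rho>' S' f'" "length js = n"
        unfolding is_cell_over_def by blast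
      have E: "{z \<in> {z \<in> X. h z \<in> C}. (tl \<circ> h) z \<in> Z} =
          {x @ m # y |x m y. length x = n \<and> m # x @ y \<in> C \<and> x @ y \<in> Z}" (is "?E = ?E'")
      proof (intro set_eqI iffI)
        fix z assume z: "z \<in> ?E"
        then obtain x m y where "z = x @ m # y" "length x = n" using XE by blast
        then show "z \<in> ?E'" using z hx by auto
      next
        fix z assume "z \<in> ?E'"
        then obtain x m y where z: "z = x @ m # y" "length x = n" "m # x @ y \<in> C" "x @ y \<in> Z" by blast
        moreover have "x @ m # y \<in> X"
        proof -
          obtain x1 y1 where "x @ y = x1 @ y1" "length x1 = n" "x1 @ m # y1 \<in> X" using CE[OF z(3)] by blast
          then show ?thesis using z(2) by simp
        qed
        ultimately show "z \<in> ?E" using hx by simp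
      qed
      \<comment> \<open>\<open>Z \<subseteq> B\<close> provides a point of \<open>C\<close> above
        each point of \<open>Z\<close>.\<close>
      have "\<exists>\<rho> S f. cell L M \<tau> Y (js @ [j]) ?E \<rho> S f"
        by (rule cell_stepI[OF M' Y C Z _ E]) (use ZB in \<open>auto simp: B_def\<close>)
      moreover have "length (js @ [j]) = Suc n" using Z(2) by simp
      ultimately have "is_cell_over L M (Suc n) \<tau> Y ?E" unfolding is_cell_over_def by blast
      then show "decomp (is_cell_over L M (Suc n) \<tau> Y) ?E" by (rule decomp_single)
    qed
  qed
qed

theorem theorem3p7:
  fixes L :: "('s, 'f, 'r) lang"
    and T :: "('s, 'f, 'r) fm set"
    and M :: "('s, 'f, 'r, 'u) struct"
    and \<tau> :: "'s list"
    and X Y :: "'u list set"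
    and n :: nat
  assumes "language L"
    and "is_theory L T"
    and "b_minimal_theory TYPE(('s, 'f, 'r, 'u) big) L T"
    and "is_model L T M"
    and "n \<ge> 1"
    and "definable L M (params M) \<tau> Y"
    and "definable L M (params M) (main_power L n @ \<tau>) X"
    and "X \<subseteq> prod_set (tuples M (main_power L n)) Y"
  shows "\<exists>P. finite P \<and> partition_on X P \<and> (\<forall>C\<in>P. is_cell_over L M n \<tau> Y C)"
  using cell_decomposition[OF assms(1,3,4,6,5,7,8)] unfolding decomp_def .

end
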